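(* Let $\mathcal{X}$ be an open subset of $\mathbb{R}^d$, $\Theta\subset\mathbb{R}$, $\alpha>0$. Let $\mathcal{P}=(P_\theta)_{\theta\in\Theta}$ be a model on $\mathcal{X}$ with Lebesgue densities $p_\theta$, DQM at an interior point $\theta_0$ of $\Theta$ with score function $s_{\theta_0}$ such that $\mathbb{E}_{\theta_0}[s_{\theta_0}(X)^2]<\infty$. Let $\mathcal{J}^{\max,\alpha}_{\theta_0}:=\sup_{q\in\mathcal{Q}_\alpha}\mathcal{I}_{\theta_0}(q\circ\mathcal{P})$. Then there exists a Radon sub-probability measure $\overline{\mu}$ on $\mathcal{E}$, satisfying $\int_{\mathcal{E}}e_x(r)\,\overline{\mu}(dr)=1$ for almost every $x\in\mathcal{X}$, such that the mechanism $q^{(\overline{\mu})}$ from $\mathcal{X}$ to $\mathcal{E}$ defined by $q^{(\overline{\mu})}_x(dr):=e_x(r)\,\overline{\mu}(dr)$ satisfies $$\mathcal{J}^{\max,\alpha}_{\theta_0}=\mathcal{I}_{\theta_0}\left(q^{(\overline{\mu})}\circ\mathcal{P}\right).$$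
   Context: "Almost every" refers to Lebesgue measure. Let $C=\{v:\mathcal{X}\to\mathbb{R}\text{ measurable}: 1\le v(x)\le e^\alpha\text{ a.e.}\}\subset L^\infty(\mathcal{X},\mathbb{R})$, equipped with the weak-$\star$ topology $\sigma(L^\infty,L^1)$ (for which it is compact and metrizable) and its Borel $\sigma$-algebra, and let $\mathcal{E}=\{r:\mathcal{X}\to\mathbb{R}\text{ measurable}: r(x)\in\{1,e^\alpha\}\text{ a.e.}\}\subset C$, the set of extreme points of $C$, a Borel ($G_\delta$) subset. Functions are identified when equal a.e. Evaluation operator: $e_x(r)=\limsup_{\epsilon\to0}\frac{1}{|B(x,\epsilon)|}\int_{B(x,\epsilon)\cap\mathcal{X}}r(y)\,dy$ for $x\in\mathcal{X}$, $r\in C$; it is jointly measurable and for each $r$, $e_x(r)=r(x)$ for a.e. $x$. DQM (differentiability in quadratic mean): a model with densities $p_\theta$ with respect to a measure $\lambda$, $\Theta\subset\mathbb{R}$, is DQM at an interior point $\theta_0$ with measurable score function $s_{\theta_0}$ if $\int\left(\sqrt{p_{\theta_0+h}}-\sqrt{p_{\theta_0}}-\tfrac12 h\,s_{\theta_0}\sqrt{p_{\theta_0}}\right)^2d\lambda=o(h^2)$ as $h\to0$; its Fisher information at $\theta_0$ is $\int s_{\theta_0}^2\,p_{\theta_0}\,d\lambda$. $\mathcal{Q}_\alpha$ is the set of $\alpha$-LDP mechanisms from $\mathcal{X}$ to some finite or countable output space $\mathcal{Z}$, i.e. families $q_x(z)$, measurable in $x$, with $q_x$ a probability mass function on $\mathcal{Z}$,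 such that for all $z$, $q_x(z)\le e^\alpha q_{x'}(z)$ for $dx\,dx'$-a.e. $(x,x')$. For $q\in\mathcal{Q}_\alpha$, $q\circ\mathcal{P}$ is the model on $\mathcal{Z}$ with mass functions $\widetilde p_\theta(z)=\int_{\mathcal{X}}q_x(z)p_\theta(x)\,dx$; it is DQM at $\theta_0$ with score $t_{\theta_0}(z)=\widetilde p_{\theta_0}(z)^{-1}\int_{\mathcal{X}}s_{\theta_0}(x)q_x(z)p_{\theta_0}(x)\,dx$. For a mechanism $q^{(\mu)}_x(dr)=e_x(r)\mu(dr)$ into $\mathcal{E}$, $q^{(\mu)}\circ\mathcal{P}$ is the model on $\mathcal{E}$ with $\mu$-densities $\widetilde p_\theta(r)=\int_{\mathcal{X}}r(x)p_\theta(x)\,dx$; it is DQM at $\theta_0$ with score $t_{\theta_0}(r)=\widetilde p_{\theta_0}(r)^{-1}\int_{\mathcal{X}}s_{\theta_0}(x)r(x)p_{\theta_0}(x)\,dx$. In both cases $\mathcal{I}_{\theta_0}$ denotes the corresponding Fisher information. *)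

theory Defs
  imports "HOL-Probability.Probability"
begin

section \<open>Models, differentiability in quadratic mean, Fisher information\<close>

definition density_model :: "'b measure \<Rightarrow> real set \<Rightarrow> (real \<Rightarrow> 'b \<Rightarrow> real) \<Rightarrow> bool" where
  "density_model L \<Theta> p \<longleftrightarrow>
     (\<forall>\<theta>\<in>\<Theta>. p \<theta> \<in> borel_measurable L \<and> (\<forall>x\<in>space L. 0 \<le> p \<theta> x) \<and>
        prob_space (density L (\<lambda>x. ennreal (p \<theta> x))))"

text \<open>The Bochner integral of a non-integrable function is 0, so integrability of the squared
  remainder has to be required explicitly. As \<open>\<theta>0\<close> is interior, \<open>\<theta>0 + h\<close> lies in
  \<open>\<Theta>\<close> for all small \<open>h\<close>, and the values of \<open>p\<close> outside \<open>\<Theta>\<close> do not matter.\<close>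

definition DQM ::
  "'b measure \<Rightarrow> real set \<Rightarrow> (real \<Rightarrow> 'b \<Rightarrow> real) \<Rightarrow> real \<Rightarrow> ('b \<Rightarrow> real) \<Rightarrow> bool" where
  "DQM L \<Theta> p \<theta>0 s \<longleftrightarrow>
     \<theta>0 \<in> interior \<Theta> \<and> s \<in> borel_measurable L \<and>
     (\<forall>\<^sub>F h in at 0. integrable L
        (\<lambda>x. (sqrt (p (\<theta>0 + h) x) - sqrt (p \<theta>0 x) - 1/2 * h * s x * sqrt (p \<theta>0 x))\<^sup>2)) \<and>
     (\<lambda>h. \<integral>x. (sqrt (p (\<theta>0 + h) x) - sqrt (p \<theta>0 x) - 1/2 * h * s x * sqrt (p \<theta>0 x))\<^sup>2 \<partial>L)
       \<in> o[at 0](\<lambda>h. h\<^sup>2)"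

text \<open>A score is only determined up to null sets of \<open>p \<theta>0\<close>, so the Fisher information does
  not depend on the choice made here; see \<open>fisher_information_eq\<close> below.\<close>

definition fisher_information ::
  "'b measure \<Rightarrow> real set \<Rightarrow> (real \<Rightarrow> 'b \<Rightarrow> real) \<Rightarrow> real \<Rightarrow> ennreal" where
  "fisher_information L \<Theta> p \<theta>0 =
     (let s = (SOME s. DQM L \<Theta> p \<theta>0 s) in \<integral>\<^sup>+x. ennreal ((s x)\<^sup>2 * p \<theta>0 x) \<partial>L)"

lemma DQM_score_unique:
  assumes s: "DQM L \<Theta> p \<theta>0 s" and t: "DQM L \<Theta> p \<theta>0 t"
    and p [measurable]: "p \<theta>0 \<in> borel_measurable L"
  shows "AE x in L. s x * sqrt (p \<theta>0 x) = t x * sqrt (p \<theta>0 x)"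
proof -
  define R where "R u h x = sqrt (p (\<theta>0 + h) x) - sqrt (p \<theta>0 x) - 1/2 * h * u x * sqrt (p \<theta>0 x)"
    for u :: "'a \<Rightarrow> real" and h x
  define D where "D x = (s x * sqrt (p \<theta>0 x) - t x * sqrt (p \<theta>0 x))\<^sup>2" for x
  have [measurable]: "s \<in> borel_measurable L" "t \<in> borel_measurable L"
    using s t by (auto simp: DQM_def)
  have D_meas [measurable]: "D \<in> borel_measurable L"
    unfolding D_def by measurable
  have int_ev: "\<forall>\<^sub>F h in at 0. integrable L (\<lambda>x. (R s h x)\<^sup>2) \<and> integrable L (\<lambda>x. (R t h x)\<^sup>2)"
    using s t by (auto simp: DQM_def R_def eventually_conj_iff)
  have o_small: "(\<lambda>h. (\<integral>x. (R s h x)\<^sup>2 \<partial>L) + (\<integral>x. (R t h x)\<^sup>2 \<partial>L)) \<in> o[at 0](\<lambda>h. h\<^sup>2)"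
    using s t unfolding DQM_def R_def by (intro sum_in_smallo) auto
  have D_le: "h\<^sup>2 * D x \<le> 8 * ((R s h x)\<^sup>2 + (R t h x)\<^sup>2)" for h x
  proof -
    have eq: "h * (s x * sqrt (p \<theta>0 x) - t x * sqrt (p \<theta>0 x)) = 2 * (R t h x - R s h x)"
      by (simp add: R_def algebra_simps)
    have "h\<^sup>2 * D x = 4 * (R t h x - R s h x)\<^sup>2"
      unfolding D_def using arg_cong[OF eq, of "\<lambda>z. z\<^sup>2"] by (simp only: power_mult_distrib) simp
    also have "\<dots> \<le> 8 * ((R s h x)\<^sup>2 + (R t h x)\<^sup>2)"
      using zero_le_power2[of "R s h x + R t h x"] by (simp add: power2_eq_square algebra_simps)
    finally show ?thesis .
  qed
  have D_int: "integrable L D"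
  proof -
    have "\<forall>\<^sub>F h in at (0::real). h \<noteq> 0" by (simp add: eventually_at_filter)
    from eventually_happens'[OF trivial_limit_at eventually_conj[OF int_ev this]]
    obtain h where h: "integrable L (\<lambda>x. (R s h x)\<^sup>2)" "integrable L (\<lambda>x. (R t h x)\<^sup>2)" "h \<noteq> 0"
      by blast
    have "integrable L (\<lambda>x. h\<^sup>2 * D x)"
      by (rule Bochner_Integration.integrable_bound[where f = "\<lambda>x. 8 * ((R s h x)\<^sup>2 + (R t h x)\<^sup>2)"])
         (use h D_le in \<open>auto simp: D_def\<close>)
    then have "integrable L (\<lambda>x. (1 / h\<^sup>2) * (h\<^sup>2 * D x))" by (rule integrable_mult_right)
    then show ?thesis using h by simp
  qed
  have "(\<integral>x. D x \<partial>L) \<le> 0"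
  proof (rule field_le_epsilon)
    fix e :: real assume "e > 0"
    have "\<forall>\<^sub>F h in at 0. norm ((\<integral>x. (R s h x)\<^sup>2 \<partial>L) + (\<integral>x. (R t h x)\<^sup>2 \<partial>L)) \<le> e/8 * norm (h\<^sup>2)"
      using landau_o.smallD[OF o_small, of "e/8"] \<open>e > 0\<close> by simp
    moreover have "\<forall>\<^sub>F h in at (0::real). h \<noteq> 0" by (simp add: eventually_at_filter)
    ultimately have "\<forall>\<^sub>F h in at 0. norm ((\<integral>x. (R s h x)\<^sup>2 \<partial>L) + (\<integral>x. (R t h x)\<^sup>2 \<partial>L))
        \<le> e/8 * norm (h\<^sup>2) \<and> h \<noteq> 0 \<and> integrable L (\<lambda>x. (R s h x)\<^sup>2) \<and> integrable L (\<lambda>x. (R t h x)\<^sup>2)"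
      using int_ev by eventually_elim simp
    from eventually_happens'[OF trivial_limit_at this] obtain h where
      h: "norm ((\<integral>x. (R s h x)\<^sup>2 \<partial>L) + (\<integral>x. (R t h x)\<^sup>2 \<partial>L)) \<le> e/8 * norm (h\<^sup>2)" "h \<noteq> 0"
        "integrable L (\<lambda>x. (R s h x)\<^sup>2)" "integrable L (\<lambda>x. (R t h x)\<^sup>2)"
      by blast
    have "h\<^sup>2 * (\<integral>x. D x \<partial>L) = (\<integral>x. h\<^sup>2 * D x \<partial>L)" by simp
    also have "\<dots> \<le> (\<integral>x. 8 * ((R s h x)\<^sup>2 + (R t h x)\<^sup>2) \<partial>L)"
      by (rule integral_mono) (use h D_int D_le in auto)
    also have "\<dots> = 8 * ((\<integral>x. (R s h x)\<^sup>2 \<partial>L) + (\<integral>x. (R t h x)\<^sup>2 \<partial>L))"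
      using h by simp
    also have "\<dots> \<le> h\<^sup>2 * e" using h(1) by (simp add: algebra_simps)
    finally show "(\<integral>x. D x \<partial>L) \<le> 0 + e" using h(2) by simp
  qed
  moreover have "(\<integral>x. D x \<partial>L) \<ge> 0" by (simp add: D_def)
  ultimately have "(\<integral>x. D x \<partial>L) = 0" by simp
  then have "AE x in L. D x = 0"
    using integral_nonneg_eq_0_iff_AE[OF D_int] by (simp add: D_def[abs_def])
  then show ?thesis by (simp add: D_def)
qed

lemma fisher_information_eq:
  assumes s: "DQM L \<Theta> p \<theta>0 s" and p: "p \<theta>0 \<in> borel_measurable L"
  shows "fisher_information L \<Theta> p \<theta>0 = (\<integral>\<^sup>+x. ennreal ((s x)\<^sup>2 * p \<theta>0 x) \<partial>L)"
proof -
  define t where "t = (SOME s. DQM L \<Theta> p \<theta>0 s)"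
  have "DQM L \<Theta> p \<theta>0 t" unfolding t_def by (rule someI[of "DQM L \<Theta> p \<theta>0", OF s])
  from DQM_score_unique[OF this s p]
  have "AE x in L. ennreal ((t x)\<^sup>2 * p \<theta>0 x) = ennreal ((s x)\<^sup>2 * p \<theta>0 x)"
    by eventually_elim (auto simp: mult_right_cancel)
  then show ?thesis
    unfolding fisher_information_def Let_def t_def[symmetric] by (rule nn_integral_cong_AE)
qed


section \<open>Private mechanisms with countable output\<close>

text \<open>Up to relabelling, every finite or countable output space is a set of natural numbers.\<close>

definition LDP_mechanisms ::
  "'a::euclidean_space set \<Rightarrow> real \<Rightarrow> (nat set \<times> ('a \<Rightarrow> nat pmf)) set" where
  "LDP_mechanisms X \<alpha> = {(Z, q).
     (\<forall>x\<in>X. set_pmf (q x) \<subseteq> Z) \<and>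
     (\<forall>z\<in>Z. (\<lambda>x. pmf (q x) z) \<in> borel_measurable (lebesgue_on X)) \<and>
     (\<forall>z\<in>Z. AE (x, x') in lebesgue_on X \<Otimes>\<^sub>M lebesgue_on X.
        pmf (q x) z \<le> exp \<alpha> * pmf (q x') z)}"

definition privatized_density ::
  "'a::euclidean_space set \<Rightarrow> (real \<Rightarrow> 'a \<Rightarrow> real) \<Rightarrow> ('a \<Rightarrow> nat pmf) \<Rightarrow> real \<Rightarrow> nat \<Rightarrow> real" where
  "privatized_density X p q \<theta> z = (\<integral>x. pmf (q x) z * p \<theta> x \<partial>lebesgue_on X)"

definition max_private_information ::
  "'a::euclidean_space set \<Rightarrow> real \<Rightarrow> real set \<Rightarrow> (real \<Rightarrow> 'a \<Rightarrow> real) \<Rightarrow> real \<Rightarrow> ennreal" where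
  "max_private_information X \<alpha> \<Theta> p \<theta>0 =
     (SUP (Z, q)\<in>LDP_mechanisms X \<alpha>.
        fisher_information (count_space Z) \<Theta> (privatized_density X p q) \<theta>0)"


section \<open>Extreme points and the weak-star topology\<close>

text \<open>Elements of \<open>L\<^sup>\<infinity>\<close> are genuine equivalence classes of measurable functions; the
  values of representatives outside \<open>X\<close> are irrelevant.\<close>

definition ae_rel :: "'a::euclidean_space set \<Rightarrow> (('a \<Rightarrow> real) \<times> ('a \<Rightarrow> real)) set" where
  "ae_rel X = {(f, g). f \<in> borel_measurable (lebesgue_on X) \<and> g \<in> borel_measurable (lebesgue_on X) \<and>
     (AE x in lebesgue_on X. f x = g x)}"

definition Linfty :: "'a::euclidean_space set \<Rightarrow> ('a \<Rightarrow> real) set set" where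
  "Linfty X = {f \<in> borel_measurable (lebesgue_on X).
     \<exists>B. AE x in lebesgue_on X. \<bar>f x\<bar> \<le> B} // ae_rel X"

definition extreme_functions :: "'a::euclidean_space set \<Rightarrow> real \<Rightarrow> ('a \<Rightarrow> real) set set" where
  "extreme_functions X \<alpha> = {r \<in> borel_measurable (lebesgue_on X).
     AE x in lebesgue_on X. r x \<in> {1, exp \<alpha>}} // ae_rel X"

definition rep :: "('a \<Rightarrow> real) set \<Rightarrow> 'a \<Rightarrow> real" where
  "rep c = (SOME f. f \<in> c)"

definition pairing :: "'a::euclidean_space set \<Rightarrow> ('a \<Rightarrow> real) set \<Rightarrow> ('a \<Rightarrow> real) \<Rightarrow> real" where
  "pairing X c g = (\<integral>x. rep c x * g x \<partial>lebesgue_on X)"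

definition weak_star :: "'a::euclidean_space set \<Rightarrow> ('a \<Rightarrow> real) set topology" where
  "weak_star X = topology_generated_by
     {{c \<in> Linfty X. pairing X c g \<in> U} | g U. integrable (lebesgue_on X) g \<and> open U}"

text \<open>The set \<open>C\<close> of classes with values in \<open>[1, exp \<alpha>]\<close> is not needed separately: the topology
  and the Borel sets which \<open>extreme_functions X \<alpha>\<close> inherits from \<open>C\<close> are those inherited
  from \<open>Linfty X\<close>.\<close>

definition extreme_topology :: "'a::euclidean_space set \<Rightarrow> real \<Rightarrow> ('a \<Rightarrow> real) set topology" where
  "extreme_topology X \<alpha> = subtopology (weak_star X) (extreme_functions X \<alpha>)"

definition evaluation :: "'a::euclidean_space set \<Rightarrow> 'a \<Rightarrow> ('a \<Rightarrow> real) set \<Rightarrow> real" where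
  "evaluation X x c = real_of_ereal (Limsup (at_right 0) (\<lambda>\<epsilon>.
     ereal (1 / measure lebesgue (ball x \<epsilon>) * (\<integral>y. rep c y \<partial>lebesgue_on (ball x \<epsilon> \<inter> X)))))"

definition radon_measure :: "'b topology \<Rightarrow> 'b measure \<Rightarrow> bool" where
  "radon_measure T M \<longleftrightarrow>
     space M = topspace T \<and>
     sets M = sigma_sets (topspace T) {U. openin T U} \<and>
     (\<forall>x\<in>topspace T. \<exists>U. openin T U \<and> x \<in> U \<and> emeasure M U < \<infinity>) \<and>
     (\<forall>A\<in>sets M. emeasure M A = (SUP K\<in>{K. compactin T K \<and> K \<subseteq> A}. emeasure M K))"

text \<open>The mechanism \<open>q\<^sub>x(dr) = e\<^sub>x(r) \<mu>(dr)\<close> has kernel density \<open>e\<^sub>x(r)\<close> with respect to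
  \<open>\<mu>\<close>. Since \<open>e\<^sub>x(r) = r(x)\<close> for almost every \<open>x\<close>, the privatized model has
  \<open>\<mu>\<close>-density \<open>r \<mapsto> \<integral> r(x) p\<^sub>\<theta>(x) dx\<close>.\<close>

definition extremal_density ::
  "'a::euclidean_space set \<Rightarrow> (real \<Rightarrow> 'a \<Rightarrow> real) \<Rightarrow> real \<Rightarrow> ('a \<Rightarrow> real) set \<Rightarrow> real" where
  "extremal_density X p \<theta> r = pairing X r (p \<theta>)"

end

theory Submission
  imports Defs
begin

text \<open>
  The supremum of the Fisher information is attained by a finite randomized response, so that
  the measure \<open>\<mu>\<close> can be taken to be a finite sum of equal point masses. Write \<open>E = exp \<alpha>\<close>,
  \<open>P\<close> for the law with density \<open>p \<theta>0\<close> and \<open>u\<^sub>t(\<sigma>) = 2 t \<sigma> - t\<^sup>2\<close>. An output with kernel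
  \<open>v\<close> contributes \<open>(\<integral> s v dP)\<^sup>2 / \<integral> v dP = Max\<^sub>t \<integral> u\<^sub>t(s) v dP\<close> to the information, the
  maximum being attained at the private score. A mechanism with kernels \<open>v\<^sub>z\<close> thus has
  information \<open>Max\<^sub>t \<Sum>\<^sub>z \<integral> u\<^bsub>t(z)\<^esub>(s) v\<^sub>z dP\<close>, and privacy says that, for some constant
  \<open>c\<^sub>z\<close>, almost all values of \<open>v\<^sub>z\<close> lie in \<open>[c\<^sub>z, E c\<^sub>z]\<close>.

  Given a finite list of levels \<open>t\<^sub>0, \<dots>, t\<^bsub>n-1\<^esub>\<close> (a codebook), let \<open>A\<^sub>i\<close> be the set of those \<open>x\<close>
  for which \<open>t\<^sub>i\<close> is the level closest to \<open>s(x)\<close>, i.e. maximizes \<open>u\<^sub>t(s(x))\<close>, and the first one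
  in case of a tie. Putting out \<open>i\<close> with probability \<open>c (1 + (E - 1) 1\<^bsub>A\<^sub>i\<^esub>(x))\<close>, where \<open>c = 1 / (E - 1 + n)\<close>, is a private
  mechanism. Since the score has mean zero, its information is at least
  \<open>((E - 1) \<integral> Max\<^sub>i u\<^bsub>t\<^sub>i\<^esub>(s) dP - \<Sum>\<^sub>i t\<^sub>i\<^sup>2) / (E - 1 + n)\<close>, the value of the codebook.

  Conversely, the information of every mechanism is at most the supremum \<open>K\<close> of these values
  (lemmas \<open>weighted_gain_le_fold\<close> and \<open>finite_mechanism_gain_le\<close>). Put \<open>C = \<Sum> c\<^sub>z\<close> and
  \<open>v\<^sub>z = c\<^sub>z + (E - 1) w\<^sub>z\<close>, so that \<open>0 \<le> w\<^sub>z \<le> c\<^sub>z\<close> and \<open>\<Sum> w\<^sub>z = C k\<close> with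
  \<open>C (1 + (E - 1) k) = 1\<close>. Let \<open>T\<close> be the quantile function on \<open>(0, 1)\<close> of the levels \<open>t(z)\<close> with
  weights \<open>c\<^sub>z / C\<close>. For a fixed value \<open>\<sigma>\<close> of the score, the sum \<open>\<Sum> w\<^sub>z u\<^bsub>t(z)\<^esub>(\<sigma>)\<close> is largest
  when the mass \<open>C k\<close> is spent on the levels closest to \<open>\<sigma>\<close>. As \<open>T\<close> is monotone, these levels
  are the values of \<open>T\<close> on an interval of length \<open>k\<close>. For almost every \<open>y \<in> (0, k)\<close> such an
  interval contains exactly one of the points \<open>y, y + k, y + 2 k, \<dots>\<close>, whence the sum is at most
  \<open>C \<integral>\<^sub>0\<^sup>k Max\<^sub>j u\<^bsub>T(y + j k)\<^esub>(\<sigma>) dy\<close>. Thus the mechanism is dominated by a mixture over \<open>y\<close> of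
  codebooks \<open>T(y), T(y + k), \<dots>\<close>, and its information by \<open>K\<close>.

  The supremum \<open>K\<close> is attained (lemma \<open>codebook_value_attained\<close>): values are at most
  \<open>(E - 1) \<integral> s\<^sup>2 dP / (E - 1 + n)\<close>, which leaves finitely many lengths \<open>n\<close>, and for each of
  them a compact set of levels.

  The definitions of the information require, in addition, that privatized models are
  differentiable in quadratic mean, which follows from the differentiability of the norm of a
  Hilbert space away from zero (lemma \<open>privatized_DQM\<close>). For the optimal mechanism, \<open>\<mu>\<close> puts
  mass \<open>c\<close> on the class of each function \<open>1 + (E - 1) 1\<^bsub>A\<^sub>i\<^esub>\<close>. The evaluation operator recovers
  these functions almost everywhere by the Lebesgue density theorem.
\<close>

section \<open>The supporting parabola and the rearranged mechanism\<close>

text \<open>The tangent at \<open>t\<close> of the parabola \<open>\<sigma>\<^sup>2\<close>, evaluated at \<open>\<sigma>\<close>. It equals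
  \<open>\<sigma>\<^sup>2 - (\<sigma> - t)\<^sup>2\<close>: the closer the level \<open>t\<close> to \<open>\<sigma>\<close>, the larger the gain.\<close>

definition gain :: "real \<Rightarrow> real \<Rightarrow> real" where
  "gain t \<sigma> = 2 * t * \<sigma> - t\<^sup>2"

lemma gain_le_square: "gain t \<sigma> \<le> \<sigma>\<^sup>2"
  using zero_le_power2[of "\<sigma> - t"] by (simp add: gain_def power2_eq_square algebra_simps)

lemma abs_gain_le: "\<bar>t\<bar> \<le> B \<Longrightarrow> \<bar>gain t \<sigma>\<bar> \<le> 2 * B * \<bar>\<sigma>\<bar> + B\<^sup>2"
proof -
  assume t: "\<bar>t\<bar> \<le> B"
  have "\<bar>gain t \<sigma>\<bar> \<le> \<bar>2 * t * \<sigma>\<bar> + \<bar>t\<^sup>2\<bar>" unfolding gain_def by linarith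
  also have "\<bar>2 * t * \<sigma>\<bar> \<le> 2 * B * \<bar>\<sigma>\<bar>" using t by (simp add: abs_mult mult_right_mono)
  also have "\<bar>t\<^sup>2\<bar> \<le> B\<^sup>2" using t by (metis abs_ge_zero abs_power2 power2_abs power_mono)
  finally show ?thesis by simp
qed

lemma borel_measurable_gain [measurable (raw)]:
  assumes [measurable]: "f \<in> borel_measurable M" "g \<in> borel_measurable M"
  shows "(\<lambda>x. gain (f x) (g x)) \<in> borel_measurable M"
  unfolding gain_def by measurable

lemma gain_mono_towards: "t' \<le> t \<Longrightarrow> t + t' \<le> 2 * \<sigma> \<Longrightarrow> gain t' \<sigma> \<le> gain t \<sigma>"
proof -
  assume "t' \<le> t" "t + t' \<le> 2 * \<sigma>"
  then have "0 \<le> (t - t') * (2 * \<sigma> - t - t')" by simp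
  then show ?thesis by (simp add: gain_def power2_eq_square algebra_simps)
qed

lemma gain_mono_away: "t \<le> t' \<Longrightarrow> 2 * \<sigma> \<le> t + t' \<Longrightarrow> gain t' \<sigma> \<le> gain t \<sigma>"
proof -
  assume "t \<le> t'" "2 * \<sigma> \<le> t + t'"
  then have "0 \<le> (t' - t) * (t + t' - 2 * \<sigma>)" by simp
  then show ?thesis by (simp add: gain_def power2_eq_square algebra_simps)
qed

text \<open>The values of a monotone function that lie closest to \<open>\<sigma>\<close> are taken on an interval
  \<open>(a, a + k)\<close>: the window is moved to the right as long as its left end is further from \<open>\<sigma>\<close>
  than its right end. The number \<open>l\<close> separates the gains inside the window from those outside.\<close>

lemma best_window:
  fixes T :: "real \<Rightarrow> real"
  assumes T: "mono T" and B: "\<And>y. \<bar>T y\<bar> \<le> B" and k: "0 < k" "k \<le> 1"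
  obtains a l where "0 \<le> a" "a \<le> 1 - k"
    "\<And>y. a < y \<Longrightarrow> y < a + k \<Longrightarrow> l \<le> gain (T y) \<sigma>"
    "\<And>y. 0 < y \<Longrightarrow> y < 1 \<Longrightarrow> y < a \<or> a + k < y \<Longrightarrow> gain (T y) \<sigma> \<le> l"
proof -
  define A where "A = {a. a = 0 \<or> (0 < a \<and> a < 1 - k \<and> T a + T (a + k) < 2 * \<sigma>)}"
  define a where "a = Sup A"
  have A0: "0 \<in> A" and A1: "\<And>b. b \<in> A \<Longrightarrow> b \<le> 1 - k" using k by (auto simp: A_def)
  have bdd: "bdd_above A" by (rule bdd_aboveI[of _ "1 - k"]) (rule A1)
  have a0: "0 \<le> a" unfolding a_def by (rule cSup_upper[OF A0 bdd])
  have a1: "a \<le> 1 - k" unfolding a_def by (rule cSup_least) (use A0 A1 in auto)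
  have cmp: "gain (T y') \<sigma> \<le> gain (T y) \<sigma>"
    if y: "a < y" "y < a + k" and y': "0 < y'" "y' < 1" "y' < a \<or> a + k < y'" for y y'
    using y'(3)
  proof
    assume "y' < a"
    then have "max y' (y - k) < Sup A" using y unfolding a_def by simp
    then obtain b where b: "b \<in> A" "max y' (y - k) < b"
      using less_cSup_iff[of A "max y' (y - k)"] A0 bdd by blast
    then have "T b + T (b + k) < 2 * \<sigma>" using y' by (auto simp: A_def)
    moreover have "T y' \<le> T b" "T y \<le> T (b + k)" "T y' \<le> T y"
      using b y \<open>y' < a\<close> by (auto intro!: monoD[OF T])
    ultimately show ?thesis by (intro gain_mono_towards) auto
  next
    assume y'a: "a + k < y'"
    obtain b where b: "a < b" "b < min y (y' - k)"
      using dense[of a "min y (y' - k)"] y y'a by auto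
    have "b \<notin> A" using b cSup_upper[OF _ bdd, of b] unfolding a_def by auto
    moreover have "0 < b" "b < 1 - k" using b a0 y' by auto
    ultimately have "2 * \<sigma> \<le> T b + T (b + k)" by (auto simp: A_def)
    moreover have "T b \<le> T y" "T (b + k) \<le> T y'" "T y \<le> T y'"
      using b y y'a by (auto intro!: monoD[OF T])
    ultimately show ?thesis by (intro gain_mono_away) auto
  qed
  define l where "l = Inf ((\<lambda>y. gain (T y) \<sigma>) ` {a<..<a+k})"
  have ne: "{a<..<a+k} \<noteq> {}" using k by simp
  have "bdd_below ((\<lambda>y. gain (T y) \<sigma>) ` {a<..<a+k})"
  proof (rule bdd_belowI2)
    fix y show "- (2 * B * \<bar>\<sigma>\<bar> + B\<^sup>2) \<le> gain (T y) \<sigma>" using abs_gain_le[OF B, of y \<sigma>] by linarith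
  qed
  then have 1: "l \<le> gain (T y) \<sigma>" if "a < y" "y < a + k" for y
    unfolding l_def by (rule cINF_lower) (use that in auto)
  have 2: "gain (T y') \<sigma> \<le> l" if "0 < y'" "y' < 1" "y' < a \<or> a + k < y'" for y'
    unfolding l_def by (rule cINF_greatest[OF ne]) (use cmp that in auto)
  show thesis using that[OF a0 a1 1 2] by blast
qed

text \<open>The interval \<open>(0, 1)\<close> is cut into pieces of length \<open>k\<close>, which are stacked over \<open>(0, k)\<close>.\<close>

lemma integral_fold_interval:
  fixes f :: "real \<Rightarrow> real"
  assumes int: "integrable lborel f" and f0: "\<And>y. y \<le> 0 \<or> 1 \<le> y \<Longrightarrow> f y = 0"
    and k: "0 < k" and N: "1 \<le> real N * k"
  shows "integrable lborel (\<lambda>w. indicator {0<..<k} w * (\<Sum>j<N. f (w + real j * k)))"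
    and "(\<integral>w. indicator {0<..<k} w * (\<Sum>j<N. f (w + real j * k)) \<partial>lborel) = (\<integral>y. f y \<partial>lborel)"
proof -
  have [measurable]: "f \<in> borel_measurable borel" using int by auto
  have shift: "integrable lborel (\<lambda>w. f (w + real j * k))" for j
    using lborel_integrable_real_affine[OF int, of 1 "real j * k"] by (simp add: add.commute)
  have int_j: "integrable lborel (\<lambda>w. indicator {0<..<k} w * f (w + real j * k))" for j
    using integrable_mult_indicator[OF _ shift[of j], of "{0<..<k}"] by simp
  then show "integrable lborel (\<lambda>w. indicator {0<..<k} w * (\<Sum>j<N. f (w + real j * k)))"
    unfolding sum_distrib_left by (intro Bochner_Integration.integrable_sum)
  have int_f: "integrable lborel (\<lambda>y. indicator {real j * k<..<real (Suc j) * k} y * f y)" for j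
    using integrable_mult_indicator[OF _ int, of "{real j * k<..<real (Suc j) * k}"] by simp
  have "(\<integral>w. indicator {0<..<k} w * (\<Sum>j<N. f (w + real j * k)) \<partial>lborel)
      = (\<Sum>j<N. \<integral>w. indicator {0<..<k} w * f (w + real j * k) \<partial>lborel)"
    unfolding sum_distrib_left by (intro Bochner_Integration.integral_sum int_j)
  also have "\<dots> = (\<Sum>j<N. \<integral>y. indicator {real j * k<..<real (Suc j) * k} y * f y \<partial>lborel)"
  proof (rule sum.cong[OF refl])
    fix j
    show "(\<integral>w. indicator {0<..<k} w * f (w + real j * k) \<partial>lborel)
      = (\<integral>y. indicator {real j * k<..<real (Suc j) * k} y * f y \<partial>lborel)"
      by (subst lborel_integral_real_affine[of 1 _ "real j * k"])
         (auto simp: indicator_def algebra_simps intro!: Bochner_Integration.integral_cong)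
  qed
  also have "\<dots> = (\<integral>y. (\<Sum>j<N. indicator {real j * k<..<real (Suc j) * k} y * f y) \<partial>lborel)"
    by (intro Bochner_Integration.integral_sum[symmetric] int_f)
  also have "\<dots> = (\<integral>y. f y \<partial>lborel)"
  proof (rule integral_cong_AE)
    have "AE y in lborel. y \<notin> (\<lambda>j. real j * k) ` (UNIV :: nat set)"
      by (rule AE_not_in[OF countable_imp_null_set_lborel]) auto
    then show "AE y in lborel. (\<Sum>j<N. indicator {real j * k<..<real (Suc j) * k} y * f y) = f y"
    proof eventually_elim
      fix y assume y: "y \<notin> (\<lambda>j. real j * k) ` (UNIV :: nat set)"
      show "(\<Sum>j<N. indicator {real j * k<..<real (Suc j) * k} y * f y) = f y"
      proof (cases "0 < y \<and> y < 1")
        case False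
        then show ?thesis using f0[of y] by auto
      next
        case True
        define i where "i = nat \<lfloor>y / k\<rfloor>"
        have "0 \<le> y / k" using True k by simp
        then have i: "real i \<le> y / k" "y / k < real i + 1"
          unfolding i_def using floor_correct[of "y / k"] by (auto simp: of_nat_nat)
        then have "real i * k \<le> y" "y < real (Suc i) * k" using k by (auto simp: field_simps)
        moreover have "real i * k \<noteq> y" using y by auto
        ultimately have iy: "y \<in> {real i * k<..<real (Suc i) * k}" by auto
        have "real i * k < real N * k" using \<open>real i * k \<le> y\<close> True N by linarith
        then have iN: "i < N" using k by simp
        have "y \<notin> {real j * k<..<real (Suc j) * k}" if "j \<noteq> i" for j
        proof (cases "j < i")
          case True
          then have "real (Suc j) * k \<le> real i * k" using k by (intro mult_right_mono) auto
          then show ?thesis using iy by auto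
        next
          case False
          then have "real (Suc i) * k \<le> real j * k" using that k by (intro mult_right_mono) auto
          then show ?thesis using iy by auto
        qed
        then have "(\<Sum>j<N. indicator {real j * k<..<real (Suc j) * k} y * f y)
          = (\<Sum>j<N. if j = i then f y else 0)"
          using iy by (intro sum.cong) (auto simp del: greaterThanLessThan_iff)
        then show ?thesis using iN by simp
      qed
    qed
  qed auto
  finally show "(\<integral>w. indicator {0<..<k} w * (\<Sum>j<N. f (w + real j * k)) \<partial>lborel) = (\<integral>y. f y \<partial>lborel)" .
qed

text \<open>The quantile function of the weights \<open>c\<close> at the levels \<open>t\<close>. Clipping it to the range of
  the levels and extending it constantly beyond \<open>(0, 1)\<close> makes it monotone and bounded on the whole
  line.\<close>

lemma exists_quantile_function:
  fixes c t :: "'z \<Rightarrow> real"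
  assumes F: "finite F" and c: "\<And>z. z \<in> F \<Longrightarrow> 0 \<le> c z" and C: "0 < (\<Sum>z\<in>F. c z)"
  obtains T :: "real \<Rightarrow> real" and B where "mono T" "\<And>y. \<bar>T y\<bar> \<le> B"
    "\<And>\<phi>. \<phi> \<in> borel_measurable borel \<Longrightarrow>
       (\<Sum>z\<in>F. c z * \<phi> (t z)) = (\<Sum>z\<in>F. c z) * (\<integral>y. indicator {0<..<1} y * \<phi> (T y) \<partial>lborel)"
proof -
  let ?C = "\<Sum>z\<in>F. c z"
  define M where "M = density (count_space F) (\<lambda>z. ennreal (c z / ?C))"
  define D where "D = distr M borel t"
  have "emeasure M (space M) = 1"
    using F c C by (simp add: M_def emeasure_density nn_integral_count_space_finite sum_ennreal sum_divide_distrib[symmetric])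
  then have M: "prob_space M" by (rule prob_spaceI)
  have [measurable]: "t \<in> borel_measurable M" by (simp add: M_def)
  interpret D: prob_space D unfolding D_def by (rule prob_space.prob_space_distr[OF M]) simp
  interpret D: cdf_distribution D
    unfolding cdf_distribution_def real_distribution_def real_distribution_axioms_def
    using D.prob_space_axioms by (simp add: D_def)
  have int_D: "(\<integral>x. \<phi> x \<partial>D) = (\<Sum>z\<in>F. c z * \<phi> (t z)) / ?C" if [measurable]: "\<phi> \<in> borel_measurable borel" for \<phi> :: "real \<Rightarrow> real"
  proof -
    have "(\<integral>x. \<phi> x \<partial>D) = (\<integral>z. \<phi> (t z) \<partial>M)" unfolding D_def by (rule integral_distr) auto
    also have "\<dots> = (\<integral>z. (c z / ?C) * \<phi> (t z) \<partial>count_space F)"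
      unfolding M_def using c C by (subst integral_density) (auto simp: AE_count_space)
    also have "\<dots> = (\<Sum>z\<in>F. c z * \<phi> (t z)) / ?C"
      using F by (simp add: lebesgue_integral_count_space_finite sum_divide_distrib)
    finally show ?thesis .
  qed
  define B where "B = (\<Sum>z\<in>F. \<bar>t z\<bar>)"
  have B: "0 \<le> B" "\<And>z. z \<in> F \<Longrightarrow> \<bar>t z\<bar> \<le> B"
    using F by (auto simp: B_def sum_nonneg intro!: member_le_sum)
  define clip where "clip x = max (- B) (min B x)" for x
  have [measurable]: "clip \<in> borel_measurable borel" unfolding clip_def by measurable
  have clip_t: "clip (t z) = t z" if "z \<in> F" for z using B(2)[OF that] by (auto simp: clip_def)
  have clip_B: "\<bar>clip x\<bar> \<le> B" for x using B(1) by (auto simp: clip_def)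
  have clip_mono: "x \<le> y \<Longrightarrow> clip x \<le> clip y" for x y by (auto simp: clip_def)
  define T where "T y = (if y \<le> 0 then - B else if 1 \<le> y then B else clip (D.I y))" for y
  show thesis
  proof (rule that[of T B])
    show "mono T"
    proof (rule monoI)
      fix x y :: real assume "x \<le> y"
      then show "T x \<le> T y"
        using clip_B[of "D.I x"] clip_B[of "D.I y"] B(1)
          clip_mono[OF mono_onD[OF D.mono_I, of x y]]
        by (auto simp: T_def abs_le_iff)
    qed
    show "\<bar>T y\<bar> \<le> B" for y using clip_B B(1) by (simp add: T_def)
    fix \<phi> :: "real \<Rightarrow> real" assume [measurable]: "\<phi> \<in> borel_measurable borel"
    have "(\<Sum>z\<in>F. c z * \<phi> (t z)) = ?C * (\<integral>x. \<phi> (clip x) \<partial>D)"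
      using C by (subst int_D) (auto simp: clip_t)
    also have "(\<integral>x. \<phi> (clip x) \<partial>D) = (\<integral>x. \<phi> (clip x) \<partial>distr (restrict_space lborel {0<..<1::real}) borel D.I)"
      by (simp only: D.distr_I_eq_M)
    also have "\<dots> = (\<integral>y. \<phi> (clip (D.I y)) \<partial>restrict_space lborel {0<..<1::real})"
      by (rule integral_distr) (auto cong: measurable_cong_sets)
    also have "\<dots> = (\<integral>y. indicator {0<..<1} y * \<phi> (clip (D.I y)) \<partial>lborel)"
      by (subst integral_restrict_space) auto
    also have "\<dots> = (\<integral>y. indicator {0<..<1} y * \<phi> (T y) \<partial>lborel)"
      by (intro Bochner_Integration.integral_cong) (auto simp: T_def indicator_def)
    finally show "(\<Sum>z\<in>F. c z * \<phi> (t z)) = ?C * (\<integral>y. indicator {0<..<1} y * \<phi> (T y) \<partial>lborel)" .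
  qed
qed

text \<open>The rearrangement step: the mass \<open>C k\<close> is best spent on the window, and each
  progression \<open>y, y + k, y + 2 k, \<dots>\<close> meets the window, hence does at least as well with its
  best member.\<close>

lemma weighted_gain_le_fold:
  fixes c w t :: "'z \<Rightarrow> real" and T :: "real \<Rightarrow> real"
  assumes F: "finite F" and w: "\<And>z. z \<in> F \<Longrightarrow> 0 \<le> w z" "\<And>z. z \<in> F \<Longrightarrow> w z \<le> c z"
    and T: "mono T" and B: "\<And>y. \<bar>T y\<bar> \<le> B"
    and q: "\<And>\<phi>. \<phi> \<in> borel_measurable borel \<Longrightarrow>
       (\<Sum>z\<in>F. c z * \<phi> (t z)) = C * (\<integral>y. indicator {0<..<1} y * \<phi> (T y) \<partial>lborel)"
    and C: "0 \<le> C" and k: "0 < k" "k \<le> 1" and N: "1 \<le> real N * k"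
    and sum_w: "(\<Sum>z\<in>F. w z) = C * k"
  shows "(\<Sum>z\<in>F. w z * gain (t z) \<sigma>) \<le>
    C * (\<integral>y. indicator {0<..<k} y * Max ((\<lambda>j. gain (T (y + real j * k)) \<sigma>) ` {j. j < N \<and> y + real j * k < 1}) \<partial>lborel)"
proof -
  define J where "J y = {j. j < N \<and> y + real j * k < 1}" for y
  define m where "m y = Max ((\<lambda>j. gain (T (y + real j * k)) \<sigma>) ` J y)" for y
  have finJ: "finite (J y)" for y unfolding J_def by simp
  have N0: "0 < N" using N by (cases N) auto
  have J0: "0 \<in> J y" if "y < k" for y using that k N0 by (auto simp: J_def)
  have [measurable]: "T \<in> borel_measurable borel" by (rule borel_measurable_mono[OF T])
  obtain a l where a: "0 \<le> a" "a \<le> 1 - k"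
    and in_a: "\<And>y. a < y \<Longrightarrow> y < a + k \<Longrightarrow> l \<le> gain (T y) \<sigma>"
    and out_a: "\<And>y. 0 < y \<Longrightarrow> y < 1 \<Longrightarrow> y < a \<or> a + k < y \<Longrightarrow> gain (T y) \<sigma> \<le> l"
    using best_window[OF T B k] by metis
  define f where "f y = indicator {0<..<1} y * max 0 (gain (T y) \<sigma> - l)" for y :: real
  define G where "G = 2 * B * \<bar>\<sigma>\<bar> + B\<^sup>2"
  have gG: "\<bar>gain (T y) \<sigma>\<bar> \<le> G" for y unfolding G_def by (rule abs_gain_le[OF B])
  have [measurable]: "f \<in> borel_measurable borel" unfolding f_def by measurable
  have int_f: "integrable lborel f"
  proof (rule Bochner_Integration.integrable_bound)
    show "integrable lborel (\<lambda>y::real. indicator {0<..<1} y * (G + \<bar>l\<bar>))" by simp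
    show "AE y in lborel. norm (f y) \<le> norm (indicator {0<..<1} y * (G + \<bar>l\<bar>))"
    proof (rule AE_I2)
      fix y
      show "norm (f y) \<le> norm (indicator {0<..<1} y * (G + \<bar>l\<bar>))"
        using gG[of y] by (auto simp: f_def indicator_def)
    qed
  qed simp
  have f0: "f y = 0" if "y \<le> 0 \<or> 1 \<le> y" for y using that by (auto simp: f_def)
  note fold = integral_fold_interval[OF int_f f0 k(1) N]
  have m_meas: "(\<lambda>y. indicator {0<..<k} y * m y) \<in> borel_measurable borel"
  proof -
    have "(\<lambda>y. indicator {0<..<k} y * Max ((\<lambda>j. if y + real j * k < 1 then gain (T (y + real j * k)) \<sigma>
            else gain (T y) \<sigma>) ` {..<N})) \<in> borel_measurable borel"
      by measurable
    also have "(\<lambda>y. indicator {0<..<k} y * Max ((\<lambda>j. if y + real j * k < 1 then gain (T (y + real j * k)) \<sigma>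
            else gain (T y) \<sigma>) ` {..<N})) = (\<lambda>y. indicator {0<..<k} y * m y)"
    proof
      fix y :: real
      show "indicator {0<..<k} y * Max ((\<lambda>j. if y + real j * k < 1 then gain (T (y + real j * k)) \<sigma>
            else gain (T y) \<sigma>) ` {..<N}) = indicator {0<..<k} y * m y"
      proof (cases "y \<in> {0<..<k}")
        case True
        then have "(\<lambda>j. if y + real j * k < 1 then gain (T (y + real j * k)) \<sigma>
            else gain (T y) \<sigma>) ` {..<N} = (\<lambda>j. gain (T (y + real j * k)) \<sigma>) ` J y"
          using J0[of y] unfolding J_def by (force simp: image_iff)
        then show ?thesis by (simp add: m_def)
      qed simp
    qed
    finally show ?thesis .
  qed
  have m_bd: "\<bar>m y\<bar> \<le> G" if "y < k" for y
  proof -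
    have "m y \<in> (\<lambda>j. gain (T (y + real j * k)) \<sigma>) ` J y"
      unfolding m_def using finJ J0[OF that] by (intro Max_in) auto
    then show ?thesis using gG by auto
  qed
  have int_m: "integrable lborel (\<lambda>y. indicator {0<..<k} y * m y)"
  proof (rule Bochner_Integration.integrable_bound)
    show "integrable lborel (\<lambda>y::real. indicator {0<..<k} y * G)" using k by simp
    show "AE y in lborel. norm (indicator {0<..<k} y * m y) \<le> norm (indicator {0<..<k} y * G)"
      using m_bd by (intro AE_I2) (fastforce simp: indicator_def)
  qed (use m_meas in simp)
  have int_k: "(\<integral>y. indicator {0<..<k} y * l \<partial>lborel) = k * l" using k by simp
  \<comment> \<open>Subtracting the separating level \<open>l\<close> costs the same on both sides, as both spend the mass
    \<open>C k\<close>. Afterwards only the positive parts matter.\<close>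
  have "(\<Sum>z\<in>F. w z * (gain (t z) \<sigma> - l)) \<le> (\<Sum>z\<in>F. c z * max 0 (gain (t z) \<sigma> - l))"
  proof (rule sum_mono)
    fix z assume z: "z \<in> F"
    have "w z * (gain (t z) \<sigma> - l) \<le> w z * max 0 (gain (t z) \<sigma> - l)"
      using w(1)[OF z] by (intro mult_left_mono) auto
    also have "\<dots> \<le> c z * max 0 (gain (t z) \<sigma> - l)"
      using w(2)[OF z] by (intro mult_right_mono) auto
    finally show "w z * (gain (t z) \<sigma> - l) \<le> c z * max 0 (gain (t z) \<sigma> - l)" .
  qed
  also have "\<dots> = C * (\<integral>y. f y \<partial>lborel)"
    unfolding f_def by (rule q) measurable
  also have "(\<integral>y. f y \<partial>lborel) = (\<integral>y. indicator {0<..<k} y * (\<Sum>j<N. f (y + real j * k)) \<partial>lborel)"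
    by (rule fold(2)[symmetric])
  also have "\<dots> \<le> (\<integral>y. indicator {0<..<k} y * (m y - l) \<partial>lborel)"
  proof (rule integral_mono_AE[OF fold(1)])
    show "integrable lborel (\<lambda>y. indicator {0<..<k} y * (m y - l))"
      unfolding right_diff_distrib using k by (intro Bochner_Integration.integrable_diff int_m) simp
    have "AE y in lborel. y \<notin> (\<lambda>j. a - real j * k) ` (UNIV :: nat set)"
      by (rule AE_not_in[OF countable_imp_null_set_lborel]) auto
    then show "AE y in lborel. indicator {0<..<k} y * (\<Sum>j<N. f (y + real j * k)) \<le> indicator {0<..<k} y * (m y - l)"
    proof eventually_elim
      fix y assume y: "y \<notin> (\<lambda>j. a - real j * k) ` (UNIV :: nat set)"
      have "(\<Sum>j<N. f (y + real j * k)) \<le> m y - l" if yk: "0 < y" "y < k"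
      proof -
        \<comment> \<open>The unique member of the progression inside the window. The excluded null set is that
          of progressions through its end points.\<close>
        define i where "i = nat \<lceil>(a - y) / k\<rceil>"
        have i: "a < y + real i * k" "y + real i * k < a + k"
        proof -
          show "a < y + real i * k"
          proof -
            have "(a - y) / k \<le> real i" unfolding i_def by linarith
            then have "a \<le> y + real i * k" using k by (simp add: field_simps)
            moreover have "a \<noteq> y + real i * k" using y by (auto simp: image_iff algebra_simps)
            ultimately show ?thesis by simp
          qed
          show "y + real i * k < a + k"
          proof (cases "i = 0")
            case True then show ?thesis using yk a by simp
          next
            case False
            then have "real i = of_int \<lceil>(a - y) / k\<rceil>" unfolding i_def by simp
            then have "real i < (a - y) / k + 1" by linarith
            then show ?thesis using k by (simp add: field_simps)
          qed
        qed
        have i1: "y + real i * k < 1" using i a by simp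
        have "real i * k < real N * k" using i1 yk N by linarith
        then have iN: "i < N" using k by simp
        then have iJ: "i \<in> J y" using i1 by (simp add: J_def)
        have "f (y + real j * k) = 0" if "j \<noteq> i" for j
        proof (cases "y + real j * k < 1")
          case True
          have "y + real j * k < a \<or> a + k < y + real j * k"
          proof (cases "j < i")
            case True
            then have "real (Suc j) * k \<le> real i * k" using k by (intro mult_right_mono) auto
            then show ?thesis using i by (simp add: algebra_simps)
          next
            case False
            then have "real (Suc i) * k \<le> real j * k" using that k by (intro mult_right_mono) auto
            then show ?thesis using i by (simp add: algebra_simps)
          qed
          moreover have "0 < y + real j * k" using yk k by (simp add: add_pos_nonneg)
          ultimately show ?thesis using out_a[of "y + real j * k"] True by (simp add: f_def)
        qed (simp add: f_def)
        then have "(\<Sum>j<N. f (y + real j * k)) = (\<Sum>j<N. if j = i then f (y + real i * k) else 0)"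
          by (intro sum.cong) auto
        also have "\<dots> = f (y + real i * k)" using iN by simp
        also have "\<dots> \<le> gain (T (y + real i * k)) \<sigma> - l"
          using in_a[OF i] by (auto simp: f_def indicator_def)
        also have "gain (T (y + real i * k)) \<sigma> \<le> m y"
          unfolding m_def using finJ iJ by (intro Max_ge) auto
        finally show ?thesis by simp
      qed
      then show "indicator {0<..<k} y * (\<Sum>j<N. f (y + real j * k)) \<le> indicator {0<..<k} y * (m y - l)"
        by (auto simp: indicator_def)
    qed
  qed
  also have "\<dots> = (\<integral>y. indicator {0<..<k} y * m y \<partial>lborel) - k * l"
    unfolding right_diff_distrib int_k[symmetric] using k
    by (intro Bochner_Integration.integral_diff int_m) simp
  finally have "(\<Sum>z\<in>F. w z * (gain (t z) \<sigma> - l)) \<le> C * ((\<integral>y. indicator {0<..<k} y * m y \<partial>lborel) - k * l)"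
    using C by (simp add: mult_left_mono)
  moreover have "(\<Sum>z\<in>F. w z * (gain (t z) \<sigma> - l)) = (\<Sum>z\<in>F. w z * gain (t z) \<sigma>) - C * k * l"
    by (simp add: right_diff_distrib sum_subtractf sum_distrib_right[symmetric] sum_w)
  ultimately have "(\<Sum>z\<in>F. w z * gain (t z) \<sigma>) \<le> C * (\<integral>y. indicator {0<..<k} y * m y \<partial>lborel)"
    by (simp add: right_diff_distrib)
  then show ?thesis unfolding m_def J_def .
qed

section \<open>Upper bound for finite mechanisms\<close>

lemma (in prob_space) integrable_of_square_integrable:
  fixes s :: "'a \<Rightarrow> real"
  assumes [measurable]: "s \<in> borel_measurable M" and "integrable M (\<lambda>x. (s x)\<^sup>2)"
  shows "integrable M s"
proof (rule Bochner_Integration.integrable_bound)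
  show "integrable M (\<lambda>x. 1 + (s x)\<^sup>2)" using assms(2) by simp
  show "AE x in M. norm (s x) \<le> norm (1 + (s x)\<^sup>2)"
  proof (intro AE_I2)
    fix x
    have "0 \<le> (\<bar>s x\<bar> - 1)\<^sup>2" by simp
    then have "2 * \<bar>s x\<bar> \<le> 1 + (s x)\<^sup>2" by (simp add: power2_eq_square algebra_simps)
    then show "norm (s x) \<le> norm (1 + (s x)\<^sup>2)" by simp
  qed
qed simp

lemma (in prob_space) integral_gain_score:
  assumes "integrable M s" "(\<integral>x. s x \<partial>M) = 0"
  shows "integrable M (\<lambda>x. gain t (s x))" "(\<integral>x. gain t (s x) \<partial>M) = - t\<^sup>2"
proof -
  show "integrable M (\<lambda>x. gain t (s x))" unfolding gain_def using assms by simp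
  have "(\<integral>x. gain t (s x) \<partial>M) = 2 * t * (\<integral>x. s x \<partial>M) - (\<integral>x. t\<^sup>2 \<partial>M)"
    unfolding gain_def using assms(1) by simp
  then show "(\<integral>x. gain t (s x) \<partial>M) = - t\<^sup>2" using assms(2) by (simp add: prob_space)
qed

text \<open>The levels \<open>T (y + j k)\<close>, for those \<open>j\<close> with \<open>y + j k < 1\<close>, form a codebook for each
  \<open>y \<in> (0, k)\<close>. Integrating the bound \<open>K\<close> on its value over \<open>y\<close> bounds the mechanism. If \<open>k = 0\<close>,
  the kernels are constant and reveal nothing.\<close>

lemma (in prob_space) finite_mechanism_gain_le:
  fixes s :: "'a \<Rightarrow> real" and v :: "'z \<Rightarrow> 'a \<Rightarrow> real" and c t :: "'z \<Rightarrow> real" and E K :: real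
  assumes s: "integrable M s" "(\<integral>x. s x \<partial>M) = 0" and E: "1 < E"
    and K: "\<And>(J::nat set) \<tau>. finite J \<Longrightarrow> J \<noteq> {} \<Longrightarrow>
       (E - 1) * (\<integral>x. Max ((\<lambda>j. gain (\<tau> j) (s x)) ` J) \<partial>M) - (\<Sum>j\<in>J. (\<tau> j)\<^sup>2) \<le> K * (E - 1 + real (card J))"
    and F: "finite F" and v: "\<And>z. z \<in> F \<Longrightarrow> v z \<in> borel_measurable M"
    and c: "\<And>z. z \<in> F \<Longrightarrow> 0 \<le> c z"
    and vc: "AE x in M. \<forall>z\<in>F. c z \<le> v z x \<and> v z x \<le> E * c z"
    and v1: "AE x in M. (\<Sum>z\<in>F. v z x) = 1"
  shows "(\<Sum>z\<in>F. \<integral>x. v z x * gain (t z) (s x) \<partial>M) \<le> K"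
proof -
  define C where "C = (\<Sum>z\<in>F. c z)"
  have [measurable]: "s \<in> borel_measurable M" using s by auto
  note gain_int = integral_gain_score[OF s]
  have "AE x in M. C \<le> 1 \<and> 1 \<le> E * C"
    using vc v1
  proof eventually_elim
    fix x assume x: "\<forall>z\<in>F. c z \<le> v z x \<and> v z x \<le> E * c z" "(\<Sum>z\<in>F. v z x) = 1"
    have "C \<le> (\<Sum>z\<in>F. v z x)" unfolding C_def by (rule sum_mono) (use x in auto)
    moreover have "(\<Sum>z\<in>F. v z x) \<le> E * C" unfolding C_def sum_distrib_left by (rule sum_mono) (use x in auto)
    ultimately show "C \<le> 1 \<and> 1 \<le> E * C" using x(2) by simp
  qed
  then have C1: "C \<le> 1" "1 \<le> E * C" by auto
  have C0: "0 < C"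
  proof (rule ccontr)
    assume "\<not> 0 < C"
    then have "E * C \<le> 0" using E by (simp add: mult_nonneg_nonpos)
    then show False using C1 by simp
  qed
  define k where "k = (1 / C - 1) / (E - 1)"
  have Ck: "C + (E - 1) * (C * k) = 1" using C0 E by (simp add: k_def field_simps)
  have k0: "0 \<le> k" using C0 C1 E by (simp add: k_def field_simps)
  have "1 / C \<le> E" using C0 C1 by (simp add: field_simps)
  then have k1: "k \<le> 1" using E by (simp add: k_def field_simps)
  define w where "w z x = (v z x - c z) / (E - 1)" for z x
  have [measurable]: "w z \<in> borel_measurable M" if "z \<in> F" for z
    using v[OF that] unfolding w_def by measurable
  have vw: "v z x = c z + (E - 1) * w z x" for z x using E by (simp add: w_def)
  have good: "AE x in M. (\<forall>z\<in>F. 0 \<le> w z x \<and> w z x \<le> c z) \<and> (\<Sum>z\<in>F. w z x) = C * k"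
    using vc v1
  proof eventually_elim
    fix x assume x: "\<forall>z\<in>F. c z \<le> v z x \<and> v z x \<le> E * c z" "(\<Sum>z\<in>F. v z x) = 1"
    have "C + (E - 1) * (\<Sum>z\<in>F. w z x) = 1"
      using x(2) by (simp add: vw sum.distrib sum_distrib_left C_def)
    with Ck have "(E - 1) * (\<Sum>z\<in>F. w z x) = (E - 1) * (C * k)" by linarith
    then have "(\<Sum>z\<in>F. w z x) = C * k" using E by simp
    then show "(\<forall>z\<in>F. 0 \<le> w z x \<and> w z x \<le> c z) \<and> (\<Sum>z\<in>F. w z x) = C * k"
      using x(1) E by (auto simp: w_def field_simps)
  qed
  have int_w: "integrable M (\<lambda>x. w z x * gain (t z) (s x))" if z: "z \<in> F" for z
  proof (rule Bochner_Integration.integrable_bound)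
    show "integrable M (\<lambda>x. c z * gain (t z) (s x))" using gain_int by simp
    show "AE x in M. norm (w z x * gain (t z) (s x)) \<le> norm (c z * gain (t z) (s x))"
      using good
    proof eventually_elim
      fix x assume x: "(\<forall>z\<in>F. 0 \<le> w z x \<and> w z x \<le> c z) \<and> (\<Sum>z\<in>F. w z x) = C * k"
      then show "norm (w z x * gain (t z) (s x)) \<le> norm (c z * gain (t z) (s x))"
        using z c[OF z] by (auto simp: abs_mult intro!: mult_right_mono)
    qed
  qed (use z in measurable)
  have split: "(\<Sum>z\<in>F. \<integral>x. v z x * gain (t z) (s x) \<partial>M)
     = (E - 1) * (\<integral>x. (\<Sum>z\<in>F. w z x * gain (t z) (s x)) \<partial>M) - (\<Sum>z\<in>F. c z * (t z)\<^sup>2)"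
  proof -
    have "(\<integral>x. v z x * gain (t z) (s x) \<partial>M)
      = c z * (- (t z)\<^sup>2) + (E - 1) * (\<integral>x. w z x * gain (t z) (s x) \<partial>M)" if z: "z \<in> F" for z
    proof -
      have "(\<integral>x. v z x * gain (t z) (s x) \<partial>M)
        = (\<integral>x. c z * gain (t z) (s x) + (E - 1) * (w z x * gain (t z) (s x)) \<partial>M)"
        by (simp add: vw algebra_simps)
      also have "\<dots> = c z * (\<integral>x. gain (t z) (s x) \<partial>M) + (E - 1) * (\<integral>x. w z x * gain (t z) (s x) \<partial>M)"
        using gain_int int_w[OF z] by simp
      finally show ?thesis using gain_int by simp
    qed
    then have "(\<Sum>z\<in>F. \<integral>x. v z x * gain (t z) (s x) \<partial>M)
      = (\<Sum>z\<in>F. c z * (- (t z)\<^sup>2) + (E - 1) * (\<integral>x. w z x * gain (t z) (s x) \<partial>M))" by (rule sum.cong[OF refl])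
    also have "\<dots> = (E - 1) * (\<Sum>z\<in>F. \<integral>x. w z x * gain (t z) (s x) \<partial>M) - (\<Sum>z\<in>F. c z * (t z)\<^sup>2)"
      by (simp add: sum_subtractf sum_distrib_left)
    also have "(\<Sum>z\<in>F. \<integral>x. w z x * gain (t z) (s x) \<partial>M) = (\<integral>x. (\<Sum>z\<in>F. w z x * gain (t z) (s x)) \<partial>M)"
      by (rule Bochner_Integration.integral_sum[symmetric]) (rule int_w)
    finally show ?thesis .
  qed
  show ?thesis
  proof (cases "k = 0")
    case True
    have "(\<integral>x. (\<Sum>z\<in>F. w z x * gain (t z) (s x)) \<partial>M) = (\<integral>x. 0 \<partial>M)"
    proof (rule integral_cong_AE)
      show "AE x in M. (\<Sum>z\<in>F. w z x * gain (t z) (s x)) = 0"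
        using good
      proof eventually_elim
        fix x assume x: "(\<forall>z\<in>F. 0 \<le> w z x \<and> w z x \<le> c z) \<and> (\<Sum>z\<in>F. w z x) = C * k"
        then have "\<forall>z\<in>F. w z x = 0" using True F sum_nonneg_eq_0_iff[of F "\<lambda>z. w z x"] by auto
        then show "(\<Sum>z\<in>F. w z x * gain (t z) (s x)) = 0" by simp
      qed
    qed (auto)
    then have "(\<Sum>z\<in>F. \<integral>x. v z x * gain (t z) (s x) \<partial>M) = - (\<Sum>z\<in>F. c z * (t z)\<^sup>2)"
      using split by simp
    also have "\<dots> \<le> 0" using c by (simp add: sum_nonneg)
    also have "0 \<le> K" using K[of "{0}" "\<lambda>_. 0"] E by (simp add: gain_def zero_le_mult_iff)
    finally show ?thesis .
  next
    case False
    then have k: "0 < k" "k \<le> 1" using k0 k1 by auto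
    obtain T :: "real \<Rightarrow> real" and B where T: "mono T" "\<And>y. \<bar>T y\<bar> \<le> B"
      and q: "\<And>\<phi>. \<phi> \<in> borel_measurable borel \<Longrightarrow>
       (\<Sum>z\<in>F. c z * \<phi> (t z)) = C * (\<integral>y. indicator {0<..<1} y * \<phi> (T y) \<partial>lborel)"
      by (rule exists_quantile_function[OF F c C0[unfolded C_def], of t, folded C_def]) (assumption, rule that)
    have [measurable]: "T \<in> borel_measurable borel" by (rule borel_measurable_mono[OF T(1)])
    obtain N :: nat where "1 / k \<le> real N" using real_arch_simple by blast
    then have N: "1 \<le> real N * k" using k by (simp add: field_simps)
    have N0: "0 < N" using N by (cases N) auto
    define J where "J y = {j. j < N \<and> y + real j * k < 1}" for y
    have finJ: "finite (J y)" for y unfolding J_def by simp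
    have J0: "0 \<in> J y" if "y < k" for y using that k N0 by (auto simp: J_def)
    define m where "m y \<sigma> = Max ((\<lambda>j. gain (T (y + real j * k)) \<sigma>) ` J y)" for y \<sigma>
    define H where "H = (\<lambda>(x, y). indicator {0<..<k} y * m y (s x))"
    have H_meas [measurable]: "H \<in> borel_measurable (M \<Otimes>\<^sub>M lborel)"
    proof -
      have "(\<lambda>(x, y). indicator {0<..<k} y * Max ((\<lambda>j. if y + real j * k < 1 then gain (T (y + real j * k)) (s x)
              else gain (T y) (s x)) ` {..<N})) \<in> borel_measurable (M \<Otimes>\<^sub>M lborel)"
        by measurable
      also have "(\<lambda>(x, y). indicator {0<..<k} y * Max ((\<lambda>j. if y + real j * k < 1 then gain (T (y + real j * k)) (s x)
              else gain (T y) (s x)) ` {..<N})) = H"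
      proof (intro ext, clarify)
        fix x and y :: real
        show "indicator {0<..<k} y * Max ((\<lambda>j. if y + real j * k < 1 then gain (T (y + real j * k)) (s x)
              else gain (T y) (s x)) ` {..<N}) = H (x, y)"
        proof (cases "y \<in> {0<..<k}")
          case True
          then have "(\<lambda>j. if y + real j * k < 1 then gain (T (y + real j * k)) (s x)
              else gain (T y) (s x)) ` {..<N} = (\<lambda>j. gain (T (y + real j * k)) (s x)) ` J y"
            using J0[of y] unfolding J_def by (force simp: image_iff)
          then show ?thesis by (simp add: H_def m_def)
        qed (simp add: H_def)
      qed
      finally show ?thesis .
    qed
    have m_bd: "\<bar>m y \<sigma>\<bar> \<le> 2 * B * \<bar>\<sigma>\<bar> + B\<^sup>2" if "y < k" for y \<sigma>
    proof -
      have "m y \<sigma> \<in> (\<lambda>j. gain (T (y + real j * k)) \<sigma>) ` J y"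
        unfolding m_def using finJ J0[OF that] by (intro Max_in) auto
      then show ?thesis using abs_gain_le[OF T(2)] by auto
    qed
    interpret pair_sigma_finite M lborel by unfold_locales
    have int_H: "integrable (M \<Otimes>\<^sub>M lborel) H"
    proof (rule Bochner_Integration.integrable_bound)
      show "integrable (M \<Otimes>\<^sub>M lborel) (\<lambda>(x, y). indicator {0<..<k} y * (2 * B * \<bar>s x\<bar> + B\<^sup>2))"
        using k s by (intro Fubini_integrable) (auto simp: abs_mult)
      show "AE z in M \<Otimes>\<^sub>M lborel. norm (H z) \<le> norm ((\<lambda>(x, y). indicator {0<..<k} y * (2 * B * \<bar>s x\<bar> + B\<^sup>2)) z)"
      proof (intro AE_I2)
        fix z :: "'a \<times> real"
        obtain x y where z: "z = (x, y)" by (cases z)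
        show "norm (H z) \<le> norm ((\<lambda>(x, y). indicator {0<..<k} y * (2 * B * \<bar>s x\<bar> + B\<^sup>2)) z)"
          using m_bd[of y "s x"] by (auto simp: H_def z indicator_def)
      qed
    qed simp
    have Hxy: "indicator {0<..<k} y * m y (s x) = H (x, y)" for x y by (simp add: H_def)
    have "(\<integral>x. (\<Sum>z\<in>F. w z x * gain (t z) (s x)) \<partial>M) \<le> (\<integral>x. C * (\<integral>y. H (x, y) \<partial>lborel) \<partial>M)"
    proof (rule integral_mono_AE)
      show "integrable M (\<lambda>x. \<Sum>z\<in>F. w z x * gain (t z) (s x))"
        by (intro Bochner_Integration.integrable_sum int_w)
      show "integrable M (\<lambda>x. C * (\<integral>y. H (x, y) \<partial>lborel))"
        using integrable_fst'[OF int_H] by simp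
      show "AE x in M. (\<Sum>z\<in>F. w z x * gain (t z) (s x)) \<le> C * (\<integral>y. H (x, y) \<partial>lborel)"
        using good
      proof eventually_elim
        fix x assume x: "(\<forall>z\<in>F. 0 \<le> w z x \<and> w z x \<le> c z) \<and> (\<Sum>z\<in>F. w z x) = C * k"
        show "(\<Sum>z\<in>F. w z x * gain (t z) (s x)) \<le> C * (\<integral>y. H (x, y) \<partial>lborel)"
          unfolding Hxy[symmetric] m_def J_def
          by (rule weighted_gain_le_fold[OF F _ _ T q _ k N]) (use x C0 in auto)
      qed
    qed
    also have "\<dots> = C * (\<integral>y. (\<integral>x. H (x, y) \<partial>M) \<partial>lborel)"
      using Fubini_integral[of "\<lambda>x y. H (x, y)"] int_H by simp
    finally have "(E - 1) * (\<integral>x. (\<Sum>z\<in>F. w z x * gain (t z) (s x)) \<partial>M)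
        \<le> C * (\<integral>y. (E - 1) * (\<integral>x. H (x, y) \<partial>M) \<partial>lborel)"
      using mult_left_mono[of "(\<integral>x. (\<Sum>z\<in>F. w z x * gain (t z) (s x)) \<partial>M)" _ "E - 1"] E
      by (simp add: mult.left_commute)
    also have "(\<integral>y. (E - 1) * (\<integral>x. H (x, y) \<partial>M) \<partial>lborel) \<le> K * (E - 1) * k + K + (\<integral>y. indicator {0<..<1} y * (T y)\<^sup>2 \<partial>lborel)"
    proof -
      \<comment> \<open>Folding \<open>f1\<close> into \<open>(0, k)\<close> counts the levels of the codebook at \<open>y\<close>, folding \<open>f2\<close> sums
        their squares.\<close>
      define f1 where "f1 = (indicator {0<..<1} :: real \<Rightarrow> real)"
      define f2 where "f2 y = indicator {0<..<1} y * (T y)\<^sup>2" for y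
      have i1: "integrable lborel f1" by (simp add: f1_def)
      have i2: "integrable lborel f2"
      proof (rule Bochner_Integration.integrable_bound)
        show "integrable lborel (\<lambda>y. indicator {0<..<1::real} y * B\<^sup>2)" by simp
        show "AE y in lborel. norm (f2 y) \<le> norm (indicator {0<..<1} y * B\<^sup>2)"
          by (intro AE_I2) (auto simp: f2_def indicator_def abs_le_square_iff[symmetric] intro!: order_trans[OF T(2) abs_ge_self])
      qed (simp add: f2_def[abs_def])
      have z1: "f1 y = 0" "f2 y = 0" if "y \<le> 0 \<or> 1 \<le> y" for y using that by (auto simp: f1_def f2_def)
      note fold1 = integral_fold_interval[OF i1 z1(1) k(1) N]
      note fold2 = integral_fold_interval[OF i2 z1(2) k(1) N]
      have "(\<integral>y. (E - 1) * (\<integral>x. H (x, y) \<partial>M) \<partial>lborel) \<le>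
        (\<integral>y. K * (E - 1) * indicator {0<..<k} y + (K * (indicator {0<..<k} y * (\<Sum>j<N. f1 (y + real j * k)))
          + indicator {0<..<k} y * (\<Sum>j<N. f2 (y + real j * k))) \<partial>lborel)"
      proof (rule integral_mono)
        show "integrable lborel (\<lambda>y. (E - 1) * (\<integral>x. H (x, y) \<partial>M))"
          using integrable_snd[of "\<lambda>x y. H (x, y)"] int_H by simp
        show "integrable lborel (\<lambda>y. K * (E - 1) * indicator {0<..<k} y + (K * (indicator {0<..<k} y * (\<Sum>j<N. f1 (y + real j * k)))
          + indicator {0<..<k} y * (\<Sum>j<N. f2 (y + real j * k))))"
          using k by (intro Bochner_Integration.integrable_add integrable_mult_right fold1(1) fold2(1)) simp
        fix y :: real
        show "(E - 1) * (\<integral>x. H (x, y) \<partial>M) \<le> K * (E - 1) * indicator {0<..<k} y + (K * (indicator {0<..<k} y * (\<Sum>j<N. f1 (y + real j * k)))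
          + indicator {0<..<k} y * (\<Sum>j<N. f2 (y + real j * k)))"
        proof (cases "y \<in> {0<..<k}")
          case True
          have inJ: "f1 (y + real j * k) = (if y + real j * k < 1 then 1 else 0)"
             "f2 (y + real j * k) = (if y + real j * k < 1 then (T (y + real j * k))\<^sup>2 else 0)" for j
            using True k by (auto simp: f1_def f2_def indicator_def add_pos_nonneg)
          have JN: "J y = {..<N} \<inter> {j. y + real j * k < 1}" by (auto simp: J_def)
          have s1: "(\<Sum>j<N. f1 (y + real j * k)) = real (card (J y))"
            unfolding inJ JN by (simp add: sum.If_cases)
          have s2: "(\<Sum>j<N. f2 (y + real j * k)) = (\<Sum>j\<in>J y. (T (y + real j * k))\<^sup>2)"
            unfolding inJ JN by (simp add: sum.If_cases)
          have "(\<integral>x. H (x, y) \<partial>M) = (\<integral>x. Max ((\<lambda>j. gain (T (y + real j * k)) (s x)) ` J y) \<partial>M)"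
            using True by (simp add: H_def m_def)
          moreover have "J y \<noteq> {}" using J0[of y] True by auto
          ultimately have "(E - 1) * (\<integral>x. H (x, y) \<partial>M)
              \<le> K * (E - 1 + real (card (J y))) + (\<Sum>j\<in>J y. (T (y + real j * k))\<^sup>2)"
            using K[OF finJ, of y "\<lambda>j. T (y + real j * k)"] by simp
          also have "\<dots> = K * (E - 1) * indicator {0<..<k} y + (K * (indicator {0<..<k} y * (\<Sum>j<N. f1 (y + real j * k)))
              + indicator {0<..<k} y * (\<Sum>j<N. f2 (y + real j * k)))"
            unfolding s1 s2 using True by (simp add: distrib_left)
          finally show ?thesis .
        qed (simp add: H_def)
      qed
      also have "\<dots> = K * (E - 1) * k + (K * (\<integral>y. f1 y \<partial>lborel) + (\<integral>y. f2 y \<partial>lborel))"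
        using k by (subst Bochner_Integration.integral_add Bochner_Integration.integral_add; (intro Bochner_Integration.integrable_add integrable_mult_right fold1(1) fold2(1))?) 
           (simp_all add: fold1 fold2)
      also have "(\<integral>y. f1 y \<partial>lborel) = 1" by (simp add: f1_def)
      finally show ?thesis by (simp add: f2_def)
    qed
    finally have "(E - 1) * (\<integral>x. (\<Sum>z\<in>F. w z x * gain (t z) (s x)) \<partial>M)
       \<le> C * (K * (E - 1) * k + K + (\<integral>y. indicator {0<..<1} y * (T y)\<^sup>2 \<partial>lborel))"
      using C0 by simp
    also have "\<dots> = K * (C + (E - 1) * (C * k)) + (\<Sum>z\<in>F. c z * (t z)\<^sup>2)"
      using q[of "\<lambda>x. x\<^sup>2"] by (simp add: algebra_simps)
    finally show ?thesis using split Ck by simp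
  qed
qed

section \<open>Existence of an optimal codebook\<close>

lemma abs_Max_le:
  fixes f g :: "'i \<Rightarrow> real"
  assumes "finite I" "I \<noteq> {}" "\<And>i. i \<in> I \<Longrightarrow> \<bar>f i\<bar> \<le> b"
  shows "\<bar>Max (f ` I)\<bar> \<le> b"
proof -
  have "Max (f ` I) \<in> f ` I" using assms by (intro Max_in) auto
  then show ?thesis using assms(3) by auto
qed

lemma compact_bounded_sequences: "compact {t :: nat \<Rightarrow> real. \<forall>i. \<bar>t i\<bar> \<le> B}"
proof -
  have "compactin (product_topology (\<lambda>i. euclidean) UNIV) (PiE UNIV (\<lambda>i::nat. {- B .. B}))"
    by (subst compactin_PiE) auto
  then show ?thesis
    by (simp add: euclidean_product_topology PiE_def Pi_def abs_le_iff) 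
      (smt (verit) Collect_cong)
qed

lemma continuous_on_Max_family:
  fixes f :: "'i \<Rightarrow> 'b::topological_space \<Rightarrow> real"
  assumes "finite I" "I \<noteq> {}" "\<And>i. i \<in> I \<Longrightarrow> continuous_on S (f i)"
  shows "continuous_on S (\<lambda>x. Max ((\<lambda>i. f i x) ` I))"
  using assms
proof (induction I rule: finite_ne_induct)
  case (insert i I)
  then have "(\<lambda>x. Max ((\<lambda>i. f i x) ` insert i I)) = (\<lambda>x. max (f i x) (Max ((\<lambda>i. f i x) ` I)))"
    by (simp add: fun_eq_iff)
  then show ?case using insert by (auto intro!: continuous_on_max)
qed simp

text \<open>A codebook with a positive value has \<open>\<Sum> (t i)\<^sup>2 \<le> (E - 1) \<integral> s\<^sup>2\<close>, which confines its
  levels to \<open>[-B, B]\<close>. Levels with index at least \<open>n\<close> are irrelevant, so the search is over a compact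
  set of sequences.\<close>

lemma (in prob_space) codebook_value_attained:
  fixes s :: "'a \<Rightarrow> real" and E :: real and val :: "nat \<Rightarrow> (nat \<Rightarrow> real) \<Rightarrow> real"
  assumes s2: "integrable M (\<lambda>x. (s x)\<^sup>2)" and s_meas [measurable]: "s \<in> borel_measurable M"
    and E: "1 < E"
  defines "val \<equiv> \<lambda>n t. ((E - 1) * (\<integral>x. Max ((\<lambda>i. gain (t i) (s x)) ` {..<n}) \<partial>M) - (\<Sum>i<n. (t i)\<^sup>2))
      / (E - 1 + real n)"
  obtains n t where "0 < n" "\<And>n' t'. 0 < n' \<Longrightarrow> val n' t' \<le> val n t"
proof -
  have s1: "integrable M s" by (rule integrable_of_square_integrable[OF s_meas s2])
  define V where "V = (\<integral>x. (s x)\<^sup>2 \<partial>M)"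
  have V0: "0 \<le> V" by (simp add: V_def)
  have intMax: "integrable M (\<lambda>x. Max ((\<lambda>i. gain (t i) (s x)) ` {..<n}))" if n: "0 < n" for n :: nat and t
  proof -
    define B where "B = (\<Sum>i<n. \<bar>t i\<bar>)"
    have tB: "\<bar>t i\<bar> \<le> B" if "i < n" for i unfolding B_def using that by (intro member_le_sum) auto
    show ?thesis
    proof (rule Bochner_Integration.integrable_bound)
      show "integrable M (\<lambda>x. 2 * B * \<bar>s x\<bar> + B\<^sup>2)" using s1 by simp
      show "AE x in M. norm (Max ((\<lambda>i. gain (t i) (s x)) ` {..<n})) \<le> norm (2 * B * \<bar>s x\<bar> + B\<^sup>2)"
      proof (intro AE_I2)
        fix x
        have "\<bar>Max ((\<lambda>i. gain (t i) (s x)) ` {..<n})\<bar> \<le> 2 * B * \<bar>s x\<bar> + B\<^sup>2"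
          using n by (intro abs_Max_le abs_gain_le tB) auto
        then show "norm (Max ((\<lambda>i. gain (t i) (s x)) ` {..<n})) \<le> norm (2 * B * \<bar>s x\<bar> + B\<^sup>2)" by simp
      qed
    qed measurable
  qed
  have num_le: "(E - 1) * (\<integral>x. Max ((\<lambda>i. gain (t i) (s x)) ` {..<n}) \<partial>M) \<le> (E - 1) * V" if n: "0 < n" for n :: nat and t
  proof -
    have "(\<integral>x. Max ((\<lambda>i. gain (t i) (s x)) ` {..<n}) \<partial>M) \<le> V"
      unfolding V_def
    proof (rule integral_mono[OF intMax[OF n] s2])
      fix x show "Max ((\<lambda>i. gain (t i) (s x)) ` {..<n}) \<le> (s x)\<^sup>2"
        using n by (intro Max.boundedI) (auto simp: gain_le_square)
    qed
    then show ?thesis using E by simp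
  qed
  have den: "0 < E - 1 + real n" for n using E by simp
  have val_le: "val n t \<le> (E - 1) * V / (E - 1 + real n)" if n: "0 < n" for n t
  proof -
    have "0 \<le> (\<Sum>i<n. (t i)\<^sup>2)" by (rule sum_nonneg) simp
    then show ?thesis
      unfolding val_def using num_le[OF n, of t] den[of n] by (intro divide_right_mono) linarith+
  qed
  have val_0: "val 1 (\<lambda>_. 0) = 0" unfolding val_def by (simp add: gain_def lessThan_Suc)
  show thesis
  proof (cases "\<forall>n t. 0 < n \<longrightarrow> val n t \<le> 0")
    case True
    then show ?thesis using that[of 1 "\<lambda>_. 0"] val_0 by auto
  next
    case False
    then obtain n0 t0 where n0: "0 < n0" and d0: "0 < val n0 t0" by (auto simp: not_le)
    define d where "d = val n0 t0"
    define B where "B = sqrt ((E - 1) * V)"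
    have B2: "B\<^sup>2 = (E - 1) * V" "0 \<le> B" using E V0 by (auto simp: B_def)
    define S where "S = {t :: nat \<Rightarrow> real. \<forall>i. \<bar>t i\<bar> \<le> B}"
    have best_n: "\<exists>t\<in>S. \<forall>t'\<in>S. val n t' \<le> val n t" if n: "0 < n" for n
    proof -
      have "continuous_on S (\<lambda>t. \<integral>x. Max ((\<lambda>i. gain (t i) (s x)) ` {..<n}) \<partial>M)"
      proof (rule continuous_on_sequentiallyI)
        fix u :: "nat \<Rightarrow> nat \<Rightarrow> real" and a assume u: "\<forall>j. u j \<in> S" "a \<in> S" "u \<longlonglongrightarrow> a"
        show "(\<lambda>j. \<integral>x. Max ((\<lambda>i. gain (u j i) (s x)) ` {..<n}) \<partial>M) \<longlonglongrightarrow> (\<integral>x. Max ((\<lambda>i. gain (a i) (s x)) ` {..<n}) \<partial>M)"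
        proof (rule integral_dominated_convergence)
          show "integrable M (\<lambda>x. 2 * B * \<bar>s x\<bar> + B\<^sup>2)" using s1 by simp
          show "AE x in M. norm (Max ((\<lambda>i. gain (u j i) (s x)) ` {..<n})) \<le> 2 * B * \<bar>s x\<bar> + B\<^sup>2" for j
            using u(1) n unfolding real_norm_def S_def
            by (intro AE_I2 abs_Max_le abs_gain_le) auto
          show "AE x in M. (\<lambda>j. Max ((\<lambda>i. gain (u j i) (s x)) ` {..<n})) \<longlonglongrightarrow> Max ((\<lambda>i. gain (a i) (s x)) ` {..<n})"
          proof (rule AE_I2)
            fix x
            have "continuous_on UNIV (\<lambda>t. Max ((\<lambda>i. gain (t i) (s x)) ` {..<n}))"
              using n unfolding gain_def
              by (intro continuous_on_Max_family continuous_intros continuous_on_product_coordinates) auto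
            then show "(\<lambda>j. Max ((\<lambda>i. gain (u j i) (s x)) ` {..<n})) \<longlonglongrightarrow> Max ((\<lambda>i. gain (a i) (s x)) ` {..<n})"
              by (rule continuous_on_tendsto_compose[OF _ u(3)]) auto
          qed
        qed measurable
      qed
      then have "continuous_on S (val n)"
        unfolding val_def using den[of n]
        by (intro continuous_intros continuous_on_subset[OF continuous_on_product_coordinates]) auto
      moreover have "compact S" unfolding S_def by (rule compact_bounded_sequences)
      moreover have "S \<noteq> {}" using B2(2) by (auto simp: S_def intro!: exI[of _ "\<lambda>_. 0"])
      ultimately show ?thesis using continuous_attains_sup[of S "val n"] by blast
    qed
    then obtain T where T: "\<And>n. 0 < n \<Longrightarrow> T n \<in> S" "\<And>n t'. 0 < n \<Longrightarrow> t' \<in> S \<Longrightarrow> val n t' \<le> val n (T n)"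
      by metis
    have big: "val n t \<le> val n (T n) \<or> val n t \<le> 0" if n: "0 < n" for n t
    proof (rule disjCI)
      assume "\<not> val n t \<le> 0"
      then have "(\<Sum>i<n. (t i)\<^sup>2) < (E - 1) * (\<integral>x. Max ((\<lambda>i. gain (t i) (s x)) ` {..<n}) \<partial>M)"
        unfolding val_def using den[of n] by (simp add: divide_le_0_iff not_le)
      also have "\<dots> \<le> B\<^sup>2" using num_le[OF n] B2 by simp
      finally have t2: "(\<Sum>i<n. (t i)\<^sup>2) < B\<^sup>2" .
      have tB: "\<bar>t i\<bar> \<le> B" if "i < n" for i
      proof -
        have "(t i)\<^sup>2 \<le> (\<Sum>i<n. (t i)\<^sup>2)" using that by (intro member_le_sum) auto
        with t2 have "\<bar>t i\<bar>\<^sup>2 \<le> B\<^sup>2" by simp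
        then show ?thesis using B2(2) by (rule power2_le_imp_le)
      qed
      define t' where "t' i = (if i < n then t i else 0)" for i
      have "val n t = val n t'"
        unfolding val_def t'_def by (simp cong: image_cong_simp)
      also have "\<dots> \<le> val n (T n)"
        using T(2)[OF n, of t'] tB B2(2) by (auto simp: S_def t'_def)
      finally show "val n t \<le> val n (T n)" .
    qed
    \<comment> \<open>Codebooks with \<open>m\<close> or more levels have values below \<open>d\<close>, by \<open>val_le\<close>.\<close>
    obtain m :: nat where "(E - 1) * V / d < real m" using reals_Archimedean2 by blast
    then have m: "(E - 1) * V < d * real m" using d0 by (simp add: d_def field_simps)
    define A where "A = (\<lambda>n. val n (T n)) ` {1..max m n0}"
    have "Max A \<in> A" unfolding A_def using n0 by (intro Max_in) auto
    then obtain n where n: "n \<in> {1..max m n0}" "Max A = val n (T n)" by (auto simp: A_def)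
    have le_A: "val i (T i) \<le> val n (T n)" if "0 < i" "i \<le> max m n0" for i
      unfolding n(2)[symmetric] A_def using that by (intro Max_ge) auto
    have d_le: "d \<le> val n (T n)"
      using big[OF n0, of t0] d0 le_A[of n0] n0 by (auto simp: d_def)
    have "val n' t' \<le> val n (T n)" if n': "0 < n'" for n' t'
    proof (cases "n' \<le> m")
      case True
      then have "val n' (T n') \<le> val n (T n)" by (intro le_A n') simp
      moreover have "0 < d" using d0 by (simp add: d_def)
      ultimately show ?thesis using big[OF n', of t'] d_le by linarith
    next
      case False
      have "(E - 1) * V < d * real m" by (rule m)
      also have "\<dots> \<le> d * (E - 1 + real n')" using False E d0 by (intro mult_left_mono) (auto simp: d_def)
      finally have "(E - 1) * V / (E - 1 + real n') \<le> d" using den[of n'] by (simp add: divide_le_eq)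
      then show ?thesis using val_le[OF n', of t'] d_le by linarith
    qed
    then show ?thesis using that[of n "T n"] n by auto
  qed
qed

text \<open>A bound for codebooks indexed by initial segments holds for every finite index set.\<close>

lemma codebook_bound_reindex:
  fixes g :: "real \<Rightarrow> 'a \<Rightarrow> real"
  assumes "\<And>n (t::nat \<Rightarrow> real). 0 < n \<Longrightarrow> a * (\<integral>x. Max ((\<lambda>i. g (t i) x) ` {..<n}) \<partial>M) - (\<Sum>i<n. (t i)\<^sup>2) \<le> K * (a + real n)"
    and J: "finite (J :: nat set)" "J \<noteq> {}"
  shows "a * (\<integral>x. Max ((\<lambda>j. g (\<tau> j) x) ` J) \<partial>M) - (\<Sum>j\<in>J. (\<tau> j)\<^sup>2) \<le> K * (a + real (card J))"
proof -
  obtain h where h: "bij_betw h {..<card J} J" using ex_bij_betw_nat_finite[OF J(1)] by (auto simp: atLeast0LessThan)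
  have "(\<lambda>j. g (\<tau> j) x) ` J = (\<lambda>i. g ((\<tau> \<circ> h) i) x) ` {..<card J}" for x
    unfolding comp_def by (subst bij_betw_imp_surj_on[OF h, symmetric]) (rule image_image)
  moreover have "(\<Sum>j\<in>J. (\<tau> j)\<^sup>2) = (\<Sum>i<card J. ((\<tau> \<circ> h) i)\<^sup>2)"
    using sum.reindex_bij_betw[OF h, of "\<lambda>j. (\<tau> j)\<^sup>2"] by simp
  moreover have "0 < card J" using J by (simp add: card_gt_0_iff)
  ultimately show ?thesis using assms(1)[of "card J" "\<tau> \<circ> h"] by simp
qed

section \<open>Differentiability in quadratic mean of privatized models\<close>

lemma integrable_bounded_times_integrable:
  fixes f g :: "'b \<Rightarrow> real"
  assumes [measurable]: "f \<in> borel_measurable M" and "AE x in M. \<bar>f x\<bar> \<le> b" and "integrable M g"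
  shows "integrable M (\<lambda>x. f x * g x)"
proof (rule Bochner_Integration.integrable_bound)
  show "integrable M (\<lambda>x. b * g x)" using assms by simp
  show "AE x in M. norm (f x * g x) \<le> norm (b * g x)"
    using assms(2) by eventually_elim (auto simp: abs_mult intro!: mult_right_mono)
  show "(\<lambda>x. f x * g x) \<in> borel_measurable M" using assms(3) by measurable
qed

lemma integrable_mult_of_squares:
  fixes f g :: "'b \<Rightarrow> real"
  assumes [measurable]: "f \<in> borel_measurable L" "g \<in> borel_measurable L"
    and "integrable L (\<lambda>x. (f x)\<^sup>2)" "integrable L (\<lambda>x. (g x)\<^sup>2)"
  shows "integrable L (\<lambda>x. f x * g x)"
proof (rule Bochner_Integration.integrable_bound)
  show "integrable L (\<lambda>x. (f x)\<^sup>2 + (g x)\<^sup>2)" using assms by simp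
  show "AE x in L. norm (f x * g x) \<le> norm ((f x)\<^sup>2 + (g x)\<^sup>2)"
  proof (intro AE_I2)
    fix x
    have "0 \<le> (\<bar>f x\<bar> - \<bar>g x\<bar>)\<^sup>2 + (f x)\<^sup>2 + (g x)\<^sup>2" by simp
    then have "2 * (\<bar>f x\<bar> * \<bar>g x\<bar>) \<le> 2 * ((f x)\<^sup>2 + (g x)\<^sup>2)"
      by (simp add: power2_eq_square algebra_simps)
    then show "norm (f x * g x) \<le> norm ((f x)\<^sup>2 + (g x)\<^sup>2)" by (simp add: abs_mult)
  qed
qed measurable

lemma integral_square_add:
  fixes f g :: "'b \<Rightarrow> real"
  assumes [measurable]: "f \<in> borel_measurable L" "g \<in> borel_measurable L"
    and f: "integrable L (\<lambda>x. (f x)\<^sup>2)" and g: "integrable L (\<lambda>x. (g x)\<^sup>2)"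
  shows "integrable L (\<lambda>x. (f x + r * g x)\<^sup>2)"
    "(\<integral>x. (f x + r * g x)\<^sup>2 \<partial>L) = (\<integral>x. (f x)\<^sup>2 \<partial>L) + 2 * r * (\<integral>x. f x * g x \<partial>L) + r\<^sup>2 * (\<integral>x. (g x)\<^sup>2 \<partial>L)"
proof -
  have fg: "integrable L (\<lambda>x. f x * g x)" by (rule integrable_mult_of_squares[OF assms])
  have eq: "(f x + r * g x)\<^sup>2 = (f x)\<^sup>2 + 2 * r * (f x * g x) + r\<^sup>2 * (g x)\<^sup>2" for x
    by (simp add: power2_eq_square algebra_simps)
  show "integrable L (\<lambda>x. (f x + r * g x)\<^sup>2)" unfolding eq using f g fg by simp
  show "(\<integral>x. (f x + r * g x)\<^sup>2 \<partial>L) = (\<integral>x. (f x)\<^sup>2 \<partial>L) + 2 * r * (\<integral>x. f x * g x \<partial>L) + r\<^sup>2 * (\<integral>x. (g x)\<^sup>2 \<partial>L)"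
    unfolding eq using f g fg by simp
qed

lemma integral_Cauchy_Schwarz:
  fixes f g :: "'b \<Rightarrow> real"
  assumes [measurable]: "f \<in> borel_measurable L" "g \<in> borel_measurable L"
    and f: "integrable L (\<lambda>x. (f x)\<^sup>2)" and g: "integrable L (\<lambda>x. (g x)\<^sup>2)"
  shows "(\<integral>x. f x * g x \<partial>L)\<^sup>2 \<le> (\<integral>x. (f x)\<^sup>2 \<partial>L) * (\<integral>x. (g x)\<^sup>2 \<partial>L)"
proof -
  define a b c where "a = (\<integral>x. (g x)\<^sup>2 \<partial>L)" and "b = (\<integral>x. f x * g x \<partial>L)" and "c = (\<integral>x. (f x)\<^sup>2 \<partial>L)"
  have *: "0 \<le> c + 2 * r * b + r\<^sup>2 * a" for r
    unfolding a_def b_def c_def integral_square_add(2)[OF assms, symmetric] by simp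
  have a0: "0 \<le> a" by (simp add: a_def)
  have "b\<^sup>2 \<le> c * a"
  proof (cases "a = 0")
    case True
    have "b = 0"
    proof (rule ccontr)
      assume "b \<noteq> 0"
      then show False using *[of "- (c + 1) / (2 * b)"] True by (simp add: field_simps)
    qed
    then show ?thesis using True by simp
  next
    case False
    then show ?thesis using *[of "- b / a"] a0 by (simp add: power2_eq_square field_simps)
  qed
  then show ?thesis by (simp add: a_def b_def c_def)
qed

lemma sqrt_integral_diff_le:
  fixes f g :: "'b \<Rightarrow> real"
  assumes [measurable]: "f \<in> borel_measurable L" "g \<in> borel_measurable L"
    and f: "integrable L (\<lambda>x. (f x)\<^sup>2)" and g: "integrable L (\<lambda>x. (g x)\<^sup>2)"
  shows "(sqrt (\<integral>x. (f x)\<^sup>2 \<partial>L) - sqrt (\<integral>x. (g x)\<^sup>2 \<partial>L))\<^sup>2 \<le> (\<integral>x. (f x - g x)\<^sup>2 \<partial>L)"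
proof -
  have "(\<integral>x. (f x - g x)\<^sup>2 \<partial>L) = (\<integral>x. (f x)\<^sup>2 \<partial>L) - 2 * (\<integral>x. f x * g x \<partial>L) + (\<integral>x. (g x)\<^sup>2 \<partial>L)"
    using integral_square_add(2)[OF assms, of "-1"] by simp
  moreover have "(\<integral>x. f x * g x \<partial>L) \<le> sqrt (\<integral>x. (f x)\<^sup>2 \<partial>L) * sqrt (\<integral>x. (g x)\<^sup>2 \<partial>L)"
    using integral_Cauchy_Schwarz[OF assms] by (simp add: real_sqrt_mult[symmetric] real_le_rsqrt)
  ultimately show ?thesis by (simp add: power2_diff)
qed

text \<open>First-order expansion of the \<open>L\<^sup>2\<close> norm at \<open>f\<close> in the direction \<open>g\<close>, with a remainder \<open>r\<close>.
  With \<open>A\<close> and \<open>B\<close> the norms of \<open>f\<close> and \<open>f + h g\<close>, the error of the linear part is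
  \<open>(h\<^sup>2 \<integral> g\<^sup>2 - (B - A)\<^sup>2) / (2 A)\<close>, which is between \<open>0\<close> and \<open>h\<^sup>2 \<integral> g\<^sup>2 / (2 A)\<close>.\<close>

lemma sqrt_integral_expansion:
  fixes f g r :: "'b \<Rightarrow> real"
  assumes [measurable]: "f \<in> borel_measurable L" "g \<in> borel_measurable L" "r \<in> borel_measurable L"
    and f: "integrable L (\<lambda>x. (f x)\<^sup>2)" and g: "integrable L (\<lambda>x. (g x)\<^sup>2)" and r: "integrable L (\<lambda>x. (r x)\<^sup>2)"
    and pos: "0 < (\<integral>x. (f x)\<^sup>2 \<partial>L)"
  defines "A \<equiv> sqrt (\<integral>x. (f x)\<^sup>2 \<partial>L)"
  shows "(sqrt (\<integral>x. (f x + h * g x + r x)\<^sup>2 \<partial>L) - A - h * (\<integral>x. f x * g x \<partial>L) / A)\<^sup>2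
    \<le> 2 * (\<integral>x. (r x)\<^sup>2 \<partial>L) + 2 * (h\<^sup>2 * (\<integral>x. (g x)\<^sup>2 \<partial>L) / (2 * A))\<^sup>2"
proof -
  define B where "B = sqrt (\<integral>x. (f x + h * g x)\<^sup>2 \<partial>L)"
  define b G where "b = (\<integral>x. f x * g x \<partial>L)" and "G = (\<integral>x. (g x)\<^sup>2 \<partial>L)"
  have A0: "0 < A" and A2: "A\<^sup>2 = (\<integral>x. (f x)\<^sup>2 \<partial>L)" using pos by (auto simp: A_def)
  note fh = integral_square_add[OF assms(1,2) f g, of h]
  have B2: "B\<^sup>2 = A\<^sup>2 + 2 * h * b + h\<^sup>2 * G" unfolding B_def A2 b_def G_def fh(2)[symmetric] by simp
  have "(B - A)\<^sup>2 \<le> (\<integral>x. (f x + h * g x - f x)\<^sup>2 \<partial>L)"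
    unfolding B_def A_def by (rule sqrt_integral_diff_le) (use fh(1) f in auto)
  then have BA: "(B - A)\<^sup>2 \<le> h\<^sup>2 * G" by (simp add: G_def power_mult_distrib)
  have "B - A - h * b / A = (h\<^sup>2 * G - (B - A)\<^sup>2) / (2 * A)"
    using A0 B2 by (simp add: field_simps power2_eq_square)
  moreover have "0 \<le> (h\<^sup>2 * G - (B - A)\<^sup>2) / (2 * A)" "(h\<^sup>2 * G - (B - A)\<^sup>2) / (2 * A) \<le> h\<^sup>2 * G / (2 * A)"
    using BA A0 by (auto intro!: divide_right_mono)
  ultimately have 1: "(B - A - h * b / A)\<^sup>2 \<le> (h\<^sup>2 * G / (2 * A))\<^sup>2" by (simp add: power_mono)
  define Q where "Q = sqrt (\<integral>x. (f x + h * g x + r x)\<^sup>2 \<partial>L)"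
  have "integrable L (\<lambda>x. (f x + h * g x + 1 * r x)\<^sup>2)"
    by (rule integral_square_add) (use fh(1) r in auto)
  then have "(Q - B)\<^sup>2 \<le> (\<integral>x. (f x + h * g x + r x - (f x + h * g x))\<^sup>2 \<partial>L)"
    unfolding Q_def B_def by (intro sqrt_integral_diff_le) (use fh(1) in auto)
  then have 2: "(Q - B)\<^sup>2 \<le> (\<integral>x. (r x)\<^sup>2 \<partial>L)" by simp
  have "(Q - A - h * b / A)\<^sup>2 = ((Q - B) + (B - A - h * b / A))\<^sup>2"
    by (rule arg_cong[where f = "\<lambda>x. x\<^sup>2"]) simp
  also have "\<dots> \<le> 2 * (Q - B)\<^sup>2 + 2 * (B - A - h * b / A)\<^sup>2"
  proof -
    have "(u + w)\<^sup>2 \<le> 2 * u\<^sup>2 + 2 * w\<^sup>2" for u w :: real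
      using zero_le_power2[of "u - w"] by (simp add: power2_sum power2_diff)
    then show ?thesis .
  qed
  finally show ?thesis using 1 2 unfolding Q_def b_def G_def by linarith
qed

lemma density_modelD:
  assumes "density_model L \<Theta> p" and \<theta>: "\<theta> \<in> \<Theta>"
  shows "p \<theta> \<in> borel_measurable L" and "\<And>x. x \<in> space L \<Longrightarrow> 0 \<le> p \<theta> x"
    and "(\<integral>\<^sup>+x. ennreal (p \<theta> x) \<partial>L) = 1"
    and "integrable L (p \<theta>)" and "(\<integral>x. p \<theta> x \<partial>L) = 1"
proof -
  show m: "p \<theta> \<in> borel_measurable L" and nn: "\<And>x. x \<in> space L \<Longrightarrow> 0 \<le> p \<theta> x"
    using assms by (auto simp: density_model_def)
  have "prob_space (density L (\<lambda>x. ennreal (p \<theta> x)))" using assms by (auto simp: density_model_def)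
  from prob_space.emeasure_space_1[OF this] show 1: "(\<integral>\<^sup>+x. ennreal (p \<theta> x) \<partial>L) = 1"
    using m by (simp add: emeasure_density cong: nn_integral_cong)
  show "integrable L (p \<theta>)" using m nn 1 by (intro integrableI_nonneg) auto
  show "(\<integral>x. p \<theta> x \<partial>L) = 1" using m nn 1 by (subst integral_eq_nn_integral) auto
qed

lemma eventually_shift_in:
  fixes \<theta>0 :: real
  assumes "\<theta>0 \<in> interior \<Theta>"
  shows "\<forall>\<^sub>F h in at 0. \<theta>0 + h \<in> \<Theta>"
proof -
  obtain e where e: "0 < e" "ball \<theta>0 e \<subseteq> \<Theta>" using assms by (auto simp: mem_interior)
  have "\<forall>\<^sub>F h in at (0::real). dist h 0 < e" using e(1) by (auto simp: eventually_at)
  then show ?thesis by eventually_elim (use e in \<open>auto simp: subset_iff dist_real_def\<close>)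
qed

text \<open>The root of a privatized density is the \<open>L\<^sup>2\<close> norm, weighted with the kernel \<open>k z\<close>, of the
  root of the density, so the expansion of the norm gives the score. The bounds on the kernel make
  the quadratic errors at \<open>z\<close> proportional to \<open>c z\<close>, hence summable. The set \<open>Z\<close> of outputs is
  arbitrary, since the kernels are summed over all natural numbers.\<close>

lemma privatized_DQM:
  fixes L :: "'b measure" and k :: "nat \<Rightarrow> 'b \<Rightarrow> real" and c :: "nat \<Rightarrow> real"
  assumes D: "DQM L \<Theta> p \<theta>0 s" and P: "density_model L \<Theta> p"
    and s2: "integrable L (\<lambda>x. (s x)\<^sup>2 * p \<theta>0 x)"
    and k_meas [measurable]: "\<And>z. k z \<in> borel_measurable L" and k0: "\<And>z x. 0 \<le> k z x"
    and k_sum: "\<And>x. x \<in> space L \<Longrightarrow> (\<Sum>z. ennreal (k z x)) \<le> 1"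
    and c0: "\<And>z. 0 \<le> c z" and c_sum: "(\<Sum>z. ennreal (c z)) \<le> 1"
    and kc: "\<And>z. AE x in L. c z \<le> k z x \<and> k z x \<le> E * c z"
  shows "DQM (count_space Z) \<Theta> (\<lambda>\<theta> z. \<integral>x. k z x * p \<theta> x \<partial>L) \<theta>0
    (\<lambda>z. (\<integral>x. k z x * (s x * p \<theta>0 x) \<partial>L) / (\<integral>x. k z x * p \<theta>0 x \<partial>L))"
proof -
  have s_meas [measurable]: "s \<in> borel_measurable L" and int\<Theta>: "\<theta>0 \<in> interior \<Theta>"
    using D by (auto simp: DQM_def)
  have \<theta>0: "\<theta>0 \<in> \<Theta>" using int\<Theta> interior_subset by auto
  note p_meas [measurable] = density_modelD(1)[OF P] and p0 = density_modelD(2)[OF P]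
    and p_int = density_modelD(4)[OF P] and p_1 = density_modelD(5)[OF P]
  have k1: "k z x \<le> 1" if x: "x \<in> space L" for z x
  proof -
    have "ennreal (k z x) \<le> (\<Sum>z. ennreal (k z x))"
      using sum_le_suminf[of "\<lambda>z. ennreal (k z x)" "{z}"] by auto
    also have "\<dots> \<le> 1" by (rule k_sum[OF x])
    finally show ?thesis by simp
  qed
  have k_bd: "AE x in L. \<bar>k z x\<bar> \<le> 1" for z using k0 k1 by (intro AE_I2) auto
  note k_int = integrable_bounded_times_integrable[OF k_meas k_bd]
  define a where "a x = sqrt (p \<theta>0 x)" for x
  define \<eta> where "\<eta> x = s x * a x / 2" for x
  define R where "R h x = sqrt (p (\<theta>0 + h) x) - sqrt (p \<theta>0 x) - 1/2 * h * s x * sqrt (p \<theta>0 x)" for h x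
  define pt where "pt \<theta> z = (\<integral>x. k z x * p \<theta> x \<partial>L)" for \<theta> z
  define t where "t z = (\<integral>x. k z x * (s x * p \<theta>0 x) \<partial>L) / pt \<theta>0 z" for z
  define W where "W = (\<integral>x. (\<eta> x)\<^sup>2 \<partial>L)"
  define Rem where "Rem h z = sqrt (pt (\<theta>0 + h) z) - sqrt (pt \<theta>0 z) - 1/2 * h * t z * sqrt (pt \<theta>0 z)" for h z
  have a2: "(a x)\<^sup>2 = p \<theta>0 x" if "x \<in> space L" for x using p0[OF \<theta>0 that] by (simp add: a_def)
  have [measurable]: "a \<in> borel_measurable L" "\<eta> \<in> borel_measurable L"
    using \<theta>0 unfolding a_def[abs_def] \<eta>_def[abs_def] by measurable
  have int_a: "integrable L (\<lambda>x. (a x)\<^sup>2)"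
    using p_int[OF \<theta>0] by (subst Bochner_Integration.integrable_cong[OF refl a2]) 
  have \<eta>2: "(\<eta> x)\<^sup>2 = (s x)\<^sup>2 * p \<theta>0 x / 4" if "x \<in> space L" for x
    using a2[OF that] by (simp add: \<eta>_def power_divide power_mult_distrib)
  have int_\<eta>: "integrable L (\<lambda>x. (\<eta> x)\<^sup>2)"
    using s2 by (subst Bochner_Integration.integrable_cong[OF refl \<eta>2]) auto
  have W0: "0 \<le> W" by (simp add: W_def)
  have Rem_le: "(Rem h z)\<^sup>2 \<le> 2 * (\<integral>x. k z x * (R h x)\<^sup>2 \<partial>L) + h^4 * (E\<^sup>2 * W\<^sup>2 / 2) * c z"
    if h: "\<theta>0 + h \<in> \<Theta>" "integrable L (\<lambda>x. (R h x)\<^sup>2)" for h z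
  proof (cases "c z = 0")
    case True
    then have k0z: "AE x in L. k z x = 0" using kc[of z] k0[of z] by (auto elim!: eventually_mono intro: antisym)
    have "pt \<theta> z = 0" if "\<theta> \<in> \<Theta>" for \<theta>
    proof -
      have "pt \<theta> z = (\<integral>x. 0 \<partial>L)"
        unfolding pt_def using k0z that by (intro integral_cong_AE) auto
      then show ?thesis by simp
    qed
    then show ?thesis using h \<theta>0 True k0 by (simp add: Rem_def)
  next
    case False
    then have cz: "0 < c z" using c0[of z] by simp
    \<comment> \<open>Multiplying with the root of the kernel turns the weighted norm into the plain one. The
      roots of the densities are \<open>a\<close>, with derivative \<open>\<eta>\<close> and remainder \<open>R h\<close>.\<close>
    define f g r where "f x = sqrt (k z x) * a x" and "g x = sqrt (k z x) * \<eta> x" and "r x = sqrt (k z x) * R h x" for x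
    have [measurable]: "R h \<in> borel_measurable L" using h \<theta>0 unfolding R_def[abs_def] by measurable
    have [measurable]: "f \<in> borel_measurable L" "g \<in> borel_measurable L" "r \<in> borel_measurable L"
      unfolding f_def[abs_def] g_def[abs_def] r_def[abs_def] by measurable
    have sq: "(f x)\<^sup>2 = k z x * (a x)\<^sup>2" "(g x)\<^sup>2 = k z x * (\<eta> x)\<^sup>2" "(r x)\<^sup>2 = k z x * (R h x)\<^sup>2" for x
      using k0 by (auto simp: f_def g_def r_def power_mult_distrib)
    have fint: "integrable L (\<lambda>x. (f x)\<^sup>2)" "integrable L (\<lambda>x. (g x)\<^sup>2)" "integrable L (\<lambda>x. (r x)\<^sup>2)"
      unfolding sq by (intro k_int int_a int_\<eta> h)+
    have pf: "pt \<theta>0 z = (\<integral>x. (f x)\<^sup>2 \<partial>L)"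
      unfolding pt_def sq by (intro Bochner_Integration.integral_cong) (auto simp: a2)
    have c_le: "c z \<le> pt \<theta>0 z"
    proof -
      have "c z = (\<integral>x. c z * p \<theta>0 x \<partial>L)" using p_1[OF \<theta>0] by simp
      also have "\<dots> \<le> (\<integral>x. k z x * p \<theta>0 x \<partial>L)"
      proof (intro integral_mono_AE k_int)
        show "AE x in L. c z * p \<theta>0 x \<le> k z x * p \<theta>0 x"
          using kc[of z] AE_space by eventually_elim (auto intro!: mult_right_mono p0[OF \<theta>0])
      qed (use p_int[OF \<theta>0] in auto)
      finally show ?thesis by (simp add: pt_def)
    qed
    have G_le: "(\<integral>x. (g x)\<^sup>2 \<partial>L) \<le> E * c z * W"
    proof -
      have "(\<integral>x. (g x)\<^sup>2 \<partial>L) \<le> (\<integral>x. E * c z * (\<eta> x)\<^sup>2 \<partial>L)"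
        unfolding sq
      proof (intro integral_mono_AE k_int)
        show "AE x in L. k z x * (\<eta> x)\<^sup>2 \<le> E * c z * (\<eta> x)\<^sup>2"
          using kc[of z] by eventually_elim (auto intro!: mult_right_mono)
      qed (use int_\<eta> in auto)
      then show ?thesis by (simp add: W_def)
    qed
    have pos: "0 < (\<integral>x. (f x)\<^sup>2 \<partial>L)" using cz c_le pf by simp
    have "(sqrt (\<integral>x. (f x + h * g x + r x)\<^sup>2 \<partial>L) - sqrt (pt \<theta>0 z) - h * (\<integral>x. f x * g x \<partial>L) / sqrt (pt \<theta>0 z))\<^sup>2
      \<le> 2 * (\<integral>x. (r x)\<^sup>2 \<partial>L) + 2 * (h\<^sup>2 * (\<integral>x. (g x)\<^sup>2 \<partial>L) / (2 * sqrt (pt \<theta>0 z)))\<^sup>2"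
      unfolding pf by (rule sqrt_integral_expansion) (use fint pos in auto)
    also have "(\<integral>x. (f x + h * g x + r x)\<^sup>2 \<partial>L) = pt (\<theta>0 + h) z"
      unfolding pt_def
    proof (intro Bochner_Integration.integral_cong refl)
      fix x assume x: "x \<in> space L"
      have "f x + h * g x + r x = sqrt (k z x) * sqrt (p (\<theta>0 + h) x)"
        by (simp add: f_def g_def r_def R_def \<eta>_def a_def algebra_simps)
      then show "(f x + h * g x + r x)\<^sup>2 = k z x * p (\<theta>0 + h) x"
        using k0 p0[OF h(1) x] by (simp add: power_mult_distrib)
    qed
    also have "h * (\<integral>x. f x * g x \<partial>L) / sqrt (pt \<theta>0 z) = 1/2 * h * t z * sqrt (pt \<theta>0 z)"
    proof -
      have "(\<integral>x. f x * g x \<partial>L) = (\<integral>x. k z x * (s x * p \<theta>0 x) / 2 \<partial>L)"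
      proof (intro Bochner_Integration.integral_cong refl)
        fix x assume x: "x \<in> space L"
        have "f x * g x = (sqrt (k z x))\<^sup>2 * (s x * (a x)\<^sup>2 / 2)"
          by (simp add: f_def g_def \<eta>_def power2_eq_square algebra_simps)
        then show "f x * g x = k z x * (s x * p \<theta>0 x) / 2" using a2[OF x] k0 by simp
      qed
      then have "(\<integral>x. f x * g x \<partial>L) = (\<integral>x. k z x * (s x * p \<theta>0 x) \<partial>L) / 2" by simp
      moreover have "pt \<theta>0 z = sqrt (pt \<theta>0 z) * sqrt (pt \<theta>0 z)" using cz c_le by simp
      ultimately show ?thesis using cz c_le
        by (simp add: t_def divide_simps)
    qed
    also have "(h\<^sup>2 * (\<integral>x. (g x)\<^sup>2 \<partial>L) / (2 * sqrt (pt \<theta>0 z)))\<^sup>2 \<le> h^4 * (E\<^sup>2 * W\<^sup>2 / 4) * c z"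
    proof -
      have "(h\<^sup>2 * (\<integral>x. (g x)\<^sup>2 \<partial>L) / (2 * sqrt (pt \<theta>0 z)))\<^sup>2 = h^4 * (\<integral>x. (g x)\<^sup>2 \<partial>L)\<^sup>2 / (4 * pt \<theta>0 z)"
        using cz c_le by (simp add: power_divide power_mult_distrib flip: power_mult)
      also have "\<dots> \<le> h^4 * (E * c z * W)\<^sup>2 / (4 * c z)"
        using G_le c_le cz by (intro frac_le mult_left_mono power_mono) auto
      also have "\<dots> = h^4 * (E\<^sup>2 * W\<^sup>2 / 4) * c z"
        using cz by (simp add: power2_eq_square field_simps)
      finally show ?thesis .
    qed
    finally show ?thesis by (simp add: Rem_def sq mult_ac)
  qed
  have ev: "\<forall>\<^sub>F h in at 0. \<theta>0 + h \<in> \<Theta> \<and> integrable L (\<lambda>x. (R h x)\<^sup>2)"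
  proof -
    have "\<forall>\<^sub>F h in at 0. \<theta>0 + h \<in> \<Theta>" by (rule eventually_shift_in[OF int\<Theta>])
    then show ?thesis using D by (auto simp: DQM_def R_def eventually_conj_iff)
  qed
  have total: "integrable (count_space Z) (\<lambda>z. (Rem h z)\<^sup>2) \<and>
      (\<integral>z. (Rem h z)\<^sup>2 \<partial>count_space Z) \<le> 2 * (\<integral>x. (R h x)\<^sup>2 \<partial>L) + h^4 * (E\<^sup>2 * W\<^sup>2 / 2)"
    if h: "\<theta>0 + h \<in> \<Theta>" "integrable L (\<lambda>x. (R h x)\<^sup>2)" for h
  proof -
    have [measurable]: "R h \<in> borel_measurable L" using h \<theta>0 unfolding R_def[abs_def] by measurable
    have ennreal_2_plus: "ennreal (2 * u + v * w) = ennreal 2 * ennreal u + ennreal v * ennreal w"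
      if "0 \<le> u" "0 \<le> v" "0 \<le> w" for u v w
      using that ennreal_plus[of "2 * u" "v * w"] ennreal_mult[of 2 u] ennreal_mult[of v w] by simp
    have "(\<integral>\<^sup>+z. ennreal ((Rem h z)\<^sup>2) \<partial>count_space Z) \<le> (\<integral>\<^sup>+z. ennreal ((Rem h z)\<^sup>2) \<partial>count_space UNIV)"
      by (subst nn_integral_count_space_indicator) (auto intro!: nn_integral_mono simp: indicator_def)
    also have "\<dots> = (\<Sum>z. ennreal ((Rem h z)\<^sup>2))" by (rule nn_integral_count_space_nat)
    also have "\<dots> \<le> (\<Sum>z. ennreal 2 * (\<integral>\<^sup>+x. ennreal (k z x) * ennreal ((R h x)\<^sup>2) \<partial>L) + ennreal (h^4 * (E\<^sup>2 * W\<^sup>2 / 2)) * ennreal (c z))"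
    proof (intro suminf_le summableI)
      fix z
      have "ennreal ((Rem h z)\<^sup>2) \<le> ennreal (2 * (\<integral>x. k z x * (R h x)\<^sup>2 \<partial>L) + h^4 * (E\<^sup>2 * W\<^sup>2 / 2) * c z)"
        by (intro ennreal_leI Rem_le h)
      also have "\<dots> = ennreal 2 * ennreal (\<integral>x. k z x * (R h x)\<^sup>2 \<partial>L) + ennreal (h^4 * (E\<^sup>2 * W\<^sup>2 / 2)) * ennreal (c z)"
        using k0 c0 by (intro ennreal_2_plus) auto
      also have "ennreal (\<integral>x. k z x * (R h x)\<^sup>2 \<partial>L) = (\<integral>\<^sup>+x. ennreal (k z x) * ennreal ((R h x)\<^sup>2) \<partial>L)"
        using k0 by (subst nn_integral_eq_integral[symmetric]) (auto simp: ennreal_mult intro!: k_int h)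
      finally show "ennreal ((Rem h z)\<^sup>2) \<le> ennreal 2 * (\<integral>\<^sup>+x. ennreal (k z x) * ennreal ((R h x)\<^sup>2) \<partial>L) + ennreal (h^4 * (E\<^sup>2 * W\<^sup>2 / 2)) * ennreal (c z)" .
    qed
    also have "\<dots> = ennreal 2 * (\<integral>\<^sup>+x. (\<Sum>z. ennreal (k z x)) * ennreal ((R h x)\<^sup>2) \<partial>L) + ennreal (h^4 * (E\<^sup>2 * W\<^sup>2 / 2)) * (\<Sum>z. ennreal (c z))"
      by (subst suminf_add[symmetric]) (auto simp: nn_integral_suminf[symmetric])
    also have "\<dots> \<le> ennreal 2 * (\<integral>\<^sup>+x. 1 * ennreal ((R h x)\<^sup>2) \<partial>L) + ennreal (h^4 * (E\<^sup>2 * W\<^sup>2 / 2)) * 1"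
      by (intro add_mono mult_left_mono nn_integral_mono mult_right_mono k_sum c_sum) auto
    also have "\<dots> = ennreal (2 * (\<integral>x. (R h x)\<^sup>2 \<partial>L) + h^4 * (E\<^sup>2 * W\<^sup>2 / 2))"
      using ennreal_2_plus[of "\<integral>x. (R h x)\<^sup>2 \<partial>L" "h^4 * (E\<^sup>2 * W\<^sup>2 / 2)" 1] nn_integral_eq_integral[OF h(2)]
      by simp
    finally have le: "(\<integral>\<^sup>+z. ennreal ((Rem h z)\<^sup>2) \<partial>count_space Z) \<le> ennreal (2 * (\<integral>x. (R h x)\<^sup>2 \<partial>L) + h^4 * (E\<^sup>2 * W\<^sup>2 / 2))" .
    have int: "integrable (count_space Z) (\<lambda>z. (Rem h z)\<^sup>2)"
      using le by (intro integrableI_nonneg) (auto intro: le_less_trans)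
    have "ennreal (\<integral>z. (Rem h z)\<^sup>2 \<partial>count_space Z) \<le> ennreal (2 * (\<integral>x. (R h x)\<^sup>2 \<partial>L) + h^4 * (E\<^sup>2 * W\<^sup>2 / 2))"
      using le by (subst nn_integral_eq_integral[OF int, symmetric]) auto
    moreover have "0 \<le> 2 * (\<integral>x. (R h x)\<^sup>2 \<partial>L) + h^4 * (E\<^sup>2 * W\<^sup>2 / 2)" by simp
    ultimately show ?thesis using int by (simp only: ennreal_le_iff)
  qed
  have h4: "(\<lambda>h::real. h^4 * (E\<^sup>2 * W\<^sup>2 / 2)) \<in> o[at 0](\<lambda>h. h\<^sup>2)"
  proof (rule smalloI_tendsto)
    have "((\<lambda>h::real. h\<^sup>2 * (E\<^sup>2 * W\<^sup>2 / 2)) \<longlongrightarrow> 0\<^sup>2 * (E\<^sup>2 * W\<^sup>2 / 2)) (at 0)" by (intro tendsto_intros)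
    moreover have "\<forall>\<^sub>F h::real in at 0. h\<^sup>2 * (E\<^sup>2 * W\<^sup>2 / 2) = h^4 * (E\<^sup>2 * W\<^sup>2 / 2) / h\<^sup>2"
      by (auto simp: eventually_at_filter field_simps power2_eq_square power4_eq_xxxx)
    ultimately have "((\<lambda>h::real. h^4 * (E\<^sup>2 * W\<^sup>2 / 2) / h\<^sup>2) \<longlongrightarrow> 0\<^sup>2 * (E\<^sup>2 * W\<^sup>2 / 2)) (at 0)"
      by (rule Lim_transform_eventually)
    then show "((\<lambda>h::real. h^4 * (E\<^sup>2 * W\<^sup>2 / 2) / h\<^sup>2) \<longlongrightarrow> 0) (at 0)" by simp
    show "\<forall>\<^sub>F h::real in at 0. h\<^sup>2 \<noteq> 0" by (simp add: eventually_at_filter)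
  qed
  have "(\<lambda>h. \<integral>x. (R h x)\<^sup>2 \<partial>L) \<in> o[at 0](\<lambda>h. h\<^sup>2)" using D by (simp add: DQM_def R_def)
  then have small: "(\<lambda>h. 2 * (\<integral>x. (R h x)\<^sup>2 \<partial>L) + h^4 * (E\<^sup>2 * W\<^sup>2 / 2)) \<in> o[at 0](\<lambda>h. h\<^sup>2)"
    by (intro sum_in_smallo h4) simp
  have "(\<lambda>h. \<integral>z. (Rem h z)\<^sup>2 \<partial>count_space Z) \<in> O[at 0](\<lambda>h. 2 * (\<integral>x. (R h x)\<^sup>2 \<partial>L) + h^4 * (E\<^sup>2 * W\<^sup>2 / 2))"
  proof (rule landau_o.big_mono)
    show "\<forall>\<^sub>F h in at 0. norm (\<integral>z. (Rem h z)\<^sup>2 \<partial>count_space Z) \<le> norm (2 * (\<integral>x. (R h x)\<^sup>2 \<partial>L) + h^4 * (E\<^sup>2 * W\<^sup>2 / 2))"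
      using ev by eventually_elim (use total in \<open>force simp: integral_nonneg\<close>)
  qed
  then have "(\<lambda>h. \<integral>z. (Rem h z)\<^sup>2 \<partial>count_space Z) \<in> o[at 0](\<lambda>h. h\<^sup>2)"
    using small by (rule landau_o.big_small_trans)
  moreover have "\<forall>\<^sub>F h in at 0. integrable (count_space Z) (\<lambda>z. (Rem h z)\<^sup>2)"
    using ev by eventually_elim (use total in blast)
  ultimately show ?thesis using int\<Theta> by (simp add: DQM_def Rem_def pt_def t_def)
qed

text \<open>The mechanism with a single output has the constant privatized density \<open>1\<close>, hence score
  \<open>0\<close>. Its score is also the mean of \<open>s\<close>, and scores are unique.\<close>

lemma DQM_score_mean_zero:
  assumes D: "DQM L \<Theta> p \<theta>0 s" and P: "density_model L \<Theta> p"
    and s2: "integrable L (\<lambda>x. (s x)\<^sup>2 * p \<theta>0 x)"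
  shows "(\<integral>x. s x * p \<theta>0 x \<partial>L) = 0"
proof -
  define c where "c z = (if z = 0 then 1 else 0 :: real)" for z :: nat
  have c_nonneg: "0 \<le> c z" for z by (simp add: c_def)
  have int\<Theta>: "\<theta>0 \<in> interior \<Theta>" using D by (simp add: DQM_def)
  note p1 = density_modelD(5)[OF P]
  have sum1: "(\<Sum>z. ennreal (c z)) = 1"
  proof -
    have "(\<lambda>z. ennreal (c z)) = (\<lambda>z. if z = 0 then 1 else 0)" by (auto simp: c_def)
    then show ?thesis by (simp add: sums_unique[OF sums_single, symmetric])
  qed
  let ?pt = "\<lambda>\<theta> z. \<integral>x. c z * p \<theta> x \<partial>L"
  have "DQM (count_space {0}) \<Theta> ?pt \<theta>0
      (\<lambda>z. (\<integral>x. c z * (s x * p \<theta>0 x) \<partial>L) / (\<integral>x. c z * p \<theta>0 x \<partial>L))"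
  proof (rule privatized_DQM[OF D P s2, where k = "\<lambda>z x. c z" and c = c and E = 1])
  qed (simp_all add: sum1 c_nonneg)
  moreover have "DQM (count_space {0}) \<Theta> ?pt \<theta>0 (\<lambda>_. 0)"
  proof -
    note ev = eventually_shift_in[OF int\<Theta>]
    have \<theta>0: "\<theta>0 \<in> \<Theta>" using int\<Theta> interior_subset by auto
    have "\<forall>\<^sub>F h in at 0. (\<integral>z. (sqrt (?pt (\<theta>0 + h) z) - sqrt (?pt \<theta>0 z) - 1 / 2 * h * 0 * sqrt (?pt \<theta>0 z))\<^sup>2 \<partial>count_space {0}) = 0"
      using ev by eventually_elim (simp add: lebesgue_integral_count_space_finite c_def p1 \<theta>0)
    then have "(\<lambda>h. \<integral>z. (sqrt (?pt (\<theta>0 + h) z) - sqrt (?pt \<theta>0 z) - 1 / 2 * h * 0 * sqrt (?pt \<theta>0 z))\<^sup>2 \<partial>count_space {0}) \<in> o[at 0](\<lambda>h. h\<^sup>2)"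
      by (intro landau_o.smallI) (auto elim!: eventually_mono)
    then show ?thesis using int\<Theta> by (simp add: DQM_def integrable_count_space)
  qed
  ultimately have "AE z in count_space {0}. (\<integral>x. c z * (s x * p \<theta>0 x) \<partial>L) / ?pt \<theta>0 z * sqrt (?pt \<theta>0 z) = 0 * sqrt (?pt \<theta>0 z)"
    by (rule DQM_score_unique) simp
  then show ?thesis using p1[of \<theta>0] int\<Theta> interior_subset[of \<Theta>] by (auto simp: AE_count_space c_def)
qed

section \<open>Consequences of local differential privacy\<close>

text \<open>The constant is the supremum of \<open>g\<close> over a set of full measure, divided by \<open>E\<close>.\<close>

lemma AE_pair_ratio_imp_bounds:
  fixes g :: "'b \<Rightarrow> real"
  assumes L: "sigma_finite_measure L" and ne: "emeasure L (space L) \<noteq> 0" and E: "0 < E"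
    and g: "\<And>x. 0 \<le> g x" "\<And>x. g x \<le> 1"
    and ratio: "AE (x, x') in L \<Otimes>\<^sub>M L. g x \<le> E * g x'"
  obtains c where "0 \<le> c" "AE x in L. c \<le> g x \<and> g x \<le> E * c"
proof -
  interpret sigma_finite_measure L by (rule L)
  interpret pair_sigma_finite L L ..
  define S where "S = {x. AE x' in L. g x \<le> E * g x'}"
  have S: "AE x in L. x \<in> S" using AE_pair[OF ratio] by (simp add: S_def)
  have "S \<noteq> {}"
  proof
    assume "S = {}"
    then have "AE x in L. False" using S by simp
    then show False using ne by (simp add: ae_filter_eq_bot_iff eventually_const_iff)
  qed
  define m where "m = Sup (g ` S)"
  have bdd: "bdd_above (g ` S)" using g by (auto intro!: bdd_aboveI[of _ 1])
  have m_ge: "g x \<le> m" if "x \<in> S" for x unfolding m_def by (rule cSUP_upper[OF that bdd])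
  have "\<exists>x\<in>S. m - 1 / real (Suc j) < g x" for j
    using less_cSUP_iff[OF \<open>S \<noteq> {}\<close> bdd, of "m - 1 / real (Suc j)"] by (simp add: m_def)
  then obtain u where u: "\<And>j. u j \<in> S" "\<And>j. m - 1 / real (Suc j) < g (u j)" by metis
  have "AE x in L. \<forall>j. g (u j) \<le> E * g x" using u(1) by (auto simp: AE_all_countable S_def)
  then have low: "AE x in L. m \<le> E * g x"
  proof eventually_elim
    fix x assume x: "\<forall>j. g (u j) \<le> E * g x"
    show "m \<le> E * g x"
    proof (rule field_le_epsilon)
      fix e :: real assume "0 < e"
      then obtain j where "1 / real (Suc j) < e" using nat_approx_posE by blast
      then show "m \<le> E * g x + e" using u(2)[of j] x[rule_format, of j] by linarith
    qed
  qed
  obtain x0 where "x0 \<in> S" using \<open>S \<noteq> {}\<close> by auto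
  then have "0 \<le> m" using m_ge[of x0] g(1)[of x0] by linarith
  moreover have "AE x in L. m / E \<le> g x \<and> g x \<le> E * (m / E)"
    using low S by eventually_elim (use E m_ge in \<open>auto simp: field_simps\<close>)
  ultimately show thesis using E by (intro that[of "m / E"]) auto
qed

lemma lower_bounds_sum_le_1:
  fixes k :: "nat \<Rightarrow> 'b \<Rightarrow> real"
  assumes ne: "emeasure L (space L) \<noteq> 0"
    and sum: "\<And>x. x \<in> space L \<Longrightarrow> (\<Sum>z. ennreal (k z x)) \<le> 1"
    and c: "\<And>z. AE x in L. c z \<le> k z x"
  shows "(\<Sum>z. ennreal (c z)) \<le> 1"
proof -
  have "AE x in L. \<forall>z. c z \<le> k z x" using c by (simp add: AE_all_countable)
  then have "AE x in L. (\<Sum>z. ennreal (c z)) \<le> 1"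
    using AE_space
  proof eventually_elim
    fix x assume x: "\<forall>z. c z \<le> k z x" "x \<in> space L"
    have "(\<Sum>z. ennreal (c z)) \<le> (\<Sum>z. ennreal (k z x))"
      using x by (intro suminf_le summableI) (auto intro: ennreal_leI)
    also have "\<dots> \<le> 1" by (rule sum[OF x(2)])
    finally show "(\<Sum>z. ennreal (c z)) \<le> 1" .
  qed
  then show ?thesis using ne by (simp add: ae_filter_eq_bot_iff eventually_const_iff)
qed

text \<open>Privacy of single outputs passes to sets of outputs, by summation.\<close>

lemma LDP_mechanism_event:
  assumes q: "(Z, q) \<in> LDP_mechanisms X \<alpha>"
  shows "(\<lambda>x. measure (measure_pmf (q x)) U) \<in> borel_measurable (lebesgue_on X)"
    and "AE (x, x') in lebesgue_on X \<Otimes>\<^sub>M lebesgue_on X.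
      measure (measure_pmf (q x)) U \<le> exp \<alpha> * measure (measure_pmf (q x')) U"
proof -
  have supp: "pmf (q x) z = 0" if "x \<in> X" "z \<notin> Z" for x z
    using q that by (auto simp: LDP_mechanisms_def pmf_eq_0_set_pmf)
  have pmf_meas [measurable]: "(\<lambda>x. pmf (q x) z) \<in> borel_measurable (lebesgue_on X)" for z
  proof (cases "z \<in> Z")
    case True then show ?thesis using q by (auto simp: LDP_mechanisms_def)
  next
    case False
    have "(\<lambda>x. pmf (q x) z) \<in> borel_measurable (lebesgue_on X) \<longleftrightarrow> (\<lambda>x. 0::real) \<in> borel_measurable (lebesgue_on X)"
      using False by (intro measurable_cong) (simp add: supp)
    then show ?thesis by simp
  qed
  have eq: "measure (measure_pmf (q x)) U = enn2real (\<Sum>z. ennreal (pmf (q x) z) * indicator U z)" for x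
    unfolding measure_def nn_integral_pmf[symmetric]
    by (simp add: nn_integral_count_space_indicator nn_integral_count_space_nat)
  show "(\<lambda>x. measure (measure_pmf (q x)) U) \<in> borel_measurable (lebesgue_on X)"
    unfolding eq by measurable
  let ?L = "lebesgue_on X"
  have "AE y in ?L \<Otimes>\<^sub>M ?L. \<forall>z\<in>Z. pmf (q (fst y)) z \<le> exp \<alpha> * pmf (q (snd y)) z"
    using q by (subst AE_ball_countable) (auto simp: LDP_mechanisms_def case_prod_beta)
  then have "AE y in ?L \<Otimes>\<^sub>M ?L. measure (measure_pmf (q (fst y))) U \<le> exp \<alpha> * measure (measure_pmf (q (snd y))) U"
    using AE_space
  proof eventually_elim
    fix y assume y: "\<forall>z\<in>Z. pmf (q (fst y)) z \<le> exp \<alpha> * pmf (q (snd y)) z" "y \<in> space (?L \<Otimes>\<^sub>M ?L)"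
    have le: "pmf (q (fst y)) z \<le> exp \<alpha> * pmf (q (snd y)) z" for z
      using y supp by (cases "z \<in> Z") (auto simp: space_pair_measure)
    have "emeasure (measure_pmf (q (fst y))) U \<le> (\<integral>\<^sup>+z. ennreal (exp \<alpha>) * ennreal (pmf (q (snd y)) z) \<partial>count_space U)"
      unfolding nn_integral_pmf[symmetric]
      by (intro nn_integral_mono) (use le in \<open>simp add: ennreal_mult[symmetric] ennreal_leI\<close>)
    also have "\<dots> = ennreal (exp \<alpha>) * emeasure (measure_pmf (q (snd y))) U"
      by (simp add: nn_integral_cmult nn_integral_pmf)
    finally show "measure (measure_pmf (q (fst y))) U \<le> exp \<alpha> * measure (measure_pmf (q (snd y))) U"
      by (simp add: measure_pmf.emeasure_eq_measure ennreal_mult[symmetric])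
  qed
  then show "AE (x, x') in ?L \<Otimes>\<^sub>M ?L. measure (measure_pmf (q x)) U \<le> exp \<alpha> * measure (measure_pmf (q x')) U"
    by (simp add: case_prod_beta)
qed

section \<open>Lebesgue density points and the evaluation operator\<close>

text \<open>The balls in which the proportion of \<open>A\<close> exceeds \<open>1 / k\<close> form a Vitali cover. They may be
  taken inside an open set \<open>U\<close> that contains little of \<open>A\<close>, and a disjoint family of them has total
  measure at most \<open>k\<close> times that of \<open>A \<inter> U\<close>.\<close>

lemma negligible_upper_density_points:
  fixes A :: "'a::euclidean_space set"
  assumes A: "A \<in> sets lebesgue" and k: "0 < (k::real)"
  shows "negligible {x \<in> ball 0 R - A. \<forall>d>0. \<exists>\<epsilon>. 0 < \<epsilon> \<and> \<epsilon> < d \<and>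
    measure lebesgue (ball x \<epsilon>) < k * measure lebesgue (A \<inter> ball x \<epsilon>)}" (is "negligible ?N")
  unfolding negligible_outer_le
proof (intro allI impI)
  fix e :: real assume e: "0 < e"
  have S: "ball 0 R - A \<in> sets lebesgue" using A by auto
  obtain T where T: "open T" "ball 0 R - A \<subseteq> T" "T - (ball 0 R - A) \<in> lmeasurable"
      "emeasure lebesgue (T - (ball 0 R - A)) < ennreal (e / k)"
    using sets_lebesgue_outer_open[OF S, of "e / k"] e k by auto
  define U where "U = T \<inter> ball 0 R"
  have U: "open U" "?N \<subseteq> U" using T by (auto simp: U_def)
  define K where "K = {(x, \<epsilon>). x \<in> ?N \<and> 0 < \<epsilon> \<and> ball x \<epsilon> \<subseteq> U \<and>
    measure lebesgue (ball x \<epsilon>) < k * measure lebesgue (A \<inter> ball x \<epsilon>)}"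
  obtain C where C: "countable C" "C \<subseteq> K"
     "pairwise (\<lambda>i j. disjnt (ball (fst i) (snd i)) (ball (fst j) (snd j))) C"
     "negligible (?N - (\<Union>i\<in>C. ball (fst i) (snd i)))"
  proof (rule Vitali_covering_theorem_balls[of ?N K fst snd])
    fix x and d :: real assume x: "x \<in> ?N" and d: "0 < d"
    obtain d' where d': "0 < d'" "ball x d' \<subseteq> U" using U x by (meson openE subsetD)
    have "0 < min d d'" using d d' by simp
    then obtain \<epsilon> where \<epsilon>: "0 < \<epsilon>" "\<epsilon> < min d d'" "measure lebesgue (ball x \<epsilon>) < k * measure lebesgue (A \<inter> ball x \<epsilon>)"
      using x by blast
    then have "(x, \<epsilon>) \<in> K" using x d' by (auto simp: K_def)
    then show "\<exists>i. i \<in> K \<and> x \<in> ball (fst i) (snd i) \<and> snd i < d"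
      using \<epsilon> by (intro exI[of _ "(x, \<epsilon>)"]) auto
  qed
  let ?B = "\<lambda>i::'a \<times> real. ball (fst i) (snd i)"
  have disj1: "disjoint_family_on ?B C"
    using C(3) unfolding pairwise_def disjoint_family_on_def disjnt_def by blast
  then have disj: "disjoint_family_on ?B C" "disjoint_family_on (\<lambda>i. A \<inter> ?B i) C"
    unfolding disjoint_family_on_def by blast+
  have fin: "A \<inter> ball x r \<in> lmeasurable" for x r
    using A by (intro fmeasurable_Int_fmeasurable[of "ball x r", simplified Int_commute]) auto
  have "emeasure lebesgue (\<Union>i\<in>C. ?B i) = (\<integral>\<^sup>+i. emeasure lebesgue (?B i) \<partial>count_space C)"
    using C(1) disj by (intro emeasure_UN_countable) auto
  also have "\<dots> \<le> (\<integral>\<^sup>+i. ennreal k * emeasure lebesgue (A \<inter> ?B i) \<partial>count_space C)"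
  proof (rule nn_integral_mono)
    fix i assume "i \<in> space (count_space C)"
    then have "measure lebesgue (?B i) \<le> k * measure lebesgue (A \<inter> ?B i)"
      using C(2) by (force simp: K_def)
    then have "ennreal (measure lebesgue (?B i)) \<le> ennreal k * ennreal (measure lebesgue (A \<inter> ?B i))"
      using k by (simp add: ennreal_mult[symmetric])
    then show "emeasure lebesgue (?B i) \<le> ennreal k * emeasure lebesgue (A \<inter> ?B i)"
      using fin[of "fst i" "snd i"] by (simp add: emeasure_eq_measure2)
  qed
  also have "\<dots> = ennreal k * emeasure lebesgue (\<Union>i\<in>C. A \<inter> ?B i)"
    using C(1) disj A by (subst emeasure_UN_countable) (auto simp: nn_integral_cmult)
  also have "\<dots> \<le> ennreal k * emeasure lebesgue (T - (ball 0 R - A))"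
    using C(2) T(3) by (intro mult_left_mono emeasure_mono) (fastforce simp: K_def U_def)+
  also have "\<dots> \<le> ennreal k * ennreal (e / k)"
    using T(4) by (intro mult_left_mono) auto
  also have "\<dots> = ennreal e" using k e by (simp add: ennreal_mult[symmetric])
  finally have le: "emeasure lebesgue (\<Union>i\<in>C. ?B i) \<le> ennreal e" .
  have "open (\<Union>i\<in>C. ?B i)" by auto
  then have "(\<Union>i\<in>C. ?B i) \<in> sets lebesgue" by simp
  then have Bm: "(\<Union>i\<in>C. ?B i) \<in> lmeasurable"
    using le by (intro fmeasurableI) (auto intro: le_less_trans)
  define N0 where "N0 = ?N - (\<Union>i\<in>C. ?B i)"
  have N0: "N0 \<in> null_sets lebesgue" using C(4) unfolding N0_def negligible_iff_null_sets .
  have "measure lebesgue (N0 \<union> (\<Union>i\<in>C. ?B i)) = measure lebesgue (\<Union>i\<in>C. ?B i)"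
    unfolding Un_commute[of N0] by (rule measure_Un_null_set[OF fmeasurableD[OF Bm] N0])
  also have "\<dots> \<le> e" using le e Bm by (simp add: emeasure_eq_measure2)
  finally have "measure lebesgue (N0 \<union> (\<Union>i\<in>C. ?B i)) \<le> e" .
  moreover have "N0 \<union> (\<Union>i\<in>C. ?B i) \<in> lmeasurable"
    by (intro fmeasurable.Un Bm) (use C(4) in \<open>simp only: N0_def negligible_imp_measurable\<close>)
  moreover have "?N \<subseteq> N0 \<union> (\<Union>i\<in>C. ?B i)" unfolding N0_def by blast
  ultimately show "\<exists>T. ?N \<subseteq> T \<and> T \<in> lmeasurable \<and> measure lebesgue T \<le> e" by blast
qed

lemma AE_density_zero_outside:
  fixes A :: "'a::euclidean_space set"
  assumes A: "A \<in> sets lebesgue"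
  shows "AE x in lebesgue. x \<notin> A \<longrightarrow>
    ((\<lambda>\<epsilon>. measure lebesgue (A \<inter> ball x \<epsilon>) / measure lebesgue (ball x \<epsilon>)) \<longlongrightarrow> 0) (at_right 0)"
proof -
  define N where "N k R = {x \<in> ball 0 R - A. \<forall>d>0. \<exists>\<epsilon>. 0 < \<epsilon> \<and> \<epsilon> < d \<and>
    measure lebesgue (ball x \<epsilon>) < k * measure lebesgue (A \<inter> ball x \<epsilon>)}" for k R
  have "negligible (N (real (Suc k)) (real R))" for k R
    unfolding N_def by (rule negligible_upper_density_points[OF A]) simp
  then have "negligible (\<Union>k::nat. \<Union>R::nat. N (real (Suc k)) (real R))"
    by (auto intro!: negligible_countable_Union)
  then have "AE x in lebesgue. x \<notin> (\<Union>k::nat. \<Union>R::nat. N (real (Suc k)) (real R))"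
    by (intro AE_not_in) (simp add: negligible_iff_null_sets)
  then show ?thesis
  proof eventually_elim
    fix x assume x: "x \<notin> (\<Union>k::nat. \<Union>R::nat. N (real (Suc k)) (real R))"
    show "x \<notin> A \<longrightarrow> ((\<lambda>\<epsilon>. measure lebesgue (A \<inter> ball x \<epsilon>) / measure lebesgue (ball x \<epsilon>)) \<longlongrightarrow> 0) (at_right 0)"
    proof (intro impI tendstoI)
      fix e :: real assume xA: "x \<notin> A" and e: "0 < e"
      obtain R :: nat where R: "norm x < real R" using reals_Archimedean2 by blast
      obtain k :: nat where k: "1 / real (Suc k) < e" using nat_approx_posE[OF e] by auto
      have "x \<notin> N (real (Suc k)) (real R)" using x by auto
      then have "\<exists>d>0. \<forall>\<epsilon>. 0 < \<epsilon> \<longrightarrow> \<epsilon> < d \<longrightarrow>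
          real (Suc k) * measure lebesgue (A \<inter> ball x \<epsilon>) \<le> measure lebesgue (ball x \<epsilon>)"
        using xA R by (simp add: N_def not_less del: of_nat_Suc) (meson not_less)
      then obtain d where d: "0 < d" "\<And>\<epsilon>. 0 < \<epsilon> \<Longrightarrow> \<epsilon> < d \<Longrightarrow>
          real (Suc k) * measure lebesgue (A \<inter> ball x \<epsilon>) \<le> measure lebesgue (ball x \<epsilon>)"
        by blast
      have "\<forall>\<^sub>F \<epsilon> in at_right 0. \<epsilon> \<in> {0<..<d}" by (rule eventually_at_right_real[OF d(1)])
      then show "\<forall>\<^sub>F \<epsilon> in at_right 0. dist (measure lebesgue (A \<inter> ball x \<epsilon>) / measure lebesgue (ball x \<epsilon>)) 0 < e"
      proof eventually_elim
        fix \<epsilon> assume "\<epsilon> \<in> {0<..<d}"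
        then have \<epsilon>: "0 < \<epsilon>" "real (Suc k) * measure lebesgue (A \<inter> ball x \<epsilon>) \<le> measure lebesgue (ball x \<epsilon>)"
          using d(2) by auto
        have pos: "0 < measure lebesgue (ball x \<epsilon>)" using content_ball_pos[OF \<epsilon>(1), of x] by simp
        have "measure lebesgue (A \<inter> ball x \<epsilon>) / measure lebesgue (ball x \<epsilon>) \<le> 1 / real (Suc k)"
          using \<epsilon>(2) pos by (simp add: field_simps)
        then show "dist (measure lebesgue (A \<inter> ball x \<epsilon>) / measure lebesgue (ball x \<epsilon>)) 0 < e"
          using k by (simp add: dist_real_def)
      qed
    qed
  qed
qed

lemma AE_evaluation_two_valued:
  fixes X :: "'a::euclidean_space set"
  assumes X: "open X" and A: "A \<in> sets lebesgue" "A \<subseteq> X"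
    and c_meas: "rep c \<in> borel_measurable (lebesgue_on X)"
    and c: "AE x in lebesgue_on X. rep c x = 1 + b * indicator A x"
  shows "AE x in lebesgue_on X. evaluation X x c = 1 + b * indicator A x"
proof -
  have XS: "X \<in> sets lebesgue" using X by auto
  have XA: "X - A \<in> sets lebesgue" using XS A by auto
  have c_leb: "AE x in lebesgue. x \<in> X \<longrightarrow> rep c x = 1 + b * indicator A x"
    using c XS by (simp add: AE_restrict_space_iff)
  have "AE x in lebesgue. x \<in> X \<longrightarrow> evaluation X x c = 1 + b * indicator A x"
    using AE_density_zero_outside[OF A(1)] AE_density_zero_outside[OF XA]
  proof eventually_elim
    fix x
    let ?m = "measure lebesgue"
    assume outA: "x \<notin> A \<longrightarrow> ((\<lambda>\<epsilon>. ?m (A \<inter> ball x \<epsilon>) / ?m (ball x \<epsilon>)) \<longlongrightarrow> 0) (at_right 0)"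
      and inA: "x \<notin> X - A \<longrightarrow> ((\<lambda>\<epsilon>. ?m ((X - A) \<inter> ball x \<epsilon>) / ?m (ball x \<epsilon>)) \<longlongrightarrow> 0) (at_right 0)"
    show "x \<in> X \<longrightarrow> evaluation X x c = 1 + b * indicator A x"
    proof
      assume x: "x \<in> X"
      obtain d where d: "0 < d" "ball x d \<subseteq> X" using X x by (meson openE)
      have small: "\<forall>\<^sub>F \<epsilon> in at_right 0. \<epsilon> \<in> {0<..<d}" by (rule eventually_at_right_real[OF d(1)])
      have avg: "1 / ?m (ball x \<epsilon>) * (\<integral>y. rep c y \<partial>lebesgue_on (ball x \<epsilon> \<inter> X)) = 1 + b * (?m (A \<inter> ball x \<epsilon>) / ?m (ball x \<epsilon>))"
        if \<epsilon>: "\<epsilon> \<in> {0<..<d}" for \<epsilon>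
      proof -
        have sub: "ball x \<epsilon> \<subseteq> X" using d \<epsilon> by auto
        have pos: "0 < ?m (ball x \<epsilon>)" using content_ball_pos[of \<epsilon> x] \<epsilon> by simp
        have "(\<integral>y. rep c y \<partial>lebesgue_on (ball x \<epsilon> \<inter> X)) = (\<integral>y. rep c y \<partial>lebesgue_on (ball x \<epsilon>))"
          using sub by (simp add: Int_absorb2)
        also have "\<dots> = (\<integral>y. 1 + b * indicator A y \<partial>lebesgue_on (ball x \<epsilon>))"
        proof (rule integral_cong_AE)
          show "rep c \<in> borel_measurable (lebesgue_on (ball x \<epsilon>))"
            by (rule measurable_restrict_mono[OF c_meas sub])
          show "(\<lambda>y. 1 + b * indicator A y) \<in> borel_measurable (lebesgue_on (ball x \<epsilon>))"
            using A by (intro measurable_restrict_space1) auto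
          show "AE y in lebesgue_on (ball x \<epsilon>). rep c y = 1 + b * indicator A y"
            using c_leb sub by (auto simp: AE_restrict_space_iff elim!: eventually_mono)
        qed
        also have "\<dots> = (\<integral>y. indicator (ball x \<epsilon>) y * (1 + b * indicator A y) \<partial>lebesgue)"
          by (subst integral_restrict_space) auto
        also have "\<dots> = (\<integral>y. indicator (ball x \<epsilon>) y + b * indicator (A \<inter> ball x \<epsilon>) y \<partial>lebesgue)"
          by (intro Bochner_Integration.integral_cong) (auto simp: indicator_def)
        also have "\<dots> = ?m (ball x \<epsilon>) + b * ?m (A \<inter> ball x \<epsilon>)"
        proof -
          have "A \<inter> ball x \<epsilon> \<in> lmeasurable"
            using A by (intro fmeasurable_Int_fmeasurable[of "ball x \<epsilon>", simplified Int_commute]) auto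
          then have "integrable lebesgue (indicator (A \<inter> ball x \<epsilon>) :: 'a \<Rightarrow> real)"
            by (simp only: lmeasurable_iff_integrable)
          moreover have "integrable lebesgue (indicator (ball x \<epsilon>) :: 'a \<Rightarrow> real)"
            using lmeasurable_ball[of x \<epsilon>] by (simp only: lmeasurable_iff_integrable)
          ultimately show ?thesis by simp
        qed
        finally show ?thesis using pos by (simp add: field_simps)
      qed
      have "((\<lambda>\<epsilon>. ?m (A \<inter> ball x \<epsilon>) / ?m (ball x \<epsilon>)) \<longlongrightarrow> indicator A x) (at_right 0)"
      proof (cases "x \<in> A")
        case True
        then have "((\<lambda>\<epsilon>. 1 - ?m ((X - A) \<inter> ball x \<epsilon>) / ?m (ball x \<epsilon>)) \<longlongrightarrow> 1 - 0) (at_right 0)"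
          using inA by (intro tendsto_intros) auto
        moreover have "\<forall>\<^sub>F \<epsilon> in at_right 0. 1 - ?m ((X - A) \<inter> ball x \<epsilon>) / ?m (ball x \<epsilon>) = ?m (A \<inter> ball x \<epsilon>) / ?m (ball x \<epsilon>)"
          using small
        proof eventually_elim
          fix \<epsilon> assume \<epsilon>: "\<epsilon> \<in> {0<..<d}"
          then have sub: "ball x \<epsilon> \<subseteq> X" using d by auto
          have pos: "0 < ?m (ball x \<epsilon>)" using content_ball_pos[of \<epsilon> x] \<epsilon> by simp
          have m1: "A \<inter> ball x \<epsilon> \<in> lmeasurable"
            using A by (intro fmeasurable_Int_fmeasurable[of "ball x \<epsilon>", simplified Int_commute]) auto
          have "(X - A) \<inter> ball x \<epsilon> = ball x \<epsilon> - (A \<inter> ball x \<epsilon>)" using sub by auto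
          then have "?m ((X - A) \<inter> ball x \<epsilon>) = ?m (ball x \<epsilon>) - ?m (A \<inter> ball x \<epsilon>)"
            using m1 by (simp add: measurable_measure_Diff fmeasurableD)
          then show "1 - ?m ((X - A) \<inter> ball x \<epsilon>) / ?m (ball x \<epsilon>) = ?m (A \<inter> ball x \<epsilon>) / ?m (ball x \<epsilon>)"
            using pos by (simp add: field_simps)
        qed
        ultimately show ?thesis using True by (simp add: tendsto_cong)
      qed (use outA in simp)
      then have "((\<lambda>\<epsilon>. 1 + b * (?m (A \<inter> ball x \<epsilon>) / ?m (ball x \<epsilon>))) \<longlongrightarrow> 1 + b * indicator A x) (at_right 0)"
        by (intro tendsto_intros)
      moreover have "\<forall>\<^sub>F \<epsilon> in at_right 0. 1 + b * (?m (A \<inter> ball x \<epsilon>) / ?m (ball x \<epsilon>))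
          = 1 / ?m (ball x \<epsilon>) * (\<integral>y. rep c y \<partial>lebesgue_on (ball x \<epsilon> \<inter> X))"
        using small by eventually_elim (simp only: avg)
      ultimately have "((\<lambda>\<epsilon>. 1 / ?m (ball x \<epsilon>) * (\<integral>y. rep c y \<partial>lebesgue_on (ball x \<epsilon> \<inter> X))) \<longlongrightarrow> 1 + b * indicator A x) (at_right 0)"
        by (simp only: tendsto_cong)
      then have "((\<lambda>\<epsilon>. ereal (1 / ?m (ball x \<epsilon>) * (\<integral>y. rep c y \<partial>lebesgue_on (ball x \<epsilon> \<inter> X)))) \<longlongrightarrow> ereal (1 + b * indicator A x)) (at_right 0)"
        by (rule tendsto_ereal)
      then have "Limsup (at_right 0) (\<lambda>\<epsilon>. ereal (1 / ?m (ball x \<epsilon>) * (\<integral>y. rep c y \<partial>lebesgue_on (ball x \<epsilon> \<inter> X)))) = ereal (1 + b * indicator A x)"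
        by (intro lim_imp_Limsup) simp_all
      then show "evaluation X x c = 1 + b * indicator A x" by (simp only: evaluation_def real_of_ereal.simps)
    qed
  qed
  then show ?thesis using XS by (simp add: AE_restrict_space_iff)
qed

section \<open>Classes of functions and the weak-star topology\<close>

text \<open>The class of \<open>r\<close> modulo equality almost everywhere on \<open>X\<close>, an element of \<open>L\<^sup>\<infinity>\<close> if \<open>r\<close> is
  measurable and essentially bounded.\<close>

definition ae_class :: "'a::euclidean_space set \<Rightarrow> ('a \<Rightarrow> real) \<Rightarrow> ('a \<Rightarrow> real) set" where
  "ae_class X r = ae_rel X `` {r}"

lemma rep_ae_class:
  assumes r: "r \<in> borel_measurable (lebesgue_on X)"
  shows "rep (ae_class X r) \<in> borel_measurable (lebesgue_on X)"
    and "AE x in lebesgue_on X. rep (ae_class X r) x = r x"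
    and "ae_class X (rep (ae_class X r)) = ae_class X r"
proof -
  have "r \<in> ae_class X r" using r by (auto simp: ae_class_def ae_rel_def)
  then have "rep (ae_class X r) \<in> ae_class X r" unfolding rep_def by (rule someI[of "\<lambda>f. f \<in> ae_class X r"])
  then have m: "rep (ae_class X r) \<in> borel_measurable (lebesgue_on X)"
    and eq: "AE x in lebesgue_on X. r x = rep (ae_class X r) x"
    by (auto simp: ae_class_def ae_rel_def)
  show "rep (ae_class X r) \<in> borel_measurable (lebesgue_on X)" by (rule m)
  show "AE x in lebesgue_on X. rep (ae_class X r) x = r x" using eq by eventually_elim simp
  show "ae_class X (rep (ae_class X r)) = ae_class X r"
  proof -
    have "(AE x in lebesgue_on X. rep (ae_class X r) x = g x) \<longleftrightarrow> (AE x in lebesgue_on X. r x = g x)" for g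
    proof
      assume "AE x in lebesgue_on X. rep (ae_class X r) x = g x"
      then show "AE x in lebesgue_on X. r x = g x" using eq by eventually_elim simp
    next
      assume "AE x in lebesgue_on X. r x = g x"
      then show "AE x in lebesgue_on X. rep (ae_class X r) x = g x" using eq by eventually_elim simp
    qed
    then show ?thesis using m r unfolding ae_class_def[of X "rep (ae_class X r)"]
      by (auto simp: ae_rel_def ae_class_def[of X r])
  qed
qed

lemma ae_class_cong:
  assumes "AE x in lebesgue_on X. f x = g x"
    "f \<in> borel_measurable (lebesgue_on X)" "g \<in> borel_measurable (lebesgue_on X)"
  shows "ae_class X f = ae_class X g"
proof -
  have "(AE x in lebesgue_on X. f x = h x) \<longleftrightarrow> (AE x in lebesgue_on X. g x = h x)" for h
  proof
    assume "AE x in lebesgue_on X. f x = h x"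
    then show "AE x in lebesgue_on X. g x = h x" using assms(1) by eventually_elim simp
  next
    assume "AE x in lebesgue_on X. g x = h x"
    then show "AE x in lebesgue_on X. f x = h x" using assms(1) by eventually_elim simp
  qed
  then show ?thesis using assms by (auto simp: ae_class_def ae_rel_def)
qed

lemma pairing_ae_class:
  assumes r: "r \<in> borel_measurable (lebesgue_on X)" and [measurable]: "g \<in> borel_measurable (lebesgue_on X)"
  shows "pairing X (ae_class X r) g = (\<integral>x. r x * g x \<partial>lebesgue_on X)"
proof -
  note [measurable] = rep_ae_class(1)[OF r] r
  show ?thesis unfolding pairing_def
    by (rule integral_cong_AE) (use rep_ae_class(2)[OF r] in \<open>auto elim!: eventually_mono\<close>)
qed

lemma extreme_functionsE:
  assumes "c \<in> extreme_functions X \<alpha>" and "0 < \<alpha>"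
  shows "rep c \<in> borel_measurable (lebesgue_on X)" "AE x in lebesgue_on X. \<bar>rep c x\<bar> \<le> exp \<alpha>"
    "ae_class X (rep c) = c"
proof -
  obtain f where f: "f \<in> borel_measurable (lebesgue_on X)" "AE x in lebesgue_on X. f x \<in> {1, exp \<alpha>}" "c = ae_class X f"
    using assms(1) by (auto simp: extreme_functions_def quotient_def ae_class_def)
  show "rep c \<in> borel_measurable (lebesgue_on X)" "ae_class X (rep c) = c"
    using rep_ae_class[OF f(1)] f(3) by auto
  show "AE x in lebesgue_on X. \<bar>rep c x\<bar> \<le> exp \<alpha>"
    using f(2) rep_ae_class(2)[OF f(1)] unfolding f(3)
    by eventually_elim (use assms(2) in auto)
qed

lemma ae_class_extreme:
  assumes "r \<in> borel_measurable (lebesgue_on X)" "AE x in lebesgue_on X. r x \<in> {1, exp \<alpha>}"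
  shows "ae_class X r \<in> extreme_functions X \<alpha>"
  unfolding extreme_functions_def ae_class_def using assms by (intro quotientI) auto

lemma topspace_weak_star: "topspace (weak_star X) = Linfty X"
proof -
  have "\<exists>g U. Linfty X = {c \<in> Linfty X. pairing X c g \<in> U} \<and> integrable (lebesgue_on X) g \<and> open U"
    by (intro exI[of _ "\<lambda>_. 0"] exI[of _ UNIV]) auto
  then show ?thesis unfolding weak_star_def topology_generated_by_topspace by blast
qed

lemma extreme_subset_Linfty: "extreme_functions X \<alpha> \<subseteq> Linfty X"
proof
  fix c assume "c \<in> extreme_functions X \<alpha>"
  then obtain f where f: "f \<in> borel_measurable (lebesgue_on X)" "AE x in lebesgue_on X. f x \<in> {1, exp \<alpha>}" "c = ae_rel X `` {f}"
    by (auto simp: extreme_functions_def quotient_def)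
  have "AE x in lebesgue_on X. \<bar>f x\<bar> \<le> 1 + exp \<alpha>" using f(2) by eventually_elim auto
  then show "c \<in> Linfty X" unfolding Linfty_def f(3) using f(1) by (intro quotientI) auto
qed

lemma topspace_extreme [simp]: "topspace (extreme_topology X \<alpha>) = extreme_functions X \<alpha>"
  using extreme_subset_Linfty[of X \<alpha>] by (auto simp: extreme_topology_def topspace_weak_star)

lemma openin_extreme_pairing:
  assumes "integrable (lebesgue_on X) g" "open U"
  shows "openin (extreme_topology X \<alpha>) {c \<in> extreme_functions X \<alpha>. pairing X c g \<in> U}"
proof -
  have "openin (weak_star X) {c \<in> Linfty X. pairing X c g \<in> U}"
    unfolding weak_star_def using assms by (intro topology_generated_by_Basis) auto
  then show ?thesis unfolding extreme_topology_def openin_subtopology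
    using extreme_subset_Linfty[of X \<alpha>] by (intro exI[of _ "{c \<in> Linfty X. pairing X c g \<in> U}"]) auto
qed

text \<open>The Borel \<open>\<sigma>\<close>-algebra of the extreme points with the weak-star topology, as a measurable
  space.\<close>

definition extreme_borel :: "'a::euclidean_space set \<Rightarrow> real \<Rightarrow> ('a \<Rightarrow> real) set measure" where
  "extreme_borel X \<alpha> = sigma (extreme_functions X \<alpha>) {U. openin (extreme_topology X \<alpha>) U}"

lemma extreme_borel_simps [simp]:
  shows "space (extreme_borel X \<alpha>) = extreme_functions X \<alpha>"
    and "sets (extreme_borel X \<alpha>) = sigma_sets (extreme_functions X \<alpha>) {U. openin (extreme_topology X \<alpha>) U}"
proof -
  have *: "{U. openin (extreme_topology X \<alpha>) U} \<subseteq> Pow (extreme_functions X \<alpha>)"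
    using openin_subset[of "extreme_topology X \<alpha>"] by auto
  show "space (extreme_borel X \<alpha>) = extreme_functions X \<alpha>"
    unfolding extreme_borel_def by (rule space_measure_of[OF *])
  show "sets (extreme_borel X \<alpha>) = sigma_sets (extreme_functions X \<alpha>) {U. openin (extreme_topology X \<alpha>) U}"
    unfolding extreme_borel_def by (rule sets_measure_of[OF *])
qed

lemma pairing_measurable:
  assumes "integrable (lebesgue_on X) g"
  shows "(\<lambda>c. pairing X c g) \<in> borel_measurable (extreme_borel X \<alpha>)"
proof (rule borel_measurableI)
  fix U :: "real set" assume "open U"
  from openin_extreme_pairing[OF assms this, of \<alpha>]
  have "{c \<in> extreme_functions X \<alpha>. pairing X c g \<in> U} \<in> sets (extreme_borel X \<alpha>)" by auto
  also have "{c \<in> extreme_functions X \<alpha>. pairing X c g \<in> U} = (\<lambda>c. pairing X c g) -` U \<inter> space (extreme_borel X \<alpha>)" by auto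
  finally show "(\<lambda>c. pairing X c g) -` U \<inter> space (extreme_borel X \<alpha>) \<in> sets (extreme_borel X \<alpha>)" .
qed

lemma integrable_indicator_ball:
  assumes X: "X \<in> sets lebesgue"
  shows "integrable (lebesgue_on X) (indicator (ball a r) :: 'a::euclidean_space \<Rightarrow> real)"
proof -
  have "integrable lebesgue (\<lambda>x. indicator X x *\<^sub>R (indicator (ball a r) x :: real))"
    using lmeasurable_ball[of a r] X
    by (intro integrable_mult_indicator) (simp_all add: lmeasurable_iff_integrable)
  then show ?thesis using X by (simp add: integrable_restrict_space)
qed

lemma pairing_separates:
  assumes X: "X \<in> sets lebesgue" and \<alpha>: "0 < \<alpha>" and c: "c \<in> extreme_functions X \<alpha>" "d \<in> extreme_functions X \<alpha>"
    and eq: "\<And>g. integrable (lebesgue_on X) g \<Longrightarrow> pairing X c g = pairing X d g"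
  shows "c = d"
proof -
  note C = extreme_functionsE[OF c(1) \<alpha>] and D = extreme_functionsE[OF c(2) \<alpha>]
  note [measurable] = C(1) D(1)
  have "AE x in lebesgue_on X. (rep c x - rep d x)\<^sup>2 * indicator (ball 0 (real n)) x = 0" for n :: nat
  proof -
    \<comment> \<open>Paired with the difference of \<open>c\<close> and \<open>d\<close>, cut off to be integrable, \<open>c - d\<close> gives
      the integral of the square of the difference over the ball.\<close>
    define g where "g x = (rep c x - rep d x) * indicator (ball 0 (real n)) x" for x
    note ball = integrable_indicator_ball[OF X, of 0 "real n"]
    have g: "integrable (lebesgue_on X) g"
      unfolding g_def left_diff_distrib
      by (intro Bochner_Integration.integrable_diff integrable_bounded_times_integrable[OF C(1,2) ball]
          integrable_bounded_times_integrable[OF D(1,2) ball])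
    have gc: "integrable (lebesgue_on X) (\<lambda>x. rep c x * g x)" "integrable (lebesgue_on X) (\<lambda>x. rep d x * g x)"
      by (intro integrable_bounded_times_integrable[OF C(1,2) g] integrable_bounded_times_integrable[OF D(1,2) g])+
    have sq: "rep c x * g x - rep d x * g x = (rep c x - rep d x)\<^sup>2 * indicator (ball 0 (real n)) x" for x
      by (simp add: g_def power2_eq_square algebra_simps)
    have int: "integrable (lebesgue_on X) (\<lambda>x. (rep c x - rep d x)\<^sup>2 * indicator (ball 0 (real n)) x)"
      using Bochner_Integration.integrable_diff[OF gc] by (simp add: sq)
    have "(\<integral>x. (rep c x - rep d x)\<^sup>2 * indicator (ball 0 (real n)) x \<partial>lebesgue_on X) = 0"
      using eq[OF g] Bochner_Integration.integral_diff[OF gc] unfolding pairing_def sq by simp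
    then show ?thesis
      using integral_nonneg_eq_0_iff_AE[OF int] by simp
  qed
  then have "AE x in lebesgue_on X. \<forall>n::nat. (rep c x - rep d x)\<^sup>2 * indicator (ball 0 (real n)) x = 0"
    by (subst AE_all_countable) blast
  then have "AE x in lebesgue_on X. rep c x = rep d x"
  proof eventually_elim
    fix x assume x: "\<forall>n::nat. (rep c x - rep d x)\<^sup>2 * indicator (ball 0 (real n)) x = 0"
    obtain n :: nat where "norm x < real n" using reals_Archimedean2 by blast
    then show "rep c x = rep d x" using x[rule_format, of n] by simp
  qed
  then show "c = d" using ae_class_cong[OF _ C(1) D(1)] C(3) D(3) by simp
qed

text \<open>Points are closed, as pairings separate them. Therefore finite sets are Borel, and they can
  serve as the compact sets in the inner regularity of a measure with finitely many atoms.\<close>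

lemma singleton_in_extreme_borel:
  assumes X: "X \<in> sets lebesgue" and \<alpha>: "0 < \<alpha>" and c: "c \<in> extreme_functions X \<alpha>"
  shows "{c} \<in> sets (extreme_borel X \<alpha>)"
proof -
  have "openin (extreme_topology X \<alpha>) (extreme_functions X \<alpha> - {c})"
  proof (subst openin_subopen, intro ballI)
    fix d assume d: "d \<in> extreme_functions X \<alpha> - {c}"
    then obtain g where g: "integrable (lebesgue_on X) g" "pairing X d g \<noteq> pairing X c g"
      using pairing_separates[OF X \<alpha>, of d c] c by auto
    then show "\<exists>T. openin (extreme_topology X \<alpha>) T \<and> d \<in> T \<and> T \<subseteq> extreme_functions X \<alpha> - {c}"
      using d openin_extreme_pairing[OF g(1), of "- {pairing X c g}" \<alpha>]
      by (intro exI[of _ "{d \<in> extreme_functions X \<alpha>. pairing X d g \<in> - {pairing X c g}}"]) auto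
  qed
  then have "extreme_functions X \<alpha> - {c} \<in> sets (extreme_borel X \<alpha>)" by auto
  then have "space (extreme_borel X \<alpha>) - (extreme_functions X \<alpha> - {c}) \<in> sets (extreme_borel X \<alpha>)"
    by (rule sets.compl_sets)
  moreover have "space (extreme_borel X \<alpha>) - (extreme_functions X \<alpha> - {c}) = {c}" using c by auto
  ultimately show ?thesis by simp
qed

text \<open>For a left-continuous function, rational arguments suffice in the upper limit. This turns
  the evaluation operator into a countable combination of measurable pairings.\<close>

lemma Limsup_at_right_0_left_continuous:
  fixes f :: "real \<Rightarrow> ereal"
  assumes cont: "\<And>e. 0 < e \<Longrightarrow> (f \<longlongrightarrow> f e) (at_left e)"
  shows "Limsup (at_right 0) f = (INF n::nat. SUP q\<in>{q\<in>\<rat>. 0 < q \<and> q < 1 / real (Suc n)}. f q)"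
proof (rule antisym)
  show "Limsup (at_right 0) f \<le> (INF n::nat. SUP q\<in>{q\<in>\<rat>. 0 < q \<and> q < 1 / real (Suc n)}. f q)"
  proof (rule INF_greatest)
    fix n :: nat
    let ?S = "SUP q\<in>{q\<in>\<rat>. 0 < q \<and> q < 1 / real (Suc n)}. f q"
    have "f e \<le> ?S" if e: "e \<in> {0<..<1 / real (Suc n)}" for e
    proof (rule ccontr)
      assume "\<not> f e \<le> ?S"
      then have "\<forall>\<^sub>F x in at_left e. ?S < f x"
        using cont[of e] e by (auto intro: order_tendstoD(1))
      moreover have "\<forall>\<^sub>F x in at_left e. x \<in> {0<..<e}" using e by (intro eventually_at_left_real) auto
      ultimately have "\<forall>\<^sub>F x in at_left e. ?S < f x \<and> x \<in> {0<..<e}" by (rule eventually_conj)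
      then obtain b where b: "b < e" "\<And>x. b < x \<Longrightarrow> x < e \<Longrightarrow> ?S < f x \<and> x \<in> {0<..<e}"
        unfolding eventually_at_left_field by blast
      obtain q where q: "q \<in> \<rat>" "b < q" "q < e" using Rats_dense_in_real[OF b(1)] by blast
      have "f q \<le> ?S" using q b(2)[OF q(2,3)] e by (intro SUP_upper) auto
      then show False using b(2)[OF q(2,3)] by auto
    qed
    moreover have "\<forall>\<^sub>F e in at_right 0. e \<in> {0<..<1 / real (Suc n)}" by (rule eventually_at_right_real) simp
    ultimately show "Limsup (at_right 0) f \<le> ?S"
      by (intro Limsup_bounded) (auto elim: eventually_mono)
  qed
  show "(INF n::nat. SUP q\<in>{q\<in>\<rat>. 0 < q \<and> q < 1 / real (Suc n)}. f q) \<le> Limsup (at_right 0) f"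
    unfolding Limsup_def
  proof (rule INF_greatest)
    fix Q assume "Q \<in> {Q. eventually Q (at_right (0::real))}"
    then obtain b :: real where b: "0 < b" "\<And>x. 0 < x \<Longrightarrow> x < b \<Longrightarrow> Q x"
      unfolding mem_Collect_eq eventually_at_right_field by blast
    obtain n where n: "1 / real (Suc n) < b" using nat_approx_posE[OF b(1)] by blast
    have "(INF n::nat. SUP q\<in>{q\<in>\<rat>. 0 < q \<and> q < 1 / real (Suc n)}. f q) \<le> (SUP q\<in>{q\<in>\<rat>. 0 < q \<and> q < 1 / real (Suc n)}. f q)"
      by (rule INF_lower) simp
    also have "\<dots> \<le> Sup (f ` Collect Q)" using n b(2) by (intro SUP_subset_mono) auto
    finally show "(INF n::nat. SUP q\<in>{q\<in>\<rat>. 0 < q \<and> q < 1 / real (Suc n)}. f q) \<le> Sup (f ` Collect Q)" .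
  qed
qed

lemma indicator_ball_at_left:
  fixes x y :: "'a::euclidean_space"
  assumes u: "\<And>n::nat. u n < e" "u \<longlonglongrightarrow> e"
  shows "(\<lambda>n. indicator (ball x (u n)) y :: real) \<longlonglongrightarrow> indicator (ball x e) y"
proof (cases "dist x y < e")
  case True
  then have "\<forall>\<^sub>F n in sequentially. dist x y < u n" using u(2) by (intro order_tendstoD(1))
  then have "\<forall>\<^sub>F n in sequentially. indicator (ball x (u n)) y = (indicator (ball x e) y :: real)"
    by eventually_elim (use True in auto)
  then show ?thesis by (rule tendsto_eventually)
next
  case False
  have "indicator (ball x (u n)) y = (indicator (ball x e) y :: real)" for n
    using False u(1)[of n] by auto
  then show ?thesis by simp
qed

lemma integral_over_ball_left_continuous:
  fixes f :: "'a::euclidean_space \<Rightarrow> real"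
  assumes X: "X \<in> sets lebesgue" and f [measurable]: "f \<in> borel_measurable (lebesgue_on X)"
    and b: "AE x in lebesgue_on X. \<bar>f x\<bar> \<le> b"
  shows "((\<lambda>e. \<integral>y. f y * indicator (ball x e) y \<partial>lebesgue_on X) \<longlongrightarrow> (\<integral>y. f y * indicator (ball x e) y \<partial>lebesgue_on X)) (at_left e)"
proof (rule tendsto_at_left_sequentially[of "e - 1"])
  fix u :: "nat \<Rightarrow> real" assume u: "\<And>n. u n < e" "u \<longlonglongrightarrow> e"
  have [measurable]: "(indicator (ball x r) :: 'a \<Rightarrow> real) \<in> borel_measurable (lebesgue_on X)" for r
    using integrable_indicator_ball[OF X, of x r] by (rule borel_measurable_integrable)
  show "(\<lambda>n. \<integral>y. f y * indicator (ball x (u n)) y \<partial>lebesgue_on X) \<longlonglongrightarrow> (\<integral>y. f y * indicator (ball x e) y \<partial>lebesgue_on X)"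
  proof (rule integral_dominated_convergence)
    show "integrable (lebesgue_on X) (\<lambda>y. b * indicator (ball x e) y)"
      using integrable_indicator_ball[OF X, of x e] by simp
    show "AE y in lebesgue_on X. (\<lambda>n. f y * indicator (ball x (u n)) y) \<longlonglongrightarrow> f y * indicator (ball x e) y"
      by (intro AE_I2 tendsto_intros indicator_ball_at_left u)
    show "AE y in lebesgue_on X. norm (f y * indicator (ball x (u n)) y) \<le> b * indicator (ball x e) y" for n
      using b by eventually_elim (use u(1)[of n] in \<open>auto simp: indicator_def\<close>)
  qed measurable
qed simp

lemma evaluation_measurable:
  fixes X :: "'a::euclidean_space set"
  assumes X: "X \<in> sets lebesgue" and \<alpha>: "0 < \<alpha>"
  shows "(\<lambda>c. evaluation X x c) \<in> borel_measurable (extreme_borel X \<alpha>)"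
proof -
  define A where "A c e = 1 / measure lebesgue (ball x e) * pairing X c (indicator (ball x e))" for c e
  have eval: "evaluation X x c = real_of_ereal (INF n::nat. SUP q\<in>{q\<in>\<rat>. 0 < q \<and> q < 1 / real (Suc n)}. ereal (A c q))"
    if c: "c \<in> extreme_functions X \<alpha>" for c
  proof -
    note C = extreme_functionsE[OF c \<alpha>]
    have int_ball: "(\<integral>y. rep c y \<partial>lebesgue_on (ball x e \<inter> X)) = pairing X c (indicator (ball x e))" for e
    proof -
      have "(\<integral>y. rep c y \<partial>lebesgue_on (ball x e \<inter> X)) = (\<integral>y. indicator (ball x e \<inter> X) y *\<^sub>R rep c y \<partial>lebesgue)"
        using X by (subst integral_restrict_space) auto
      also have "\<dots> = (\<integral>y. indicator X y *\<^sub>R (rep c y * indicator (ball x e) y) \<partial>lebesgue)"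
        by (intro Bochner_Integration.integral_cong) (auto simp: indicator_def)
      also have "\<dots> = pairing X c (indicator (ball x e))"
        unfolding pairing_def using X by (subst integral_restrict_space) auto
      finally show ?thesis .
    qed
    have cont: "((\<lambda>e. ereal (A c e)) \<longlongrightarrow> ereal (A c e)) (at_left e)" if e: "0 < e" for e
    proof (rule tendsto_ereal)
      have L1: "((\<lambda>e. pairing X c (indicator (ball x e))) \<longlongrightarrow> pairing X c (indicator (ball x e))) (at_left e)"
        unfolding pairing_def by (rule integral_over_ball_left_continuous[OF X C(1,2)])
      have m: "measure lebesgue (ball x r) = (\<integral>y. 1 * indicator (ball x r) y \<partial>lebesgue_on UNIV)" for r
        by (simp add: measure_restrict_space)
      have L2: "((\<lambda>e. measure lebesgue (ball x e)) \<longlongrightarrow> measure lebesgue (ball x e)) (at_left e)"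
        unfolding m by (rule integral_over_ball_left_continuous[where b = 1]) auto
      have "measure lebesgue (ball x e) \<noteq> 0" using content_ball_pos[OF e, of x] by simp
      then show "((\<lambda>e. A c e) \<longlongrightarrow> A c e) (at_left e)"
        unfolding A_def by (intro tendsto_intros L1 L2)
    qed
    show ?thesis
      unfolding evaluation_def int_ball A_def[symmetric]
      by (subst Limsup_at_right_0_left_continuous) (use cont in auto)
  qed
  have [measurable]: "(\<lambda>c. A c e) \<in> borel_measurable (extreme_borel X \<alpha>)" for e
    unfolding A_def using pairing_measurable[OF integrable_indicator_ball[OF X, of x e], of \<alpha>] by simp
  have cnt: "countable {q\<in>\<rat>. 0 < q \<and> q < 1 / real (Suc n)}" for n
    by (rule countable_subset[OF _ countable_rat]) auto
  have "(\<lambda>c. real_of_ereal (INF n::nat. SUP q\<in>{q\<in>\<rat>. 0 < q \<and> q < 1 / real (Suc n)}. ereal (A c q)))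
      \<in> borel_measurable (extreme_borel X \<alpha>)"
    by (intro borel_measurable_real_of_ereal borel_measurable_INF borel_measurable_SUP borel_measurable_ereal cnt) auto
  then show ?thesis
    by (subst measurable_cong[where g = "\<lambda>c. real_of_ereal (INF n::nat. SUP q\<in>{q\<in>\<rat>. 0 < q \<and> q < 1 / real (Suc n)}. ereal (A c q))"])
       (use eval in auto)
qed

section \<open>Fisher information of private mechanisms\<close>

text \<open>The index \<open>i\<close> is the first one below \<open>n\<close> at which \<open>f\<close> attains its maximum. Breaking ties
  in this way turns the sets of nearest levels into a partition.\<close>

definition first_max :: "nat \<Rightarrow> (nat \<Rightarrow> real) \<Rightarrow> nat \<Rightarrow> bool" where
  "first_max n f i \<longleftrightarrow> i < n \<and> f i = Max (f ` {..<n}) \<and> (\<forall>j<i. f j \<noteq> Max (f ` {..<n}))"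

lemma sum_first_max:
  assumes n: "0 < n"
  shows "(\<Sum>i<n. of_bool (first_max n f i)) = (1::real)"
    and "(\<Sum>i<n. of_bool (first_max n f i) * f i) = Max (f ` {..<n})"
proof -
  define m where "m = Max (f ` {..<n})"
  have "m \<in> f ` {..<n}" unfolding m_def using n by (intro Max_in) auto
  then have "\<exists>i. i < n \<and> f i = m" by auto
  then obtain l where l: "l < n \<and> f l = m" "\<And>j. j < l \<Longrightarrow> \<not> (j < n \<and> f j = m)"
    using exists_least_iff[of "\<lambda>i. i < n \<and> f i = m"] by blast
  have "first_max n f i \<longleftrightarrow> i = l" for i
  proof
    assume i: "first_max n f i"
    then have "\<not> i < l" using l(2) by (auto simp: first_max_def m_def)
    moreover have "\<not> l < i" using i l(1) by (auto simp: first_max_def m_def)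
    ultimately show "i = l" by simp
  next
    assume "i = l"
    moreover have "f j \<noteq> m" if "j < l" for j using l(1) l(2)[OF that] that by simp
    ultimately show "first_max n f i" using l(1) by (simp add: first_max_def m_def)
  qed
  then have *: "of_bool (first_max n f i) * g i = (if i = l then g i else 0)" for i and g :: "nat \<Rightarrow> real"
    by simp
  have sum: "(\<Sum>i<n. of_bool (first_max n f i) * g i) = g l" for g :: "nat \<Rightarrow> real"
    unfolding * using l(1) by simp
  show "(\<Sum>i<n. of_bool (first_max n f i)) = (1::real)" using sum[of "\<lambda>_. 1"] by simp
  show "(\<Sum>i<n. of_bool (first_max n f i) * f i) = Max (f ` {..<n})"
    using sum[of f] l(1) by (simp add: m_def)
qed

lemma sigma_finite_lebesgue: "sigma_finite_measure (lebesgue :: 'a::euclidean_space measure)"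
proof
  show "\<exists>A::'a set set. countable A \<and> A \<subseteq> sets lebesgue \<and> \<Union>A = space lebesgue \<and> (\<forall>a\<in>A. emeasure lebesgue a \<noteq> \<infinity>)"
  proof (intro exI conjI ballI)
    show "\<Union>(range (\<lambda>n::nat. ball (0::'a) (real n))) = space lebesgue"
      using reals_Archimedean2 by (auto simp: dist_norm)
    fix a assume "a \<in> range (\<lambda>n::nat. ball (0::'a) (real n))"
    then show "emeasure lebesgue a \<noteq> \<infinity>" using fmeasurableD2[OF lmeasurable_ball] by fastforce
  qed auto
qed

text \<open>A model on an open set that is differentiable in quadratic mean, with finite information.\<close>

locale DQM_model =
  fixes X :: "'a::euclidean_space set" and \<Theta> :: "real set" and \<alpha> \<theta>0 :: real
    and p :: "real \<Rightarrow> 'a \<Rightarrow> real" and s :: "'a \<Rightarrow> real"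
  assumes open_X: "open X" and \<alpha>_pos: "\<alpha> > 0"
    and model: "density_model (lebesgue_on X) \<Theta> p"
    and dqm: "DQM (lebesgue_on X) \<Theta> p \<theta>0 s"
    and fin: "integrable (density (lebesgue_on X) (\<lambda>x. ennreal (p \<theta>0 x))) (\<lambda>x. (s x)\<^sup>2)"
begin

abbreviation "L \<equiv> lebesgue_on X"
abbreviation "P \<equiv> density (lebesgue_on X) (\<lambda>x. ennreal (p \<theta>0 x))"
abbreviation "E \<equiv> exp \<alpha>"

lemma E1: "1 < E" using \<alpha>_pos by simp

lemma X_sets: "X \<in> sets lebesgue" using open_X by auto

lemma \<theta>0_interior: "\<theta>0 \<in> interior \<Theta>" using dqm by (simp add: DQM_def)

lemma \<theta>0_in: "\<theta>0 \<in> \<Theta>" using \<theta>0_interior interior_subset by auto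

lemma s_meas [measurable]: "s \<in> borel_measurable L" using dqm by (simp add: DQM_def)

lemma p_meas: "\<theta> \<in> \<Theta> \<Longrightarrow> p \<theta> \<in> borel_measurable L"
  and p_nonneg: "\<theta> \<in> \<Theta> \<Longrightarrow> x \<in> X \<Longrightarrow> 0 \<le> p \<theta> x"
  using model by (auto simp: density_model_def)

lemma p0_meas [measurable]: "p \<theta>0 \<in> borel_measurable L" by (rule p_meas[OF \<theta>0_in])

lemma prob_P: "prob_space P" using model \<theta>0_in by (auto simp: density_model_def)

lemma p_integrable: "\<theta> \<in> \<Theta> \<Longrightarrow> integrable L (p \<theta>)"
  by (rule density_modelD(4)[OF model])

lemma s_meas_P: "s \<in> borel_measurable P" by simp

lemma P_integral:
  assumes "f \<in> borel_measurable L"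
  shows "(\<integral>x. f x \<partial>P) = (\<integral>x. f x * p \<theta>0 x \<partial>L)" "integrable P f \<longleftrightarrow> integrable L (\<lambda>x. f x * p \<theta>0 x)"
proof -
  have nn: "AE x in L. 0 \<le> p \<theta>0 x" using p_nonneg[OF \<theta>0_in] by (intro AE_I2) simp
  show "(\<integral>x. f x \<partial>P) = (\<integral>x. f x * p \<theta>0 x \<partial>L)"
    using integral_density[of f L "p \<theta>0"] assms nn by (simp add: mult.commute)
  show "integrable P f \<longleftrightarrow> integrable L (\<lambda>x. f x * p \<theta>0 x)"
    using integrable_density[of f L "p \<theta>0"] assms nn by (simp add: mult.commute)
qed

lemma AE_P: "AE x in L. Q x \<Longrightarrow> AE x in P. Q x"
  by (auto simp: AE_density elim!: eventually_mono)

lemma s2: "integrable L (\<lambda>x. (s x)\<^sup>2 * p \<theta>0 x)"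
  using fin P_integral(2)[of "\<lambda>x. (s x)\<^sup>2"] by simp

lemma s_integrable_P: "integrable P s"
  by (rule prob_space.integrable_of_square_integrable[OF prob_P s_meas_P fin])

lemma score_integrable: "integrable L (\<lambda>x. s x * p \<theta>0 x)"
  using s_integrable_P P_integral(2)[of s] by simp

lemma s_mean_P: "(\<integral>x. s x \<partial>P) = 0"
  using DQM_score_mean_zero[OF dqm model s2] P_integral(1)[of s] by simp

lemma L_nontrivial: "emeasure L (space L) \<noteq> 0"
proof
  assume "emeasure L (space L) = 0"
  then have "AE x in L. ennreal (p \<theta>0 x) = 0"
    by (metis (mono_tags, lifting) AE_I' null_setsI sets.top subsetI mem_Collect_eq)
  then have "(\<integral>\<^sup>+x. ennreal (p \<theta>0 x) \<partial>L) = 0" by (subst nn_integral_0_iff_AE) auto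
  then show False using density_modelD(3)[OF model \<theta>0_in] by simp
qed

lemma sigma_finite_L: "sigma_finite_measure L"
  using X_sets by (intro sigma_finite_measure_restrict_space sigma_finite_lebesgue)

lemma mechanism_event_bounds:
  assumes "(Z, q) \<in> LDP_mechanisms X \<alpha>"
  obtains c where "0 \<le> c"
    "AE x in L. c \<le> measure (measure_pmf (q x)) U \<and> measure (measure_pmf (q x)) U \<le> E * c"
  by (rule AE_pair_ratio_imp_bounds[OF sigma_finite_L L_nontrivial _ _ _ LDP_mechanism_event(2)[OF assms, of U]]) auto

text \<open>The numerator of the private score at the output \<open>z\<close>.\<close>

definition score_mass :: "('a \<Rightarrow> nat pmf) \<Rightarrow> nat \<Rightarrow> real" where
  "score_mass q z = (\<integral>x. pmf (q x) z * (s x * p \<theta>0 x) \<partial>L)"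

lemma mechanism_DQM:
  assumes q: "(Z, q) \<in> LDP_mechanisms X \<alpha>"
  shows "DQM (count_space Z) \<Theta> (privatized_density X p q) \<theta>0
    (\<lambda>z. score_mass q z / privatized_density X p q \<theta>0 z)"
proof -
  have "\<exists>c. 0 \<le> c \<and> (AE x in L. c \<le> pmf (q x) z \<and> pmf (q x) z \<le> E * c)" for z
    by (rule mechanism_event_bounds[OF q, of "{z}"]) (auto simp: measure_pmf_single)
  then obtain c where c: "\<And>z. 0 \<le> c z" "\<And>z. AE x in L. c z \<le> pmf (q x) z \<and> pmf (q x) z \<le> E * c z"
    by metis
  have sum: "(\<Sum>z. ennreal (pmf (q x) z)) \<le> 1" for x
    using nn_integral_pmf[of UNIV "q x"] by (simp add: nn_integral_count_space_nat)
  have c_sum: "(\<Sum>z. ennreal (c z)) \<le> 1"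
    by (rule lower_bounds_sum_le_1[OF L_nontrivial, where k = "\<lambda>z x. pmf (q x) z"])
       (use c(2) sum in auto)
  show ?thesis
    unfolding privatized_density_def[abs_def] score_mass_def
    by (rule privatized_DQM[OF dqm model s2 _ _ _ c(1) c_sum c(2)])
       (use LDP_mechanism_event(1)[OF q, of "{z}" for z] sum in \<open>auto simp: measure_pmf_single\<close>)
qed

lemma mechanism_information:
  assumes q: "(Z, q) \<in> LDP_mechanisms X \<alpha>"
  shows "fisher_information (count_space Z) \<Theta> (privatized_density X p q) \<theta>0
    = (\<integral>\<^sup>+z. ennreal ((score_mass q z / privatized_density X p q \<theta>0 z)\<^sup>2 * privatized_density X p q \<theta>0 z) \<partial>count_space Z)"
  by (rule fisher_information_eq[OF mechanism_DQM[OF q]]) simp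

lemma gain_integral:
  assumes [measurable]: "v \<in> borel_measurable L" and v: "AE x in L. \<bar>v x\<bar> \<le> b"
  shows "integrable P (\<lambda>x. v x * gain t (s x))"
    "(\<integral>x. v x * gain t (s x) \<partial>P) = 2 * t * (\<integral>x. v x * (s x * p \<theta>0 x) \<partial>L) - t\<^sup>2 * (\<integral>x. v x * p \<theta>0 x \<partial>L)"
proof -
  note int = integrable_bounded_times_integrable[OF assms]
  note 1 = int[OF score_integrable] and 2 = int[OF p_integrable[OF \<theta>0_in]]
  have eq: "v x * gain t (s x) * p \<theta>0 x = 2 * t * (v x * (s x * p \<theta>0 x)) - t\<^sup>2 * (v x * p \<theta>0 x)" for x
    by (simp add: gain_def algebra_simps)
  show "integrable P (\<lambda>x. v x * gain t (s x))"
    by (subst P_integral) (auto simp: eq intro!: Bochner_Integration.integrable_diff integrable_mult_right 1 2)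
  show "(\<integral>x. v x * gain t (s x) \<partial>P) = 2 * t * (\<integral>x. v x * (s x * p \<theta>0 x) \<partial>L) - t\<^sup>2 * (\<integral>x. v x * p \<theta>0 x \<partial>L)"
    using 1 2 by (subst P_integral) (auto simp: eq)
qed

lemma gain_at_private_score:
  assumes "v \<in> borel_measurable L" "AE x in L. \<bar>v x\<bar> \<le> b"
  defines "t \<equiv> (\<integral>x. v x * (s x * p \<theta>0 x) \<partial>L) / (\<integral>x. v x * p \<theta>0 x \<partial>L)"
  shows "(\<integral>x. v x * gain t (s x) \<partial>P) = t\<^sup>2 * (\<integral>x. v x * p \<theta>0 x \<partial>L)"
  unfolding gain_integral(2)[OF assms(1,2)] by (simp add: t_def power2_eq_square)

text \<open>\<open>K\<close> bounds the values of all codebooks.\<close>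

definition codebook_bound :: "real \<Rightarrow> bool" where
  "codebook_bound K \<longleftrightarrow> (\<forall>n t. 0 < n \<longrightarrow>
     (E - 1) * (\<integral>x. Max ((\<lambda>i. gain (t i) (s x)) ` {..<n}) \<partial>P) - (\<Sum>i<n. (t i)\<^sup>2) \<le> K * (E - 1 + real n))"

text \<open>For the first \<open>N\<close> outputs of a mechanism, all others are merged into one more output, with
  level \<open>0\<close> and hence no gain. The resulting mechanism is finite.\<close>

lemma mechanism_information_le:
  assumes K: "codebook_bound K" and q: "(Z, q) \<in> LDP_mechanisms X \<alpha>"
  shows "fisher_information (count_space Z) \<Theta> (privatized_density X p q) \<theta>0 \<le> ennreal K"
proof -
  interpret P: prob_space P by (rule prob_P)
  define pt where "pt z = privatized_density X p q \<theta>0 z" for z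
  define t where "t z = score_mass q z / pt z" for z
  have pt0: "0 \<le> pt z" for z
    unfolding pt_def privatized_density_def using p_nonneg[OF \<theta>0_in] by (intro integral_nonneg_AE AE_I2) auto
  have partial: "(\<Sum>z<N. (t z)\<^sup>2 * pt z) \<le> K" for N
  proof -
    \<comment> \<open>The event \<open>U z\<close> is reported as the output \<open>z\<close>; the output \<open>N\<close> stands for all \<open>z \<ge> N\<close>.\<close>
    define U where "U z = (if z < N then {z} else {N..})" for z
    define v where "v z x = measure (measure_pmf (q x)) (U z)" for z x
    define \<tau> where "\<tau> z = (if z < N then t z else 0)" for z
    have "\<exists>c. 0 \<le> c \<and> (AE x in L. c \<le> v z x \<and> v z x \<le> E * c)" for z
      unfolding v_def by (rule mechanism_event_bounds[OF q, of "U z"]) auto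
    then obtain c where c: "\<And>z. 0 \<le> c z" "\<And>z. AE x in L. c z \<le> v z x \<and> v z x \<le> E * c z" by metis
    have v_meas: "v z \<in> borel_measurable L" for z
      unfolding v_def[abs_def] by (rule LDP_mechanism_event(1)[OF q])
    have v_bd: "AE x in L. \<bar>v z x\<bar> \<le> 1" for z by (simp add: v_def)
    have v_sum: "(\<Sum>z\<in>{..N}. v z x) = 1" for x
    proof -
      have "(\<Sum>z\<in>{..N}. v z x) = (\<Sum>z<N. pmf (q x) z) + measure (measure_pmf (q x)) {N..}"
        by (simp add: lessThan_Suc_atMost[symmetric] v_def U_def measure_pmf_single)
      also have "(\<Sum>z<N. pmf (q x) z) = measure (measure_pmf (q x)) {..<N}"
        by (simp add: measure_measure_pmf_finite)
      also have "measure (measure_pmf (q x)) {..<N} + measure (measure_pmf (q x)) {N..} = measure (measure_pmf (q x)) ({..<N} \<union> {N..})"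
        by (rule measure_pmf.finite_measure_Union[symmetric]) auto
      also have "{..<N} \<union> {N..} = (UNIV :: nat set)" by auto
      finally show ?thesis by simp
    qed
    have "(\<Sum>z\<in>{..N}. \<integral>x. v z x * gain (\<tau> z) (s x) \<partial>P) \<le> K"
    proof (rule P.finite_mechanism_gain_le[OF s_integrable_P s_mean_P E1])
      show "(E - 1) * (\<integral>x. Max ((\<lambda>j. gain (\<sigma> j) (s x)) ` J) \<partial>P) - (\<Sum>j\<in>J. (\<sigma> j)\<^sup>2) \<le> K * (E - 1 + real (card J))"
        if "finite J" "J \<noteq> {}" for J :: "nat set" and \<sigma>
        by (rule codebook_bound_reindex[OF _ that, where g = "\<lambda>t x. gain t (s x)"]) (use K in \<open>auto simp: codebook_bound_def\<close>)
      show "AE x in P. \<forall>z\<in>{..N}. c z \<le> v z x \<and> v z x \<le> E * c z"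
        by (rule AE_P) (use c(2) in \<open>simp add: AE_ball_countable\<close>)
      show "AE x in P. (\<Sum>z\<in>{..N}. v z x) = 1" by (simp add: v_sum)
    qed (use v_meas c(1) in auto)
    also have "(\<Sum>z\<in>{..N}. \<integral>x. v z x * gain (\<tau> z) (s x) \<partial>P) = (\<Sum>z<N. (t z)\<^sup>2 * pt z)"
    proof -
      have "(\<integral>x. v z x * gain (\<tau> z) (s x) \<partial>P) = (t z)\<^sup>2 * pt z" if "z < N" for z
      proof -
        have v: "v z = (\<lambda>x. pmf (q x) z)" using that by (auto simp: v_def U_def measure_pmf_single)
        show ?thesis
          using gain_at_private_score[OF v_meas v_bd, of z] that
          unfolding v t_def pt_def score_mass_def privatized_density_def \<tau>_def by simp
      qed
      moreover have "(\<integral>x. v N x * gain (\<tau> N) (s x) \<partial>P) = 0" by (simp add: \<tau>_def gain_def)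
      ultimately show ?thesis by (simp add: lessThan_Suc_atMost[symmetric])
    qed
    finally show ?thesis .
  qed
  have "(\<integral>\<^sup>+z. ennreal ((t z)\<^sup>2 * pt z) \<partial>count_space Z) \<le> (\<integral>\<^sup>+z. ennreal ((t z)\<^sup>2 * pt z) \<partial>count_space UNIV)"
    by (subst nn_integral_count_space_indicator) (auto intro!: nn_integral_mono simp: indicator_def)
  also have "\<dots> = (\<Sum>z. ennreal ((t z)\<^sup>2 * pt z))" by (rule nn_integral_count_space_nat)
  also have "\<dots> \<le> ennreal K"
  proof (rule suminf_le_const)
    fix N
    have "(\<Sum>z<N. ennreal ((t z)\<^sup>2 * pt z)) = ennreal (\<Sum>z<N. (t z)\<^sup>2 * pt z)"
      using pt0 by (intro sum_ennreal) simp
    then show "(\<Sum>z<N. ennreal ((t z)\<^sup>2 * pt z)) \<le> ennreal K" using partial[of N] by (simp add: ennreal_leI)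
  qed simp
  finally show ?thesis unfolding mechanism_information[OF q] t_def pt_def .
qed

text \<open>The randomized response on the partition by nearest levels, for an optimal codebook. Its
  information is at least the value of the codebook, because the private scores are at least as
  good as the levels \<open>t\<close>.\<close>

lemma optimal_mechanism:
  obtains n c A q where "0 < n" "0 < c" "real n * c \<le> 1"
    "\<And>i. i < n \<Longrightarrow> A i \<in> sets lebesgue" "\<And>i. i < n \<Longrightarrow> A i \<subseteq> X"
    "({..<n}, q) \<in> LDP_mechanisms X \<alpha>"
    "\<And>x i. x \<in> X \<Longrightarrow> i < n \<Longrightarrow> pmf (q x) i = c * (1 + (E - 1) * indicator (A i) x)"
    "max_private_information X \<alpha> \<Theta> p \<theta>0 =
      fisher_information (count_space {..<n}) \<Theta> (privatized_density X p q) \<theta>0"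
proof -
  interpret P: prob_space P by (rule prob_P)
  obtain n t where n: "0 < n" and best: "\<And>n' t'. 0 < n' \<Longrightarrow>
      ((E - 1) * (\<integral>x. Max ((\<lambda>i. gain (t' i) (s x)) ` {..<n'}) \<partial>P) - (\<Sum>i<n'. (t' i)\<^sup>2)) / (E - 1 + real n')
      \<le> ((E - 1) * (\<integral>x. Max ((\<lambda>i. gain (t i) (s x)) ` {..<n}) \<partial>P) - (\<Sum>i<n. (t i)\<^sup>2)) / (E - 1 + real n)"
    by (rule P.codebook_value_attained[OF fin s_meas_P E1]) (rule that)
  define c where "c = 1 / (E - 1 + real n)"
  have den: "0 < E - 1 + real n" using E1 by linarith
  have c0: "0 < c" unfolding c_def using den by (rule divide_pos_pos[OF zero_less_one])
  have c1: "c * (E - 1 + real n) = 1" unfolding c_def using den by simp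
  have "c * real n \<le> c * (E - 1 + real n)" using c0 E1 by (intro mult_left_mono) linarith+
  then have c: "0 < c" "real n * c \<le> 1" "c * (E - 1 + real n) = 1" using c0 c1 by (auto simp: mult.commute)
  define K where "K = ((E - 1) * (\<integral>x. Max ((\<lambda>i. gain (t i) (s x)) ` {..<n}) \<partial>P) - (\<Sum>i<n. (t i)\<^sup>2)) * c"
  have K: "codebook_bound K"
    unfolding codebook_bound_def
  proof (intro allI impI)
    fix n' :: nat and t' :: "nat \<Rightarrow> real" assume n': "0 < n'"
    have "0 < E - 1 + real n'" using E1 by linarith
    then show "(E - 1) * (\<integral>x. Max ((\<lambda>i. gain (t' i) (s x)) ` {..<n'}) \<partial>P) - (\<Sum>i<n'. (t' i)\<^sup>2) \<le> K * (E - 1 + real n')"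
      using best[OF n', of t'] by (simp add: divide_le_eq K_def c_def)
  qed
  define B where "B x = first_max n (\<lambda>i. gain (t i) (s x))" for x
  define A where "A i = {x \<in> X. B x i}" for i
  define v where "v i x = (if i < n then c * (1 + (E - 1) * of_bool (B x i)) else 0)" for i x
  have v0: "0 \<le> v i x" for i x using c(1) E1 by (simp add: v_def)
  have v_sum: "(\<Sum>i<n. v i x) = 1" for x
  proof -
    have "(\<Sum>i<n. v i x) = (\<Sum>i<n. c + c * (E - 1) * of_bool (B x i))"
      by (intro sum.cong) (auto simp: v_def algebra_simps)
    also have "\<dots> = real n * c + c * (E - 1)"
      unfolding sum.distrib sum_distrib_left[symmetric] B_def sum_first_max(1)[OF n] by simp
    finally show ?thesis using c(3) by (simp add: algebra_simps)
  qed
  define q where "q x = embed_pmf (\<lambda>i. v i x)" for x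
  have pmf_q: "pmf (q x) i = v i x" for x i
    unfolding q_def
  proof (rule pmf_embed_pmf[OF v0])
    have "(\<integral>\<^sup>+i. ennreal (v i x) \<partial>count_space UNIV) = (\<integral>\<^sup>+i. ennreal (v i x) \<partial>count_space {..<n})"
      by (subst (2) nn_integral_count_space_indicator) (auto intro!: nn_integral_cong simp: v_def indicator_def)
    also have "\<dots> = ennreal (\<Sum>i<n. v i x)" using v0 by (simp add: nn_integral_count_space_finite sum_ennreal)
    finally show "(\<integral>\<^sup>+i. ennreal (v i x) \<partial>count_space UNIV) = 1" by (simp add: v_sum)
  qed
  have B_meas: "{x \<in> space L. B x i} \<in> sets L" for i
    unfolding B_def first_max_def by measurable
  have A_sets: "A i \<in> sets lebesgue" for i
    using B_meas[of i] X_sets by (simp add: A_def sets_restrict_space_iff)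
  have v_meas [measurable]: "v i \<in> borel_measurable L" for i
  proof -
    have "v i x = (if i < n then c * (1 + (E - 1) * indicator (A i) x) else 0)" if "x \<in> space L" for x
      using that by (auto simp: v_def A_def)
    moreover have "(\<lambda>x. if i < n then c * (1 + (E - 1) * indicator (A i) x) else 0) \<in> borel_measurable L"
      using A_sets[of i] by (intro measurable_restrict_space1) auto
    ultimately show ?thesis by (subst measurable_cong) auto
  qed
  have q_LDP: "({..<n}, q) \<in> LDP_mechanisms X \<alpha>"
  proof -
    have "v i x \<le> E * v i x'" for i x x'
    proof (cases "i < n")
      case True
      have "v i x \<le> c * E" "c \<le> v i x'" using True c(1) E1 by (auto simp: v_def of_bool_def)
      then have "v i x \<le> E * c" "E * c \<le> E * v i x'" by (auto simp: mult.commute)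
      then show ?thesis by linarith
    qed (simp add: v_def)
    moreover have "set_pmf (q x) \<subseteq> {..<n}" for x
      using pmf_q[of x] by (auto simp: set_pmf_iff v_def split: if_splits)
    ultimately show ?thesis by (auto simp: LDP_mechanisms_def pmf_q[abs_def])
  qed
  define pt where "pt i = privatized_density X p q \<theta>0 i" for i
  define \<tau> where "\<tau> i = score_mass q i / pt i" for i
  have v_bd: "AE x in L. \<bar>v i x\<bar> \<le> 1" for i
    unfolding pmf_q[symmetric] by (simp add: pmf_le_1)
  have gain_v: "integrable P (\<lambda>x. v i x * gain u (s x))"
      "(\<integral>x. v i x * gain u (s x) \<partial>P) = 2 * u * score_mass q i - u\<^sup>2 * pt i" for i u
    using gain_integral[OF v_meas v_bd, of i u]
    by (simp_all add: score_mass_def pt_def privatized_density_def pmf_q)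
  have pt0: "0 < pt i" if "i < n" for i
  proof -
    have "c * p \<theta>0 x \<le> v i x * p \<theta>0 x" if "x \<in> X" for x
      using p_nonneg[OF \<theta>0_in that] c(1) E1 \<open>i < n\<close> by (intro mult_right_mono) (auto simp: v_def)
    then have "(\<integral>x. c * p \<theta>0 x \<partial>L) \<le> (\<integral>x. v i x * p \<theta>0 x \<partial>L)"
      using p_integrable[OF \<theta>0_in] integrable_bounded_times_integrable[OF v_meas v_bd p_integrable[OF \<theta>0_in]]
      by (intro integral_mono) auto
    moreover have "(\<integral>x. p \<theta>0 x \<partial>L) = 1" using P_integral(1)[of "\<lambda>_. 1"] P.prob_space by simp
    ultimately show ?thesis using c(1) by (simp add: pt_def privatized_density_def pmf_q)
  qed
  have "K = (\<integral>x. (\<Sum>i<n. v i x * gain (t i) (s x)) \<partial>P)"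
  proof -
    have eq: "(\<Sum>i<n. v i x * gain (t i) (s x))
        = c * ((\<Sum>i<n. gain (t i) (s x)) + (E - 1) * Max ((\<lambda>i. gain (t i) (s x)) ` {..<n}))" for x
    proof -
      have "(\<Sum>i<n. v i x * gain (t i) (s x))
        = (\<Sum>i<n. c * gain (t i) (s x) + c * (E - 1) * (of_bool (B x i) * gain (t i) (s x)))"
        by (intro sum.cong) (auto simp: v_def algebra_simps)
      also have "\<dots> = c * (\<Sum>i<n. gain (t i) (s x)) + c * (E - 1) * Max ((\<lambda>i. gain (t i) (s x)) ` {..<n})"
        unfolding sum.distrib sum_distrib_left[symmetric] B_def
        by (subst sum_first_max(2)[OF n, where f = "\<lambda>i. gain (t i) (s x)"]) (rule refl)
      finally show ?thesis by (simp only: distrib_left mult.assoc)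
    qed
    have i1: "integrable P (\<lambda>x. gain (t i) (s x))" "(\<integral>x. gain (t i) (s x) \<partial>P) = - (t i)\<^sup>2" for i
      by (rule P.integral_gain_score[OF s_integrable_P s_mean_P])+
    define S where "S x = (\<Sum>i<n. v i x * gain (t i) (s x))" for x
    define G where "G x = (\<Sum>i<n. gain (t i) (s x))" for x
    define m where "m x = Max ((\<lambda>i. gain (t i) (s x)) ` {..<n})" for x
    have Sm: "S x = c * (G x + (E - 1) * m x)" for x unfolding S_def G_def m_def by (rule eq)
    have int_S: "integrable P S"
      unfolding S_def[abs_def] by (intro Bochner_Integration.integrable_sum gain_v(1))
    have int_G: "integrable P G"
      unfolding G_def[abs_def] by (intro Bochner_Integration.integrable_sum i1(1))
    have "m x = (S x / c - G x) / (E - 1)" for x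
      unfolding Sm using c(1) E1 by simp
    then have "m = (\<lambda>x. (S x / c - G x) / (E - 1))" by (rule ext)
    then have int_m: "integrable P m"
      by (simp only:) (intro integrable_divide Bochner_Integration.integrable_diff int_S int_G)
    have "(\<integral>x. S x \<partial>P) = c * ((\<integral>x. G x \<partial>P) + (\<integral>x. (E - 1) * m x \<partial>P))"
      unfolding Sm
      by (subst integral_mult_right_zero, subst Bochner_Integration.integral_add[OF int_G integrable_mult_right[OF int_m]]) (rule refl)
    also have "(\<integral>x. G x \<partial>P) = (\<Sum>i<n. \<integral>x. gain (t i) (s x) \<partial>P)"
      unfolding G_def by (intro Bochner_Integration.integral_sum i1(1))
    also have "\<dots> = - (\<Sum>i<n. (t i)\<^sup>2)" by (simp only: i1(2) sum_negf)
    also have "(\<integral>x. (E - 1) * m x \<partial>P) = (E - 1) * (\<integral>x. m x \<partial>P)" by (rule integral_mult_right_zero)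
    also have "c * (- (\<Sum>i<n. (t i)\<^sup>2) + (E - 1) * (\<integral>x. m x \<partial>P)) = ((E - 1) * (\<integral>x. m x \<partial>P) - (\<Sum>i<n. (t i)\<^sup>2)) * c"
      by (rule trans[OF mult.commute]) (rule arg_cong[where f = "\<lambda>y. y * c"], rule uminus_add_conv_diff)
    finally show ?thesis unfolding K_def S_def m_def by (rule sym)
  qed
  also have "\<dots> = (\<Sum>i<n. \<integral>x. v i x * gain (t i) (s x) \<partial>P)"
    by (intro Bochner_Integration.integral_sum gain_v(1))
  also have "\<dots> \<le> (\<Sum>i<n. (\<tau> i)\<^sup>2 * pt i)"
  proof (rule sum_mono)
    fix i assume "i \<in> {..<n}"
    then have pt: "0 < pt i" using pt0 by simp
    have "score_mass q i = \<tau> i * pt i" using pt by (simp add: \<tau>_def)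
    moreover have "2 * t i * (\<tau> i * pt i) - (t i)\<^sup>2 * pt i = (\<tau> i)\<^sup>2 * pt i - (\<tau> i - t i)\<^sup>2 * pt i"
      by (simp add: power2_eq_square algebra_simps)
    ultimately show "(\<integral>x. v i x * gain (t i) (s x) \<partial>P) \<le> (\<tau> i)\<^sup>2 * pt i"
      using pt by (simp add: gain_v(2))
  qed
  finally have K_le: "K \<le> (\<Sum>i<n. (\<tau> i)\<^sup>2 * pt i)" .
  define I where "I = fisher_information (count_space {..<n}) \<Theta> (privatized_density X p q) \<theta>0"
  have "0 \<le> (\<tau> i)\<^sup>2 * pt i" if "i \<in> {..<n}" for i using pt0[of i] that by simp
  then have "I = ennreal (\<Sum>i<n. (\<tau> i)\<^sup>2 * pt i)"
    unfolding I_def mechanism_information[OF q_LDP] \<tau>_def pt_def[symmetric]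
    by (subst nn_integral_count_space_finite) (auto intro: sum_ennreal)
  then have "ennreal K \<le> I" using K_le by (simp add: ennreal_leI)
  moreover have "I \<le> max_private_information X \<alpha> \<Theta> p \<theta>0"
    unfolding max_private_information_def I_def using q_LDP by (intro SUP_upper2) auto
  moreover have "max_private_information X \<alpha> \<Theta> p \<theta>0 \<le> ennreal K"
    unfolding max_private_information_def by (intro SUP_least) (auto intro: mechanism_information_le[OF K])
  ultimately have "max_private_information X \<alpha> \<Theta> p \<theta>0 = I" by (intro antisym) auto
  moreover have "pmf (q x) i = c * (1 + (E - 1) * indicator (A i) x)" if "x \<in> X" "i < n" for x i
    using that by (simp add: pmf_q v_def A_def indicator_def)
  moreover have "A i \<subseteq> X" for i by (auto simp: A_def)
  ultimately show thesis unfolding I_def by (intro that[OF n c(1,2) A_sets _ q_LDP])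
qed

section \<open>The optimal mechanism as a finite measure on the extreme points\<close>

text \<open>A finite mechanism whose kernels are multiples, by a common factor \<open>c\<close>, of two-valued
  functions is represented by the sum of the point masses \<open>c\<close> at their classes. The privatized
  densities differ by the factor \<open>c\<close> only, which the point masses restore.\<close>

lemma atomic_mechanism:
  assumes n: "0 < n" and c: "0 < c" "real n * c \<le> 1"
    and A: "\<And>i. i < n \<Longrightarrow> A i \<in> sets lebesgue" "\<And>i. i < n \<Longrightarrow> A i \<subseteq> X"
    and q: "({..<n}, q) \<in> LDP_mechanisms X \<alpha>"
    and q_A: "\<And>x i. x \<in> X \<Longrightarrow> i < n \<Longrightarrow> pmf (q x) i = c * (1 + (E - 1) * indicator (A i) x)"
  obtains \<mu> where "radon_measure (extreme_topology X \<alpha>) \<mu>" "subprob_space \<mu>"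
    "AE x in L. (\<integral>r. evaluation X x r \<partial>\<mu>) = 1"
    "fisher_information \<mu> \<Theta> (extremal_density X p) \<theta>0 =
      fisher_information (count_space {..<n}) \<Theta> (privatized_density X p q) \<theta>0"
proof -
  define r where "r i x = 1 + (E - 1) * indicator (A i) x" for i x
  have r_meas [measurable]: "r i \<in> borel_measurable L" if "i < n" for i
    unfolding r_def[abs_def] using A(1)[OF that] by (intro measurable_restrict_space1) auto
  define cls where "cls i = ae_class X (r i)" for i
  have cls: "cls i \<in> extreme_functions X \<alpha>" if "i < n" for i
    unfolding cls_def using r_meas[OF that] by (intro ae_class_extreme) (auto simp: r_def indicator_def)
  define N where "N = density (count_space {..<n}) (\<lambda>_. ennreal c)"
  define \<mu> where "\<mu> = distr N (extreme_borel X \<alpha>) cls"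
  have cls_meas [measurable]: "cls \<in> N \<rightarrow>\<^sub>M extreme_borel X \<alpha>" using cls by (auto simp: N_def)
  have sets_\<mu>: "sets \<mu> = sets (extreme_borel X \<alpha>)" and space_\<mu>: "space \<mu> = extreme_functions X \<alpha>"
    by (simp_all add: \<mu>_def)
  have int_\<mu>: "integrable \<mu> f" "(\<integral>y. f y \<partial>\<mu>) = (\<Sum>i<n. c * f (cls i))"
    if [measurable]: "f \<in> borel_measurable (extreme_borel X \<alpha>)" for f :: "('a \<Rightarrow> real) set \<Rightarrow> real"
  proof -
    show "integrable \<mu> f"
      unfolding \<mu>_def using c
      by (subst integrable_distr_eq[OF cls_meas that]) (simp add: N_def integrable_density integrable_count_space)
    have "(\<integral>y. f y \<partial>\<mu>) = (\<integral>i. f (cls i) \<partial>N)" unfolding \<mu>_def by (rule integral_distr) auto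
    also have "\<dots> = (\<Sum>i<n. c * f (cls i))"
      unfolding N_def using c by (simp add: integral_density lebesgue_integral_count_space_finite sum_distrib_left)
    finally show "(\<integral>y. f y \<partial>\<mu>) = (\<Sum>i<n. c * f (cls i))" .
  qed
  have nn_\<mu>: "(\<integral>\<^sup>+y. f y \<partial>\<mu>) = (\<Sum>i<n. ennreal c * f (cls i))"
    if [measurable]: "f \<in> borel_measurable (extreme_borel X \<alpha>)" for f
    unfolding \<mu>_def
    by (subst nn_integral_distr) (auto simp: cls N_def nn_integral_density nn_integral_count_space_finite)
  have em_\<mu>: "emeasure \<mu> B = (\<Sum>i<n. ennreal c * indicator B (cls i))" if "B \<in> sets \<mu>" for B
    using nn_\<mu>[OF borel_measurable_indicator, of B] that[unfolded sets_\<mu>] nn_integral_indicator[OF that] by argo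
  have total: "emeasure \<mu> (space \<mu>) \<le> 1"
  proof -
    have "emeasure \<mu> (space \<mu>) = (\<Sum>i<n. ennreal c)"
      by (subst em_\<mu>[OF sets.top]) (auto simp: space_\<mu> cls)
    also have "\<dots> = ennreal (real n * c)" using c by (simp add: ennreal_mult ennreal_of_nat_eq_real_of_nat)
    also have "\<dots> \<le> 1" using c(2) by simp
    finally show ?thesis .
  qed
  have radon: "radon_measure (extreme_topology X \<alpha>) \<mu>"
    unfolding radon_measure_def
  proof (intro conjI ballI)
    show "space \<mu> = topspace (extreme_topology X \<alpha>)" by (simp add: space_\<mu>)
    show "sets \<mu> = sigma_sets (topspace (extreme_topology X \<alpha>)) {U. openin (extreme_topology X \<alpha>) U}"
      by (simp add: sets_\<mu>)
    fix x assume "x \<in> topspace (extreme_topology X \<alpha>)"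
    then show "\<exists>U. openin (extreme_topology X \<alpha>) U \<and> x \<in> U \<and> emeasure \<mu> U < \<infinity>"
      using total openin_topspace[of "extreme_topology X \<alpha>"]
      by (intro exI[of _ "extreme_functions X \<alpha>"]) (auto simp: space_\<mu> intro: le_less_trans)
  next
    fix B assume B: "B \<in> sets \<mu>"
    \<comment> \<open>The atoms in \<open>B\<close>: a compact Borel set that carries all the mass of \<open>B\<close>.\<close>
    define F where "F = B \<inter> cls ` {..<n}"
    have F_fin: "finite F" "F \<subseteq> extreme_functions X \<alpha>" using cls by (auto simp: F_def)
    have "{y} \<in> sets \<mu>" if "y \<in> F" for y
      unfolding sets_\<mu> using that F_fin(2) by (intro singleton_in_extreme_borel[OF X_sets \<alpha>_pos]) blast
    then have F_sets: "F \<in> sets \<mu>" by (rule sets.countable[OF _ countable_finite[OF F_fin(1)]])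
    have "compactin (extreme_topology X \<alpha>) F"
      using F_fin by (intro finite_imp_compactin) auto
    moreover have "emeasure \<mu> F = emeasure \<mu> B"
      unfolding em_\<mu>[OF F_sets] em_\<mu>[OF B] by (intro sum.cong) (auto simp: F_def indicator_def)
    ultimately show "emeasure \<mu> B = (SUP K\<in>{K. compactin (extreme_topology X \<alpha>) K \<and> K \<subseteq> B}. emeasure \<mu> K)"
      using B by (intro antisym SUP_least SUP_upper2[of F]) (auto simp: F_def intro: emeasure_mono)
  qed
  have sub: "subprob_space \<mu>"
    using total cls[OF n] by (intro subprob_spaceI) (auto simp: space_\<mu>)
  have "AE x in L. evaluation X x (cls i) = r i x" if "i < n" for i
    unfolding r_def
  proof (rule AE_evaluation_two_valued[OF open_X A[OF that]])
    show "rep (cls i) \<in> borel_measurable L" unfolding cls_def by (rule rep_ae_class(1)[OF r_meas[OF that]])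
    show "AE x in L. rep (cls i) x = 1 + (E - 1) * indicator (A i) x"
      unfolding cls_def using rep_ae_class(2)[OF r_meas[OF that]] by (simp add: r_def)
  qed
  then have "AE x in L. \<forall>i\<in>{..<n}. evaluation X x (cls i) = r i x" by (subst AE_ball_countable) auto
  then have eval: "AE x in L. (\<integral>r. evaluation X x r \<partial>\<mu>) = 1"
    using AE_space
  proof eventually_elim
    fix x assume x: "\<forall>i\<in>{..<n}. evaluation X x (cls i) = r i x" "x \<in> space L"
    have "(\<integral>r. evaluation X x r \<partial>\<mu>) = (\<Sum>i<n. c * evaluation X x (cls i))"
      by (rule int_\<mu>(2)[OF evaluation_measurable[OF X_sets \<alpha>_pos]])
    also have "\<dots> = (\<Sum>i<n. pmf (q x) i)" using x q_A by (intro sum.cong) (auto simp: r_def)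
    also have "\<dots> = 1"
      using q x by (intro sum_pmf_eq_1) (auto simp: LDP_mechanisms_def)
    finally show "(\<integral>r. evaluation X x r \<partial>\<mu>) = 1" .
  qed
  have pair: "pairing X (cls i) f = (\<integral>x. r i x * f x \<partial>L)" if "i < n" "f \<in> borel_measurable L" for i f
    unfolding cls_def by (rule pairing_ae_class[OF r_meas[OF that(1)] that(2)])
  have pmf_pair: "(\<integral>x. pmf (q x) i * f x \<partial>L) = c * pairing X (cls i) f" if i: "i < n" and f: "f \<in> borel_measurable L" for i f
  proof -
    have "(\<integral>x. pmf (q x) i * f x \<partial>L) = (\<integral>x. c * (r i x * f x) \<partial>L)"
      using i by (intro Bochner_Integration.integral_cong) (auto simp: q_A r_def)
    then show ?thesis by (simp add: pair[OF i f])
  qed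
  have priv: "privatized_density X p q \<theta> i = c * extremal_density X p \<theta> (cls i)" if "i < n" "\<theta> \<in> \<Theta>" for \<theta> i
    unfolding privatized_density_def extremal_density_def by (rule pmf_pair[OF that(1) p_meas[OF that(2)]])
  define t where "t y = pairing X y (\<lambda>x. s x * p \<theta>0 x) / extremal_density X p \<theta>0 y" for y
  have t_cls: "score_mass q i / privatized_density X p q \<theta>0 i = t (cls i)" if "i < n" for i
    unfolding priv[OF that \<theta>0_in] score_mass_def t_def using c(1) by (subst pmf_pair[OF that]) auto
  have ed_meas: "extremal_density X p \<theta> \<in> borel_measurable (extreme_borel X \<alpha>)" if "\<theta> \<in> \<Theta>" for \<theta>
    unfolding extremal_density_def[abs_def] by (rule pairing_measurable[OF p_integrable[OF that]])
  note [measurable] = ed_meas[OF \<theta>0_in] pairing_measurable[OF score_integrable]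
  have t_meas [measurable]: "t \<in> borel_measurable (extreme_borel X \<alpha>)" unfolding t_def[abs_def] by measurable
  define remZ where "remZ h i = (sqrt (privatized_density X p q (\<theta>0 + h) i) - sqrt (privatized_density X p q \<theta>0 i)
     - 1 / 2 * h * (score_mass q i / privatized_density X p q \<theta>0 i) * sqrt (privatized_density X p q \<theta>0 i))\<^sup>2" for h i
  define rem where "rem h y = (sqrt (extremal_density X p (\<theta>0 + h) y) - sqrt (extremal_density X p \<theta>0 y)
     - 1 / 2 * h * t y * sqrt (extremal_density X p \<theta>0 y))\<^sup>2" for h y
  have rem: "integrable \<mu> (rem h) \<and> (\<integral>y. rem h y \<partial>\<mu>) = (\<integral>i. remZ h i \<partial>count_space {..<n})" if h: "\<theta>0 + h \<in> \<Theta>" for h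
  proof -
    note [measurable] = ed_meas[OF h]
    have m: "rem h \<in> borel_measurable (extreme_borel X \<alpha>)" unfolding rem_def[abs_def] by measurable
    have "c * rem h (cls i) = remZ h i" if i: "i < n" for i
    proof -
      have "remZ h i = (sqrt c * (sqrt (extremal_density X p (\<theta>0 + h) (cls i)) - sqrt (extremal_density X p \<theta>0 (cls i))
        - 1 / 2 * h * t (cls i) * sqrt (extremal_density X p \<theta>0 (cls i))))\<^sup>2"
        unfolding remZ_def t_cls[OF i] unfolding priv[OF i h] priv[OF i \<theta>0_in] real_sqrt_mult
        by (simp only: right_diff_distrib mult_ac)
      then show ?thesis using c(1) by (simp add: rem_def power_mult_distrib)
    qed
    then have "(\<integral>y. rem h y \<partial>\<mu>) = (\<Sum>i<n. remZ h i)" unfolding int_\<mu>(2)[OF m] by (intro sum.cong) auto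
    then show ?thesis using int_\<mu>(1)[OF m] by (simp add: lebesgue_integral_count_space_finite)
  qed
  note ev = eventually_shift_in[OF \<theta>0_interior]
  have DQM_\<mu>: "DQM \<mu> \<Theta> (extremal_density X p) \<theta>0 t"
    unfolding DQM_def
  proof (intro conjI)
    show "\<theta>0 \<in> interior \<Theta>" by (rule \<theta>0_interior)
    show "t \<in> borel_measurable \<mu>" using t_meas by (simp add: \<mu>_def)
    show "\<forall>\<^sub>F h in at 0. integrable \<mu> (\<lambda>y. (sqrt (extremal_density X p (\<theta>0 + h) y) - sqrt (extremal_density X p \<theta>0 y)
       - 1 / 2 * h * t y * sqrt (extremal_density X p \<theta>0 y))\<^sup>2)"
      unfolding rem_def[symmetric] using ev by eventually_elim (use rem in blast)
    have "(\<lambda>h. \<integral>i. remZ h i \<partial>count_space {..<n}) \<in> o[at 0](\<lambda>h. h\<^sup>2)"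
      using mechanism_DQM[OF q] unfolding DQM_def remZ_def by blast
    moreover have "\<forall>\<^sub>F h in at 0. (\<integral>i. remZ h i \<partial>count_space {..<n}) = (\<integral>y. rem h y \<partial>\<mu>)"
      using ev by eventually_elim (use rem in simp)
    ultimately show "(\<lambda>h. \<integral>y. (sqrt (extremal_density X p (\<theta>0 + h) y) - sqrt (extremal_density X p \<theta>0 y)
       - 1 / 2 * h * t y * sqrt (extremal_density X p \<theta>0 y))\<^sup>2 \<partial>\<mu>) \<in> o[at 0](\<lambda>h. h\<^sup>2)"
      unfolding rem_def[symmetric] by (simp only: landau_o.small.in_cong)
  qed
  have "fisher_information \<mu> \<Theta> (extremal_density X p) \<theta>0 = (\<integral>\<^sup>+y. ennreal ((t y)\<^sup>2 * extremal_density X p \<theta>0 y) \<partial>\<mu>)"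
    by (rule fisher_information_eq[OF DQM_\<mu>]) (simp add: \<mu>_def ed_meas \<theta>0_in)
  also have "\<dots> = (\<Sum>i<n. ennreal c * ennreal ((t (cls i))\<^sup>2 * extremal_density X p \<theta>0 (cls i)))"
    by (rule nn_\<mu>) measurable
  also have "\<dots> = (\<Sum>i<n. ennreal ((score_mass q i / privatized_density X p q \<theta>0 i)\<^sup>2 * privatized_density X p q \<theta>0 i))"
  proof (intro sum.cong refl)
    fix i assume "i \<in> {..<n}"
    then have i: "i < n" by simp
    show "ennreal c * ennreal ((t (cls i))\<^sup>2 * extremal_density X p \<theta>0 (cls i))
      = ennreal ((score_mass q i / privatized_density X p q \<theta>0 i)\<^sup>2 * privatized_density X p q \<theta>0 i)"
      unfolding t_cls[OF i] unfolding priv[OF i \<theta>0_in] using c(1) by (subst ennreal_mult'[symmetric]) (auto simp: mult_ac)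
  qed
  also have "\<dots> = fisher_information (count_space {..<n}) \<Theta> (privatized_density X p q) \<theta>0"
    by (simp add: mechanism_information[OF q] nn_integral_count_space_finite)
  finally show thesis using that[OF radon sub eval] by blast
qed

end

theorem theorem3:
  fixes X :: "'a::euclidean_space set" and \<Theta> :: "real set" and \<alpha> \<theta>0 :: real
    and p :: "real \<Rightarrow> 'a \<Rightarrow> real" and s :: "'a \<Rightarrow> real"
  assumes "open X" and "\<alpha> > 0"
    and "density_model (lebesgue_on X) \<Theta> p"
    and "DQM (lebesgue_on X) \<Theta> p \<theta>0 s"
    and "integrable (density (lebesgue_on X) (\<lambda>x. ennreal (p \<theta>0 x))) (\<lambda>x. (s x)\<^sup>2)"
  shows "\<exists>\<mu> :: ('a \<Rightarrow> real) set measure.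
           radon_measure (extreme_topology X \<alpha>) \<mu> \<and> subprob_space \<mu> \<and>
           (AE x in lebesgue_on X. (\<integral>r. evaluation X x r \<partial>\<mu>) = 1) \<and>
           max_private_information X \<alpha> \<Theta> p \<theta>0 =
             fisher_information \<mu> \<Theta> (extremal_density X p) \<theta>0"
proof -
  interpret DQM_model X \<Theta> \<alpha> \<theta>0 p s using assms by unfold_locales
  obtain n c A q where opt: "0 < n" "0 < c" "real n * c \<le> 1"
    "\<And>i. i < n \<Longrightarrow> A i \<in> sets lebesgue" "\<And>i. i < n \<Longrightarrow> A i \<subseteq> X"
    "({..<n}, q) \<in> LDP_mechanisms X \<alpha>"
    "\<And>x i. x \<in> X \<Longrightarrow> i < n \<Longrightarrow> pmf (q x) i = c * (1 + (exp \<alpha> - 1) * indicator (A i) x)"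
    "max_private_information X \<alpha> \<Theta> p \<theta>0 =
      fisher_information (count_space {..<n}) \<Theta> (privatized_density X p q) \<theta>0"
    by (rule optimal_mechanism) (rule that)
  show ?thesis
    by (rule atomic_mechanism[OF opt(1-7)]) (use opt(8) in auto)
qed

end
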